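(* Let $K\subset\mathbb{R}^{d\times m}$, let $U\subset\mathbb{R}^{d\times m}$ be open, and let $1<p<\infty$. Assume that there exist constants $M\ge1$ and $m_*>0$ with the following property: for any $X_0\in U$ there exists a staircase laminate $\nu_{X_0}^\infty$ supported on $K$, with barycenter $X_0$ and construction steps in $U$, satisfying the bound \[ \nu_{X_0}^\infty(\{X:\ |X|>t\})\le M^p(1+|X_0|^p)\,t^{-p}\qquad\text{for all }t>0. \tag{a} \] Then $U$ can be $U$-reduced to $K$ in weak $L^p$. If, in addition to (a), one also has \[ \nu_{X_0}^\infty(\{X:\ |X|>t\})\ge m_*^p\,t^{-p}\qquad\text{for all }t\in(1,\infty) \] (for every $X_0\in U$), then $U$ can be $U$-reduced to $K$ exactly in weak $L^p$.
   Context: Throughout, $|X|$ denotes the Euclidean (Frobenius) norm of a matrix and $|E|$ the Lebesgue measure of a set $E$. Regular domain: a set $\Omega\subset\mathbb{R}^m$ that is open, bounded, connected (in particular nonempty) and whose boundary has zero $m$-dimensional Lebesgue measure. Piecewise affine map: $w\in W^{1,1}(\Omega,\mathbb{R}^d)$, $\Omega$ a regular domain, is piecewise affine if there is an at most countable decomposition $\Omega=\bigcup_i\Omega_i\cup\mathcal{N}$ into pairwise disjoint regular domains $\Omega_i\subset\Omega$ and a null set $\mathcal{N}$ such that $w$ agrees with an affine map $x\mapsto X_ix+b_i$ on each $\Omega_i$. $U$-reducibility: for $U,K\subset\mathbb{R}^{d\times m}$ and $1<p<\infty$, "$U$ can be $U$-reduced to $K$ in weak $L^p$" means that there is a constant $M'=M'(U,K,p)\ge1$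 such that for all $X_0\in U$, $b\in\mathbb{R}^d$, $\varepsilon,\alpha\in(0,1)$, $q\in(1,\infty)$ and every regular domain $\Omega\subset\mathbb{R}^m$ there exists a piecewise affine map $w\in W^{1,1}(\Omega,\mathbb{R}^d)\cap C^\alpha(\overline{\Omega},\mathbb{R}^d)$ with $w(x)=X_0x+b$ on $\partial\Omega$ such that (i) $|\{x\in\Omega:|\nabla w(x)|>t\}|\le (M')^p(1+|X_0|^p)|\Omega|t^{-p}$ for all $t>0$; and, with $\Omega_{err}:=\{x\in\Omega:\nabla w(x)\notin K\}$, (ii) $\nabla w(x)\in U$ for a.e. $x\in\Omega_{err}$; (iii) $\int_{\Omega_{err}}(1+|\nabla w|)^q\,dx<\varepsilon|\Omega|$. "$U$ can be $U$-reduced to $K$ exactly in weak $L^p$" means that in addition there is a constant $m'=m'(U,K,p)>0$ (independent of $\varepsilon$ and the other data) such that the maps $w$ above can be chosen to satisfy also (iv) $|\{x\in\Omega:|\nabla w(x)|>t\}|\ge (m')^p|\Omega|t^{-p}$ for all $t>1$. Elementary splitting: a probability measure $\mu$ on $\mathbb{R}^{d\times m}$ is obtained from a probability measure $\nu$ by elementary splitting if $\nu=\lambda\delta_X+(1-\lambda)\tilde\nu$ for some $\lambda\in(0,1]$ and some probability measure $\tilde\nu$, and there are matrices $B,B'$ and $\lambda'\in(0,1)$ with $X=\lambda'B+(1-\lambda')B'$, $\operatorname{rank}(B'-B)=1$, and $\mu=\lambda(\lambda'\delta_B+(1-\lambda')\delta_{B'})+(1-\lambda)\tilde\nu$. If $X\in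 U$, the splitting is said to originate from $U$. Laminate of finite order: a probability measure obtained from a Dirac mass by finitely many elementary splittings; it has construction steps in $U$ if every one of these splittings originates from $U$. The barycenter of $\sum_i\lambda_i\delta_{X_i}$ is $\sum_i\lambda_iX_i$. Staircase laminate: let $X_0\notin K$. Suppose there are pairwise different matrices $X_n\in\mathbb{R}^{d\times m}\setminus K$, $n=0,1,2,\dots$ (the soaring sequence), probability measures $\mu_n$ ($n\ge1$), each a finite convex combination of Dirac masses at points of $K$, and scalars $\gamma_n\in(0,1)$ such that: (1) for each $n\ge1$, $\omega_n:=(1-\gamma_n)\mu_n+\gamma_n\delta_{X_n}$ is a laminate of finite order with barycenter $X_{n-1}$; (2) $|X_n|$ is strictly increasing with $|X_n|\to\infty$; (3) $\beta_n:=\prod_{k=1}^n\gamma_k\to0$ ($\beta_0:=1$). Put $\nu^N:=\sum_{n=1}^N\beta_{n-1}(1-\gamma_n)\mu_n+\beta_N\delta_{X_N}$ and $\nu^\infty(E):=\lim_{N\to\infty}\nu^N(E)$ for Borel sets $E$, i.e. $\nu^\infty=\sum_{n\ge1}\beta_{n-1}(1-\gamma_n)\mu_n$. This probability measure is called a staircase laminate supported on $K$ with barycenter $X_0$; having barycenter $X_0$ means $\int X\,d\nu^\infty(X)=X_0$ and is part of the notion. It has construction steps in $U$ if each $\omega_n$ is a laminate of finite order with construction steps in $U$ starting from $\delta_{X_{n-1}}$ (so in particular $X_{n-1}\in U$ for all $n\geq 1$). *)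

theory Defs
  imports "HOL-Probability.Probability"
begin

text \<open>
  A \<open>d \<times> m\<close> matrix has type \<^typ>\<open>real^'m^'d\<close>; \<^const>\<open>norm\<close> on this type is the Frobenius norm.
\<close>

subsection \<open>Sobolev maps and piecewise affine maps\<close>

definition regular_domain :: "(real^'m) set \<Rightarrow> bool" where
  "regular_domain \<Omega> \<longleftrightarrow>
     open \<Omega> \<and> bounded \<Omega> \<and> connected \<Omega> \<and> \<Omega> \<noteq> {} \<and> frontier \<Omega> \<in> null_sets lebesgue"

definition partial_deriv :: "'m \<Rightarrow> (real^'m \<Rightarrow> real) \<Rightarrow> real^'m \<Rightarrow> real" where
  "partial_deriv j \<phi> x = frechet_derivative \<phi> (at x) (axis j 1)"

primrec C_k :: "nat \<Rightarrow> (real^'m \<Rightarrow> real) \<Rightarrow> bool" where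
  "C_k 0 \<phi> \<longleftrightarrow> continuous_on UNIV \<phi>"
| "C_k (Suc k) \<phi> \<longleftrightarrow>
     (\<forall>x. \<phi> differentiable (at x)) \<and> (\<forall>j. C_k k (partial_deriv j \<phi>))"

definition test_function :: "(real^'m) set \<Rightarrow> (real^'m \<Rightarrow> real) \<Rightarrow> bool" where
  "test_function \<Omega> \<phi> \<longleftrightarrow>
     (\<forall>k. C_k k \<phi>) \<and> compact (closure {x. \<phi> x \<noteq> 0}) \<and> closure {x. \<phi> x \<noteq> 0} \<subseteq> \<Omega>"

text \<open>
  \<open>W11_gradient \<Omega> w G\<close> says that \<open>w\<close> belongs to \<open>W\<^sup>1\<^sup>,\<^sup>1(\<Omega>)\<close> and that \<open>G\<close> is (a representative
  of) its weak gradient. The two integrals are vector valued: component \<open>i\<close> reads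
  \<open>\<integral> w\<^sub>i \<partial>\<^sub>j\<phi> = - \<integral> G\<^sub>i\<^sub>j \<phi>\<close>.
\<close>

definition W11_gradient ::
    "(real^'m) set \<Rightarrow> (real^'m \<Rightarrow> real^'d) \<Rightarrow> (real^'m \<Rightarrow> real^'m^'d) \<Rightarrow> bool" where
  "W11_gradient \<Omega> w G \<longleftrightarrow>
     set_integrable lebesgue \<Omega> w \<and> set_integrable lebesgue \<Omega> G \<and>
     (\<forall>\<phi> j. test_function \<Omega> \<phi> \<longrightarrow>
        (LINT x:\<Omega>|lebesgue. partial_deriv j \<phi> x *\<^sub>R w x)
          = - (LINT x:\<Omega>|lebesgue. \<phi> x *\<^sub>R column j (G x)))"

definition W11 :: "(real^'m) set \<Rightarrow> (real^'m \<Rightarrow> real^'d) set" where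
  "W11 \<Omega> = {w. \<exists>G. W11_gradient \<Omega> w G}"

definition piecewise_affine :: "(real^'m) set \<Rightarrow> (real^'m \<Rightarrow> real^'d) \<Rightarrow> bool" where
  "piecewise_affine \<Omega> w \<longleftrightarrow>
     regular_domain \<Omega> \<and> w \<in> W11 \<Omega> \<and>
     (\<exists>\<V> N. countable \<V> \<and> disjoint \<V> \<and> N \<in> null_sets lebesgue \<and> \<Omega> = \<Union>\<V> \<union> N \<and>
        (\<forall>V\<in>\<V>. regular_domain V \<and> V \<subseteq> \<Omega> \<and> (\<exists>X b. \<forall>x\<in>V. w x = X *v x + b)))"

text \<open>On bounded sets a finite Hoelder seminorm already forces a finite sup norm.\<close>

definition holder_on :: "real \<Rightarrow> (real^'m) set \<Rightarrow> (real^'m \<Rightarrow> real^'d) \<Rightarrow> bool" where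
  "holder_on \<alpha> S w \<longleftrightarrow> (\<exists>C. \<forall>x\<in>S. \<forall>y\<in>S. norm (w x - w y) \<le> C * norm (x - y) powr \<alpha>)"


subsection \<open>Reducibility in weak Lp\<close>

definition error_set :: "(real^'m^'d) set \<Rightarrow> (real^'m) set \<Rightarrow> (real^'m \<Rightarrow> real^'m^'d) \<Rightarrow> (real^'m) set"
  where "error_set K \<Omega> G = {x\<in>\<Omega>. G x \<notin> K}"

text \<open>
  \<open>G\<close> plays the role of \<open>\<nabla>w\<close>. All conditions on it are invariant under changes on a null set, so
  the choice of representative is immaterial. The set \<open>K\<close> is arbitrary; the error set is
  nevertheless Lebesgue measurable (but maybe not Borel), because \<open>G\<close> takes only countably many
  values up to a null set.
\<close>

definition reducing_map ::
    "(real^'m^'d) set \<Rightarrow> (real^'m^'d) set \<Rightarrow> real \<Rightarrow> real \<Rightarrow>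
     real^'m^'d \<Rightarrow> real^'d \<Rightarrow> real \<Rightarrow> real \<Rightarrow> real \<Rightarrow> (real^'m) set \<Rightarrow>
     (real^'m \<Rightarrow> real^'d) \<Rightarrow> (real^'m \<Rightarrow> real^'m^'d) \<Rightarrow> bool" where
  "reducing_map U K p M' X\<^sub>0 b \<epsilon> \<alpha> q \<Omega> w G \<longleftrightarrow>
     piecewise_affine \<Omega> w \<and> W11_gradient \<Omega> w G \<and> holder_on \<alpha> (closure \<Omega>) w \<and>
     (\<forall>x\<in>frontier \<Omega>. w x = X\<^sub>0 *v x + b) \<and>
     (\<forall>t>0. measure lebesgue {x\<in>\<Omega>. norm (G x) > t}
              \<le> M' powr p * (1 + norm X\<^sub>0 powr p) * measure lebesgue \<Omega> * t powr (- p)) \<and>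
     (AE x in lebesgue. x \<in> error_set K \<Omega> G \<longrightarrow> G x \<in> U) \<and>
     (\<integral>\<^sup>+ x\<in>error_set K \<Omega> G. ennreal ((1 + norm (G x)) powr q) \<partial>lebesgue)
        < ennreal (\<epsilon> * measure lebesgue \<Omega>)"

definition weak_Lp_reducible :: "(real^'m^'d) set \<Rightarrow> (real^'m^'d) set \<Rightarrow> real \<Rightarrow> bool" where
  "weak_Lp_reducible U K p \<longleftrightarrow>
     (\<exists>M'\<ge>1. \<forall>X\<^sub>0\<in>U. \<forall>b. \<forall>\<epsilon>\<in>{0<..<1}. \<forall>\<alpha>\<in>{0<..<1}. \<forall>q>1. \<forall>\<Omega>. regular_domain \<Omega> \<longrightarrow>
        (\<exists>w G. reducing_map U K p M' X\<^sub>0 b \<epsilon> \<alpha> q \<Omega> w G))"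

definition weak_Lp_exactly_reducible :: "(real^'m^'d) set \<Rightarrow> (real^'m^'d) set \<Rightarrow> real \<Rightarrow> bool" where
  "weak_Lp_exactly_reducible U K p \<longleftrightarrow>
     (\<exists>M'\<ge>1. \<exists>m'>0. \<forall>X\<^sub>0\<in>U. \<forall>b. \<forall>\<epsilon>\<in>{0<..<1}. \<forall>\<alpha>\<in>{0<..<1}. \<forall>q>1. \<forall>\<Omega>. regular_domain \<Omega> \<longrightarrow>
        (\<exists>w G. reducing_map U K p M' X\<^sub>0 b \<epsilon> \<alpha> q \<Omega> w G \<and>
           (\<forall>t>1. measure lebesgue {x\<in>\<Omega>. norm (G x) > t}
                    \<ge> m' powr p * measure lebesgue \<Omega> * t powr (- p))))"


subsection \<open>Laminates of finite order\<close>

definition borel_prob :: "'a::topological_space measure \<Rightarrow> bool" where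
  "borel_prob \<mu> \<longleftrightarrow> prob_space \<mu> \<and> sets \<mu> = sets borel"

text \<open>\<open>convex_mix \<theta> \<mu> \<nu>\<close> is the convex combination \<open>\<theta>\<mu> + (1-\<theta>)\<nu>\<close> of Borel measures.\<close>

definition convex_mix :: "real \<Rightarrow> 'a measure \<Rightarrow> 'a measure \<Rightarrow> 'a::topological_space measure" where
  "convex_mix \<theta> \<mu> \<nu> = measure_of UNIV (sets borel)
     (\<lambda>E. ennreal \<theta> * emeasure \<mu> E + ennreal (1 - \<theta>) * emeasure \<nu> E)"

lemma sets_convex_mix [simp]: "sets (convex_mix \<theta> \<mu> \<nu>) = sets borel"
  unfolding convex_mix_def by (metis sets.sets_measure_of_eq space_borel)

lemma emeasure_convex_mix:
  assumes "sets \<mu> = sets borel" "sets \<nu> = sets borel" "E \<in> sets borel"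
  shows "emeasure (convex_mix \<theta> \<mu> \<nu>) E = ennreal \<theta> * emeasure \<mu> E + ennreal (1 - \<theta>) * emeasure \<nu> E"
proof (rule emeasure_measure_of[OF convex_mix_def])
  show "sets borel \<subseteq> Pow UNIV" by simp
  show "positive (sets (convex_mix \<theta> \<mu> \<nu>))
          (\<lambda>E. ennreal \<theta> * emeasure \<mu> E + ennreal (1 - \<theta>) * emeasure \<nu> E)"
    by (simp add: positive_def)
  show "countably_additive (sets (convex_mix \<theta> \<mu> \<nu>))
          (\<lambda>E. ennreal \<theta> * emeasure \<mu> E + ennreal (1 - \<theta>) * emeasure \<nu> E)"
    unfolding countably_additive_def
    by (auto simp: assms suminf_add[symmetric] suminf_emeasure)
  show "E \<in> sets (convex_mix \<theta> \<mu> \<nu>)" using assms(3) by simp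
qed

definition has_barycenter :: "(real^'m^'d) measure \<Rightarrow> real^'m^'d \<Rightarrow> bool" where
  "has_barycenter \<mu> X\<^sub>0 \<longleftrightarrow> integrable \<mu> (\<lambda>X. X) \<and> integral\<^sup>L \<mu> (\<lambda>X. X) = X\<^sub>0"

text \<open>
  The measure \<open>\<mu>\<close> arises from \<open>\<nu>\<close> by an elementary splitting that originates from \<open>U\<close>;
  \<open>U = UNIV\<close> gives unrestricted elementary splittings.
\<close>

definition elementary_splitting ::
    "(real^'m^'d) set \<Rightarrow> (real^'m^'d) measure \<Rightarrow> (real^'m^'d) measure \<Rightarrow> bool" where
  "elementary_splitting U \<nu> \<mu> \<longleftrightarrow>
     (\<exists>\<theta> X \<nu>' B B' \<theta>'. \<theta> \<in> {0<..1} \<and> borel_prob \<nu>' \<and> \<nu> = convex_mix \<theta> (return borel X) \<nu>' \<and>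
        X \<in> U \<and> \<theta>' \<in> {0<..<1} \<and> X = \<theta>' *\<^sub>R B + (1 - \<theta>') *\<^sub>R B' \<and> rank (B' - B) = 1 \<and>
        \<mu> = convex_mix \<theta> (convex_mix \<theta>' (return borel B) (return borel B')) \<nu>')"

text \<open>Laminates of finite order, started at \<open>\<delta>\<^bsub>X\<^sub>0\<^esub>\<close>, with construction steps in \<open>U\<close>.\<close>

inductive finite_order_laminate ::
    "(real^'m^'d) set \<Rightarrow> real^'m^'d \<Rightarrow> (real^'m^'d) measure \<Rightarrow> bool"
  for U X\<^sub>0 where
  dirac: "finite_order_laminate U X\<^sub>0 (return borel X\<^sub>0)"
| split: "finite_order_laminate U X\<^sub>0 \<nu> \<Longrightarrow> elementary_splitting U \<nu> \<mu> \<Longrightarrow>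
            finite_order_laminate U X\<^sub>0 \<mu>"


subsection \<open>Staircase laminates\<close>

definition finite_dirac_combination :: "(real^'m^'d) set \<Rightarrow> (real^'m^'d) measure \<Rightarrow> bool" where
  "finite_dirac_combination K \<mu> \<longleftrightarrow> borel_prob \<mu> \<and>
     (\<exists>S c. finite S \<and> S \<subseteq> K \<and> (\<forall>Y\<in>S. 0 \<le> c Y) \<and> (\<Sum>Y\<in>S. c Y) = 1 \<and>
        (\<forall>E\<in>sets borel. measure \<mu> E = (\<Sum>Y\<in>S. c Y * indicator E Y)))"

definition stair_weight :: "(nat \<Rightarrow> real) \<Rightarrow> nat \<Rightarrow> real" where
  "stair_weight \<gamma> n = (\<Prod>k=1..n. \<gamma> k)"

text \<open>The value \<open>\<nu>\<^sup>N(E)\<close> of the \<open>N\<close>-th partial staircase; \<open>\<mu>\<close> and \<open>\<gamma>\<close> are indexed from \<open>1\<close>.\<close>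

definition partial_staircase ::
    "(nat \<Rightarrow> real^'m^'d) \<Rightarrow> (nat \<Rightarrow> (real^'m^'d) measure) \<Rightarrow> (nat \<Rightarrow> real) \<Rightarrow>
     nat \<Rightarrow> (real^'m^'d) set \<Rightarrow> real" where
  "partial_staircase X \<mu> \<gamma> N E =
     (\<Sum>n=1..N. stair_weight \<gamma> (n - 1) * (1 - \<gamma> n) * measure (\<mu> n) E)
       + stair_weight \<gamma> N * indicator E (X N)"

text \<open>
  \<open>staircase_laminate U K X\<^sub>0 \<nu>\<close>: the measure \<open>\<nu>\<close> is a staircase laminate supported on \<open>K\<close> with
  barycenter \<open>X\<^sub>0\<close> and construction steps in \<open>U\<close>.
\<close>

definition staircase_laminate ::
    "(real^'m^'d) set \<Rightarrow> (real^'m^'d) set \<Rightarrow> real^'m^'d \<Rightarrow> (real^'m^'d) measure \<Rightarrow> bool" where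
  "staircase_laminate U K X\<^sub>0 \<nu> \<longleftrightarrow> borel_prob \<nu> \<and> has_barycenter \<nu> X\<^sub>0 \<and>
     (\<exists>X \<mu> \<gamma>. X 0 = X\<^sub>0 \<and> inj X \<and> (\<forall>n. X n \<notin> K) \<and>
        (\<forall>n\<ge>1. finite_dirac_combination K (\<mu> n) \<and> \<gamma> n \<in> {0<..<1} \<and>
           (let \<omega> = convex_mix (1 - \<gamma> n) (\<mu> n) (return borel (X n))
            in finite_order_laminate U (X (n - 1)) \<omega> \<and> has_barycenter \<omega> (X (n - 1)))) \<and>
        strict_mono (\<lambda>n. norm (X n)) \<and> filterlim (\<lambda>n. norm (X n)) at_top sequentially \<and>
        stair_weight \<gamma> \<longlonglongrightarrow> 0 \<and>
        (\<forall>E\<in>sets borel. (\<lambda>N. partial_staircase X \<mu> \<gamma> N E) \<longlonglongrightarrow> measure \<nu> E))"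

end

theory Submission
  imports Defs
begin

text \<open>
  The maps are built by convex integration with exact gradients, and every map used on the way is
  defined on the whole space, Lipschitz, and affine near almost every point of the domain.

  One splitting \<open>X = \<theta>B + (1 - \<theta>)C\<close> with \<open>B - C = a \<otimes> n\<close> is realized on a box by adding \<open>h a\<close>, where
  \<open>h\<close> is the minimum of a fast sawtooth in direction \<open>n\<close> with slopes \<open>1 - \<theta>\<close>, \<open>-\<theta>\<close> and of \<open>\<delta>g\<close>, with
  \<open>g\<close> a piecewise affine bump that vanishes outside the box. Where the sawtooth is smaller the
  gradient is exactly \<open>B\<close> or \<open>C\<close>; elsewhere it is close to \<open>X\<close>, hence in the open set \<open>U\<close>, although
  the segment from \<open>B\<close> to \<open>C\<close> may leave \<open>U\<close>. The exceptional part is as small as desired, and the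
  volume fractions of \<open>B\<close> and \<open>C\<close> need no computation: the integral of \<open>\<nabla>h\<close> vanishes, and this
  forces them (\<open>gradient_fractions\<close>). A fast sawtooth has small height, so the change is small in
  every Hoelder norm of exponent below \<open>1\<close>. Boxes exhaust an arbitrary open set (\<open>rank_one_splitting\<close>), and induction on
  the splittings realizes laminates of finite order (\<open>finite_order_laminate_realizable\<close>). The
  induction carries only lower bounds for the volumes; upper bounds come for free at the end,
  because the regions are disjoint and the weights sum to \<open>1\<close> (\<open>upper_of_lower_fractions\<close>).

  For a staircase with soaring matrices \<open>X\<^sub>n\<close> this is repeated forever: \<open>R\<^sub>n\<close> is the open region where
  the \<open>n\<close>-th map \<open>w\<^sub>n\<close> has gradient \<open>X\<^sub>n\<close>, and \<open>w\<^sub>n\<close> is modified only in \<open>R\<^sub>n\<close>, where the next laminate of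
  finite order is realized. Tolerances that decrease fast with \<open>n\<close> make the maps converge uniformly
  and in the Hoelder norm, keep the volume of every region within a factor \<open>2\<close> of its weight in the
  staircase laminate (\<open>measure_P\<close>), and make the contribution of the leftover gradients in \<open>U\<close> to the
  \<open>L\<^sup>q\<close> norm small (\<open>measure_err\<close>). The tail bounds for the laminate therefore pass to the gradient of the limit
  with constants \<open>3M\<close> and \<open>m\<^sub>* / 2\<close> (\<open>tail_upper\<close>, \<open>tail_lower\<close>).

  For a Lipschitz map that is affine near almost every point, the pointwise gradient is the weak
  gradient (\<open>W11_gradient_lipschitz\<close>). To pass to the limit one needs convergence of the gradients in
  \<open>L\<^sup>1\<close>, that is, \<open>|X\<^sub>n| |R\<^sub>n| \<rightarrow> 0\<close>. The volume of \<open>R\<^sub>n\<close> is comparable to \<open>\<beta>\<^sub>n\<close>, and \<open>\<beta>\<^sub>n X\<^sub>n\<close> is what is missing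
  in the barycenter of the \<open>n\<close>-th partial staircase; it vanishes in the limit precisely because the
  staircase laminate has barycenter \<open>X\<^sub>0\<close> (\<open>soaring_vanishes\<close>).
\<close>

section \<open>Maps that are affine near a point\<close>

text \<open>
  Writing the gradient as a function \<open>A\<close> covers matrices (\<open>A y = X *v y\<close>) and gradients of scalar
  functions (\<open>A y = v \<bullet> y\<close>) alike.
\<close>

definition affine_near ::
    "('a::real_normed_vector \<Rightarrow> 'b::real_normed_vector) \<Rightarrow> ('a \<Rightarrow> 'b) \<Rightarrow> 'a set" where
  "affine_near f A = {x. \<exists>e>0. \<forall>y\<in>ball x e. f y - f x = A (y - x)}"

abbreviation slope_region :: "('a::real_inner \<Rightarrow> real) \<Rightarrow> 'a \<Rightarrow> 'a set" where
  "slope_region f v \<equiv> affine_near f (\<lambda>y. v \<bullet> y)"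

abbreviation vol :: "'a::euclidean_space set \<Rightarrow> real" where
  "vol \<equiv> measure lebesgue"

lemma affine_near_ball:
  assumes "linear A" "\<And>y. y \<in> ball x e \<Longrightarrow> f y - f x = A (y - x)"
  shows "ball x e \<subseteq> affine_near f A"
proof
  fix z assume z: "z \<in> ball x e"
  then obtain r where r: "r > 0" "ball z r \<subseteq> ball x e"
    using openE[OF open_ball z] by blast
  have "f y - f z = A (y - z)" if "y \<in> ball z r" for y
  proof -
    have "f y - f x = A (y - x)" "f z - f x = A (z - x)" using assms(2) z that r by blast+
    moreover have "A (y - x) = A (y - z) + A (z - x)"
      using linear_add[OF assms(1), of "y - z" "z - x"] by simp
    ultimately show ?thesis by (simp add: algebra_simps)
  qed
  then show "z \<in> affine_near f A" unfolding affine_near_def using r(1) by blast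
qed

lemma affine_nearD:
  assumes "linear A" "x \<in> affine_near f A"
  shows "\<exists>e>0. ball x e \<subseteq> affine_near f A \<and> (\<forall>y\<in>ball x e. f y - f x = A (y - x))"
proof -
  obtain e where e: "e > 0" "\<And>y. y \<in> ball x e \<Longrightarrow> f y - f x = A (y - x)"
    using assms(2) unfolding affine_near_def by blast
  then show ?thesis using affine_near_ball[OF assms(1) e(2)] by blast
qed

lemma open_affine_near: "linear A \<Longrightarrow> open (affine_near f A)"
  unfolding open_contains_ball by (blast dest: affine_nearD)

lemma affine_near_unique:
  fixes A B :: "'a::real_normed_vector \<Rightarrow> 'b::real_normed_vector"
  assumes "linear A" "linear B" "x \<in> affine_near f A" "x \<in> affine_near f B"
  shows "A = B"
proof
  fix v :: 'a
  obtain e1 where e1: "e1 > 0" "ball x e1 \<subseteq> affine_near f A" "\<And>y. y \<in> ball x e1 \<Longrightarrow> f y - f x = A (y - x)"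
    using affine_nearD[OF assms(1,3)] by blast
  obtain e2 where e2: "e2 > 0" "ball x e2 \<subseteq> affine_near f B" "\<And>y. y \<in> ball x e2 \<Longrightarrow> f y - f x = B (y - x)"
    using affine_nearD[OF assms(2,4)] by blast
  note e = e1(1) e2(1) e1(3) e2(3)
  define m where "m = min e1 e2"
  define t where "t = m / (norm v + 1)"
  have m: "m > 0" using e(1,2) by (simp add: m_def)
  have "norm v + 1 > 0" by (simp add: add_nonneg_pos)
  then have t: "t > 0" "t * norm v < m" using m by (simp_all add: t_def pos_divide_less_eq)
  then have "x + t *\<^sub>R v \<in> ball x e1" "x + t *\<^sub>R v \<in> ball x e2" by (auto simp: dist_norm m_def)
  from e(3)[OF this(1)] e(4)[OF this(2)] have "A (t *\<^sub>R v) = B (t *\<^sub>R v)" by simp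
  then show "A v = B v" using t by (simp add: linear_scale assms)
qed

lemma affine_near_cong:
  assumes "open S" "x \<in> S" "\<And>y. y \<in> S \<Longrightarrow> f y = g y" "x \<in> affine_near f A"
  shows "x \<in> affine_near g A"
proof -
  obtain e1 where e1: "e1 > 0" "\<forall>y\<in>ball x e1. f y - f x = A (y - x)"
    using assms(4) unfolding affine_near_def by blast
  obtain e2 where e2: "e2 > 0" "ball x e2 \<subseteq> S" using openE[OF assms(1,2)] by blast
  have "g y - g x = A (y - x)" if "y \<in> ball x (min e1 e2)" for y
  proof -
    have "y \<in> S" using that e2 by auto
    then have "f y = g y" "f x = g x" using assms by auto
    moreover have "f y - f x = A (y - x)" using that e1 by auto
    ultimately show ?thesis by simp
  qed
  then show ?thesis unfolding affine_near_def using e1(1) e2(1)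
    by (intro CollectI exI[of _ "min e1 e2"]) simp
qed

lemma affine_near_add:
  assumes "x \<in> affine_near f A" "x \<in> affine_near g B"
  shows "x \<in> affine_near (\<lambda>y. f y + g y) (\<lambda>y. A y + B y)"
proof -
  obtain e1 e2 where "e1 > 0" "e2 > 0"
      "\<forall>y\<in>ball x e1. f y - f x = A (y - x)" "\<forall>y\<in>ball x e2. g y - g x = B (y - x)"
    using assms unfolding affine_near_def by blast
  then show ?thesis unfolding affine_near_def by (auto simp: add_diff_add intro!: exI[of _ "min e1 e2"])
qed

lemma affine_near_linear_image:
  assumes "x \<in> affine_near f A" "linear L"
  shows "x \<in> affine_near (\<lambda>y. L (f y)) (\<lambda>y. L (A y))"
  using assms unfolding affine_near_def by (auto simp: linear_diff[symmetric])

lemma linear_inner_left: "linear (\<lambda>y. v \<bullet> y)"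
  by (simp add: inner_add_right linearI)

lemma inner_left_eq_iff: "(\<lambda>y. v \<bullet> y) = (\<lambda>y. w \<bullet> y) \<longleftrightarrow> v = w"
  by (metis vector_eq_rdot inner_commute)

lemma affine_near_grad_unique:
  assumes "x \<in> slope_region f v" "x \<in> slope_region f w"
  shows "v = w"
  using affine_near_unique[OF linear_inner_left linear_inner_left assms] by (simp add: inner_left_eq_iff)

lemma affine_near_const: "affine_near (\<lambda>x. c) (\<lambda>y. 0) = UNIV"
  unfolding affine_near_def by (auto intro!: exI[of _ 1])

text \<open>
  An almost-everywhere statement: the pieces are neither named nor counted.
\<close>

definition piecewise_gradients ::
    "('a::euclidean_space) set \<Rightarrow> ('a \<Rightarrow> real) \<Rightarrow> 'a set \<Rightarrow> bool" where
  "piecewise_gradients Q f V \<longleftrightarrow> negligible (Q - (\<Union>v\<in>V. slope_region f v))"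

lemma piecewise_gradients_subset:
  "piecewise_gradients Q f V \<Longrightarrow> Q' \<subseteq> Q \<Longrightarrow> V \<subseteq> V' \<Longrightarrow> piecewise_gradients Q' f V'"
  unfolding piecewise_gradients_def by (erule negligible_subset) blast

text \<open>
  Near such a point the two functions agree only on a hyperplane; the rest is the fact that
  locally negligible sets are negligible.
\<close>

lemma negligible_tie:
  fixes f g :: "'a::euclidean_space \<Rightarrow> real"
  shows "negligible {x. f x = g x \<and> (\<exists>v w. v \<noteq> w \<and> x \<in> slope_region f v \<and> x \<in> slope_region g w)}"
    (is "negligible ?T")
proof (subst locally_negligible_alt, rule ballI)
  fix x assume "x \<in> ?T"
  then obtain v w where *: "f x = g x" "v \<noteq> w" "x \<in> slope_region f v" "x \<in> slope_region g w"
    by blast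
  obtain e1 where e1: "e1 > 0" "ball x e1 \<subseteq> slope_region f v" "\<And>y. y \<in> ball x e1 \<Longrightarrow> f y - f x = v \<bullet> (y - x)"
    using affine_nearD[OF linear_inner_left *(3)] by blast
  obtain e2 where e2: "e2 > 0" "ball x e2 \<subseteq> slope_region g w" "\<And>y. y \<in> ball x e2 \<Longrightarrow> g y - g x = w \<bullet> (y - x)"
    using affine_nearD[OF linear_inner_left *(4)] by blast
  note e = e1(1) e2(1) e1(3) e2(3)
  let ?U = "?T \<inter> ball x (min e1 e2)"
  have "?U \<subseteq> {y. (v - w) \<bullet> y = (v - w) \<bullet> x}"
  proof
    fix y assume y: "y \<in> ?U"
    then have "f y = g y" by blast
    moreover have "f y - f x = v \<bullet> (y - x)" using y e(3)[of y] by simp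
    moreover have "g y - g x = w \<bullet> (y - x)" using y e(4)[of y] by simp
    ultimately show "y \<in> {y. (v - w) \<bullet> y = (v - w) \<bullet> x}" using *(1) by (simp add: inner_diff_left inner_diff_right)
  qed
  moreover have "negligible {y. (v - w) \<bullet> y = (v - w) \<bullet> x}" using *(2) by (intro negligible_hyperplane) simp
  ultimately have "negligible ?U" using negligible_subset by blast
  moreover have "x \<in> ?U" using \<open>x \<in> ?T\<close> e(1,2) by simp
  moreover have "openin (top_of_set ?T) ?U" by (simp add: openin_open_Int)
  ultimately show "\<exists>U. openin (top_of_set ?T) U \<and> x \<in> U \<and> negligible U" by blast
qed

lemma affine_near_less_min:
  fixes f g :: "'a::real_inner \<Rightarrow> real"
  assumes "continuous_on UNIV f" "continuous_on UNIV g" "f x < g x" "x \<in> affine_near f A"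
  shows "x \<in> affine_near (\<lambda>y. min (f y) (g y)) A"
proof (rule affine_near_cong[of "{y. f y < g y}"])
  show "open {y. f y < g y}" using assms open_Collect_less by blast
qed (use assms in auto)

lemma piecewise_gradients_min:
  fixes f g :: "'a::euclidean_space \<Rightarrow> real"
  assumes "continuous_on UNIV f" "continuous_on UNIV g"
    and "piecewise_gradients Q f V" "piecewise_gradients Q g W"
  shows "piecewise_gradients Q (\<lambda>x. min (f x) (g x)) (V \<union> W)"
proof -
  let ?T = "{x. f x = g x \<and> (\<exists>v w. v \<noteq> w \<and> x \<in> slope_region f v \<and> x \<in> slope_region g w)}"
  let ?h = "\<lambda>x. min (f x) (g x)"
  have "x \<in> (\<Union>v\<in>V \<union> W. slope_region ?h v)"
    if "x \<notin> ?T" "v \<in> V" and fx: "x \<in> slope_region f v" and "w \<in> W"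
      and gx: "x \<in> slope_region g w" for x v w
  proof -
    consider "f x < g x" | "g x < f x" | "f x = g x" by linarith
    then show ?thesis
    proof cases
      case 1 then show ?thesis using that affine_near_less_min[OF assms(1,2)] by blast
    next
      case 2
      then have "x \<in> slope_region (\<lambda>y. min (g y) (f y)) w"
        using that affine_near_less_min[OF assms(2,1)] by blast
      then show ?thesis using that by (auto simp: min.commute)
    next
      case 3
      then have "v = w" using that by blast
      obtain e1 where e1: "e1 > 0" "ball x e1 \<subseteq> slope_region f v" "\<And>y. y \<in> ball x e1 \<Longrightarrow> f y - f x = v \<bullet> (y - x)"
        using affine_nearD[OF linear_inner_left fx] by blast
      obtain e2 where e2: "e2 > 0" "ball x e2 \<subseteq> slope_region g w" "\<And>y. y \<in> ball x e2 \<Longrightarrow> g y - g x = w \<bullet> (y - x)"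
        using affine_nearD[OF linear_inner_left gx] by blast
      note e = e1(1) e2(1) e1(3) e2(3)
      have "?h y - ?h x = v \<bullet> (y - x)" if "y \<in> ball x (min e1 e2)" for y
        using that e(3)[of y] e(4)[of y] 3 \<open>v = w\<close> by auto
      then have "x \<in> slope_region ?h v" unfolding affine_near_def
        using e(1,2) by (intro CollectI exI[of _ "min e1 e2"]) simp
      then show ?thesis using that by blast
    qed
  qed
  then have "Q - (\<Union>v\<in>V \<union> W. slope_region ?h v) \<subseteq>
      (Q - (\<Union>v\<in>V. slope_region f v)) \<union> (Q - (\<Union>v\<in>W. slope_region g v)) \<union> ?T"
    by blast
  then show ?thesis using assms(3,4) negligible_tie[of f g] unfolding piecewise_gradients_def
    using negligible_subset[OF negligible_Un[OF negligible_Un]] by blast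
qed

lemma open_imp_sets_lebesgue: "open S \<Longrightarrow> S \<in> sets lebesgue"
  by (simp add: sets_completionI_sets)

text \<open>
  The values on the exceptional null set are arbitrary, and \<open>E\<close> is an arbitrary set; completeness
  of Lebesgue measure takes care of both, because the rest of the preimage is open in \<open>S\<close>.
\<close>

lemma lebesgue_measurable_piecewise:
  fixes f :: "'a::euclidean_space \<Rightarrow> 'b::real_normed_vector"
  assumes S: "S \<in> sets lebesgue"
    and "\<And>i. i \<in> I \<Longrightarrow> open (W i)" "\<And>i x. i \<in> I \<Longrightarrow> x \<in> W i \<Longrightarrow> f x = c i"
    and "negligible (S - (\<Union>i\<in>I. W i))"
  shows "(\<lambda>x. indicator S x *\<^sub>R f x) \<in> borel_measurable lebesgue" "{x\<in>S. f x \<in> E} \<in> sets lebesgue"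
proof -
  have *: "{x\<in>S. f x \<in> E} \<in> sets lebesgue" for E
  proof -
    let ?N = "{x\<in>S. f x \<in> E} - (\<Union>i\<in>I. W i)"
    have eq: "{x\<in>S. f x \<in> E} = (S \<inter> (\<Union>i\<in>{i\<in>I. c i \<in> E}. W i)) \<union> ?N" using assms(3) by auto
    have "negligible ?N" using assms(4) by (rule negligible_subset) auto
    then have "?N \<in> sets lebesgue" by (simp add: negligible_imp_sets)
    moreover have "(\<Union>i\<in>{i\<in>I. c i \<in> E}. W i) \<in> sets lebesgue"
      using assms(2) by (intro open_imp_sets_lebesgue open_UN) auto
    ultimately show ?thesis by (subst eq) (intro sets.Un sets.Int S)
  qed
  then show "{x\<in>S. f x \<in> E} \<in> sets lebesgue" .
  show "(\<lambda>x. indicator S x *\<^sub>R f x) \<in> borel_measurable lebesgue"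
  proof (rule borel_measurableI)
    fix T :: "'b set"
    have "(\<lambda>x. indicator S x *\<^sub>R f x) -` T \<inter> space lebesgue = {x\<in>S. f x \<in> T} \<union> (if 0 \<in> T then - S else {})"
    proof (rule set_eqI)
      fix x
      show "x \<in> (\<lambda>x. indicator S x *\<^sub>R f x) -` T \<inter> space lebesgue \<longleftrightarrow>
          x \<in> {x\<in>S. f x \<in> T} \<union> (if 0 \<in> T then - S else {})"
        by (cases "x \<in> S") auto
    qed
    also have "\<dots> \<in> sets lebesgue"
      using *[of T] sets.compl_sets[OF S] by (auto simp: Compl_eq_Diff_UNIV intro: sets.Un)
    finally show "(\<lambda>x. indicator S x *\<^sub>R f x) -` T \<inter> space lebesgue \<in> sets lebesgue" .
  qed
qed

section \<open>The integral of a gradient\<close>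

text \<open>
  By translation invariance every difference quotient has integral zero; the Lipschitz bound in
  direction \<open>e\<close> allows dominated convergence.
\<close>

lemma integral_directional_derivative_zero:
  fixes f :: "'a::euclidean_space \<Rightarrow> 'b::euclidean_space" and e :: 'a
  assumes cont: "continuous_on UNIV f" and S: "bounded S" "\<And>x. x \<notin> S \<Longrightarrow> f x = 0"
    and lip: "\<And>x t. norm (f (x + t *\<^sub>R e) - f x) \<le> C * \<bar>t\<bar>"
    and g: "g \<in> borel_measurable lebesgue"
    and lim: "AE x in lebesgue. ((\<lambda>t. (1 / t) *\<^sub>R (f (x + t *\<^sub>R e) - f x)) \<longlongrightarrow> g x) (at 0)"
  shows "integrable lebesgue g" "integral\<^sup>L lebesgue g = 0"
proof -
  define q where "q = (\<lambda>k x. real (Suc k) *\<^sub>R (f (x + (1 / real (Suc k)) *\<^sub>R e) - f x))"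
  obtain r where r: "r > 0" "S \<subseteq> cball 0 r"
    using bounded_subset_ballD[OF S(1), of 0] ball_subset_cball by blast
  define T :: "'a set" where "T = cball 0 (r + norm e)"
  have C: "C \<ge> 0" using order_trans[OF norm_ge_zero lip[of 0 1]] by simp
  have fb: "f \<in> borel_measurable borel" by (intro borel_measurable_continuous_onI cont)
  have "integrable lborel (\<lambda>x. indicator (cball 0 r) x *\<^sub>R f x)"
    by (intro borel_integrable_compact) (auto intro: continuous_on_subset[OF cont])
  also have "(\<lambda>x. indicator (cball 0 r) x *\<^sub>R f x) = f"
    using r(2) S(2) by (fastforce simp: indicator_def)
  finally have fi: "integrable lborel f" .
  have fi': "integrable lborel (\<lambda>x. f (x + c))" "(\<integral>x. f (x + c) \<partial>lborel) = integral\<^sup>L lborel f" for c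
  proof -
    have d: "distr lborel borel ((+) c) = lborel" by (rule lborel_distr_plus)
    have "integrable (distr lborel borel ((+) c)) f" using fi by (simp only: d)
    then show "integrable lborel (\<lambda>x. f (x + c))"
      by (subst (asm) integrable_distr_eq) (use fb in \<open>auto simp: add.commute\<close>)
    have "integral\<^sup>L (distr lborel borel ((+) c)) f = (\<integral>x. f (c + x) \<partial>lborel)"
      by (rule integral_distr) (use fb in auto)
    then show "(\<integral>x. f (x + c) \<partial>lborel) = integral\<^sup>L lborel f" by (simp only: d add.commute)
  qed
  have qi: "q k \<in> borel_measurable lebesgue" "integral\<^sup>L lebesgue (q k) = 0" for k
  proof -
    have i: "integrable lborel (q k)" unfolding q_def using fi fi' by simp
    have "integral\<^sup>L lborel (q k) = 0" unfolding q_def using fi fi' by simp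
    then show "integral\<^sup>L lebesgue (q k) = 0" using i by (simp add: integral_completion)
    show "q k \<in> borel_measurable lebesgue" using i by (auto intro!: measurable_completion)
  qed
  have qlim: "AE x in lebesgue. (\<lambda>k. q k x) \<longlonglongrightarrow> g x"
    using lim
  proof eventually_elim
    case (elim x)
    have "filterlim (\<lambda>k. 1 / real (Suc k)) (at 0) sequentially"
      unfolding filterlim_at using LIMSEQ_inverse_real_of_nat by (auto simp: inverse_eq_divide)
    from filterlim_compose[OF elim this] show ?case by (simp add: q_def)
  qed
  have qbd: "norm (q k x) \<le> C * indicator T x" for k x
  proof -
    define t where "t = 1 / real (Suc k)"
    have t: "0 < t" "t \<le> 1" by (auto simp: t_def)
    have qq: "norm (q k x) = norm (f (x + t *\<^sub>R e) - f x) / t" by (simp add: q_def t_def)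
    show ?thesis
    proof (cases "x \<in> T")
      case True
      then show ?thesis using lip[of x t] t unfolding qq by (simp add: divide_le_eq)
    next
      case False
      then have x: "norm x > r + norm e" by (auto simp: T_def)
      have "norm (t *\<^sub>R e) \<le> norm e" using t by (simp add: mult_left_le_one_le)
      then have "norm (x + t *\<^sub>R e) > r" using x norm_diff_ineq[of x "t *\<^sub>R e"] by linarith
      moreover have "norm x > r" using x norm_ge_zero[of e] by linarith
      ultimately have "f (x + t *\<^sub>R e) = 0" "f x = 0" using r(2) S(2) by force+
      then show ?thesis using qq C by simp
    qed
  qed
  have Ti: "integrable lebesgue (\<lambda>x. C * indicator T x)"
    unfolding T_def by (intro integrable_mult_right integrable_real_indicator) (use lmeasurable_cball[of 0 "r + norm e"] in \<open>auto simp: fmeasurable_def\<close>)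
  show "integrable lebesgue g"
    by (rule integrable_dominated_convergence[OF g qi(1) Ti qlim]) (use qbd in auto)
  have "(\<lambda>k. integral\<^sup>L lebesgue (q k)) \<longlonglongrightarrow> integral\<^sup>L lebesgue g"
    by (rule integral_dominated_convergence[OF g qi(1) Ti qlim]) (use qbd in auto)
  then show "integral\<^sup>L lebesgue g = 0" by (simp add: qi LIMSEQ_const_iff)
qed

lemma difference_quotient_affine_near:
  fixes f :: "'a::real_normed_vector \<Rightarrow> 'b::real_normed_vector"
  assumes "linear A" "x \<in> affine_near f A"
  shows "((\<lambda>t. (1 / t) *\<^sub>R (f (x + t *\<^sub>R e) - f x)) \<longlongrightarrow> A e) (at 0)"
proof (rule tendsto_eventually)
  obtain r where r: "r > 0" "\<And>y. y \<in> ball x r \<Longrightarrow> f y - f x = A (y - x)"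
    using assms(2) unfolding affine_near_def by blast
  show "\<forall>\<^sub>F t in at 0. (1 / t) *\<^sub>R (f (x + t *\<^sub>R e) - f x) = A e"
    unfolding eventually_at
  proof (intro exI conjI ballI impI)
    show "0 < r / (norm e + 1)" using r by (simp add: add_nonneg_pos)
    fix t :: real assume t: "t \<noteq> 0 \<and> dist t 0 < r / (norm e + 1)"
    then have "\<bar>t\<bar> * (norm e + 1) < r" by (simp add: pos_less_divide_eq add_nonneg_pos)
    then have "\<bar>t\<bar> * norm e < r" by (simp add: distrib_left)
    then have "x + t *\<^sub>R e \<in> ball x r" by (simp add: dist_norm)
    then have "f (x + t *\<^sub>R e) - f x = A (t *\<^sub>R e)" using r(2)[of "x + t *\<^sub>R e"] by simp
    then show "(1 / t) *\<^sub>R (f (x + t *\<^sub>R e) - f x) = A e"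
      using t by (simp add: linear_scale[OF assms(1)])
  qed
qed

lemma norm_gradient_le:
  assumes lip: "\<And>x y. norm (f x - f y) \<le> L * norm (x - y)" and "linear A" "x \<in> affine_near f A"
  shows "norm (A e) \<le> L * norm e"
proof (rule tendsto_upperbound)
  show "((\<lambda>t. norm ((1 / t) *\<^sub>R (f (x + t *\<^sub>R e) - f x))) \<longlongrightarrow> norm (A e)) (at 0)"
    by (intro tendsto_norm difference_quotient_affine_near assms)
  have "norm ((1 / t) *\<^sub>R (f (x + t *\<^sub>R e) - f x)) \<le> L * norm e" if "t \<noteq> 0" for t
    using lip[of "x + t *\<^sub>R e" x] that by (simp add: divide_le_eq mult_ac)
  then show "\<forall>\<^sub>F t in at 0. norm ((1 / t) *\<^sub>R (f (x + t *\<^sub>R e) - f x)) \<le> L * norm e"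
    unfolding eventually_at by (auto intro!: exI[of _ 1])
qed simp

section \<open>Sawtooth functions and bumps\<close>

lemma abs_min_diff_le:
  fixes a :: real
  shows "\<bar>a - a'\<bar> \<le> N \<Longrightarrow> \<bar>b - b'\<bar> \<le> N \<Longrightarrow> \<bar>min a b - min a' b'\<bar> \<le> N"
  by linarith

text \<open>
  The function of period \<open>1\<close> that rises with slope \<open>1 - \<theta>\<close> on \<open>[0, \<theta>]\<close> and falls with slope \<open>-\<theta>\<close> on
  \<open>[\<theta>, 1]\<close>.
\<close>

definition sawtooth :: "real \<Rightarrow> real \<Rightarrow> real" where
  "sawtooth \<theta> t = min ((1 - \<theta>) * frac t) (\<theta> * (1 - frac t))"

lemma sawtooth_bounds:
  assumes "0 < \<theta>" "\<theta> < 1"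
  shows "0 \<le> sawtooth \<theta> t" "sawtooth \<theta> t \<le> 1"
proof -
  have f: "0 \<le> frac t" "frac t < 1" by (auto simp: frac_lt_1)
  then show "0 \<le> sawtooth \<theta> t" using assms by (simp add: sawtooth_def)
  have "(1 - \<theta>) * frac t \<le> 1 * 1" using f assms by (intro mult_mono) auto
  then show "sawtooth \<theta> t \<le> 1" by (simp add: sawtooth_def)
qed

lemma sawtooth_lipschitz_less:
  assumes \<theta>: "0 < \<theta>" "\<theta> < 1" and "t < u"
  shows "\<bar>sawtooth \<theta> t - sawtooth \<theta> u\<bar> \<le> u - t"
proof (cases "\<lfloor>t\<rfloor> = \<lfloor>u\<rfloor>")
  case True
  then have eq: "frac u - frac t = u - t" by (simp add: frac_def)
  have *: "(1 - \<theta>) * (frac u - frac t) \<le> 1 * (u - t)" "\<theta> * (frac u - frac t) \<le> 1 * (u - t)"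
    "0 \<le> (1 - \<theta>) * (frac u - frac t)" "0 \<le> \<theta> * (frac u - frac t)"
    unfolding eq using \<theta> \<open>t < u\<close> by (intro mult_right_mono mult_nonneg_nonneg; simp)+
  have **: "(1 - \<theta>) * frac t - (1 - \<theta>) * frac u = - ((1 - \<theta>) * (frac u - frac t))"
    "\<theta> * (1 - frac t) - \<theta> * (1 - frac u) = \<theta> * (frac u - frac t)"
    by (simp_all add: algebra_simps)
  show ?thesis unfolding sawtooth_def
    by (rule abs_min_diff_le; use * in \<open>simp only: ** abs_minus_cancel abs_of_nonneg mult_1\<close>)
next
  case False
  then have "\<lfloor>t\<rfloor> + 1 \<le> \<lfloor>u\<rfloor>" using floor_mono[of t u] \<open>t < u\<close> by linarith
  then have *: "1 - frac t + frac u \<le> u - t" unfolding frac_def by linarith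
  have f: "0 \<le> frac t" "frac t < 1" "0 \<le> frac u" "frac u < 1" by (auto simp: frac_lt_1)
  have "sawtooth \<theta> t \<le> \<theta> * (1 - frac t)" "sawtooth \<theta> u \<le> (1 - \<theta>) * frac u" by (auto simp: sawtooth_def)
  moreover have "\<theta> * (1 - frac t) \<le> 1 - frac t" "(1 - \<theta>) * frac u \<le> frac u"
    using \<theta> f by (simp_all add: mult_left_le_one_le)
  ultimately have "sawtooth \<theta> t \<le> 1 - frac t" "sawtooth \<theta> u \<le> frac u" by (meson order_trans)+
  then have "sawtooth \<theta> t \<le> u - t" "sawtooth \<theta> u \<le> u - t" using * f by linarith+
  then show ?thesis using sawtooth_bounds[OF \<theta>, of t] sawtooth_bounds[OF \<theta>, of u] by linarith
qed

lemma sawtooth_lipschitz: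
  assumes "0 < \<theta>" "\<theta> < 1"
  shows "\<bar>sawtooth \<theta> t - sawtooth \<theta> u\<bar> \<le> \<bar>t - u\<bar>"
  using sawtooth_lipschitz_less[OF assms, of t u] sawtooth_lipschitz_less[OF assms, of u t]
  by (cases t u rule: linorder_cases) auto

text \<open>
  The kinks lie on countably many hyperplanes orthogonal to \<open>n\<close>, at the levels where \<open>k (n \<bullet> x)\<close> is
  congruent to \<open>0\<close> or \<open>\<theta>\<close> modulo \<open>1\<close>.
\<close>

lemma piecewise_gradients_sawtooth:
  fixes n :: "'a::euclidean_space"
  assumes \<theta>: "0 < \<theta>" "\<theta> < 1" and "n \<noteq> 0" "k > 0"
  shows "piecewise_gradients UNIV (\<lambda>x. sawtooth \<theta> (k * (n \<bullet> x)) / k) {(1 - \<theta>) *\<^sub>R n, (- \<theta>) *\<^sub>R n}"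
    (is "piecewise_gradients UNIV ?s ?V")
proof -
  define Z where "Z = (\<Union>i::int. {x. n \<bullet> x = of_int i / k}) \<union> (\<Union>i::int. {x. n \<bullet> x = (of_int i + \<theta>) / k})"
  have "negligible Z" unfolding Z_def using \<open>n \<noteq> 0\<close>
    by (intro negligible_Un negligible_countable_Union) (auto intro!: negligible_hyperplane)
  moreover have "x \<in> (\<Union>v\<in>?V. slope_region ?s v)" if "x \<notin> Z" for x
  proof -
    define i where "i = \<lfloor>k * (n \<bullet> x)\<rfloor>"
    have i: "of_int i \<le> k * (n \<bullet> x)" "k * (n \<bullet> x) < of_int i + 1" unfolding i_def by linarith+
    have "k * (n \<bullet> x) \<noteq> of_int i" "k * (n \<bullet> x) \<noteq> of_int i + \<theta>"
      using \<open>x \<notin> Z\<close> \<open>k > 0\<close> unfolding Z_def by (auto simp: field_simps)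
    then consider "x \<in> {x. of_int i < k * (n \<bullet> x)} \<inter> {x. k * (n \<bullet> x) < of_int i + \<theta>}"
      | "x \<in> {x. of_int i + \<theta> < k * (n \<bullet> x)} \<inter> {x. k * (n \<bullet> x) < of_int i + 1}"
      using i by (cases "k * (n \<bullet> x) < of_int i + \<theta>") auto
    then show ?thesis
    proof cases
      case 1
      have eq: "((1 - \<theta>) *\<^sub>R n) \<bullet> y + (- (1 - \<theta>) * i / k) = ?s y"
        if "y \<in> {x. of_int i < k * (n \<bullet> x)} \<inter> {x. k * (n \<bullet> x) < of_int i + \<theta>}" for y
      proof -
        have "\<lfloor>k * (n \<bullet> y)\<rfloor> = i" using that \<theta> by (intro floor_unique) auto
        then have f: "frac (k * (n \<bullet> y)) = k * (n \<bullet> y) - i" by (simp add: frac_def)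
        have "(1 - \<theta>) * (k * (n \<bullet> y) - i) \<le> \<theta> * (1 - (k * (n \<bullet> y) - i))" using that by (simp add: algebra_simps)
        then have sy: "?s y = (1 - \<theta>) * (k * (n \<bullet> y) - i) / k" by (simp add: sawtooth_def f)
        show ?thesis unfolding sy inner_scaleR_left using \<open>k > 0\<close> by (simp add: field_simps)
      qed
      have "x \<in> slope_region ?s ((1 - \<theta>) *\<^sub>R n)"
      proof (rule affine_near_cong[OF _ 1 eq])
        show "open ({x. of_int i < k * (n \<bullet> x)} \<inter> {x. k * (n \<bullet> x) < of_int i + \<theta>})"
          by (intro open_Int open_Collect_less continuous_intros)
        show "x \<in> slope_region (\<lambda>y. ((1 - \<theta>) *\<^sub>R n) \<bullet> y + - (1 - \<theta>) * i / k) ((1 - \<theta>) *\<^sub>R n)"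
          by (auto simp: affine_near_def inner_diff_right algebra_simps intro!: exI[of _ 1])
      qed
      then show ?thesis by blast
    next
      case 2
      have eq: "((- \<theta>) *\<^sub>R n) \<bullet> y + (\<theta> * (1 + i) / k) = ?s y"
        if "y \<in> {x. of_int i + \<theta> < k * (n \<bullet> x)} \<inter> {x. k * (n \<bullet> x) < of_int i + 1}" for y
      proof -
        have "\<lfloor>k * (n \<bullet> y)\<rfloor> = i" using that \<theta> by (intro floor_unique) auto
        then have f: "frac (k * (n \<bullet> y)) = k * (n \<bullet> y) - i" by (simp add: frac_def)
        have "(1 - \<theta>) * (k * (n \<bullet> y) - i) \<ge> \<theta> * (1 - (k * (n \<bullet> y) - i))" using that by (simp add: algebra_simps)
        then have sy: "?s y = \<theta> * (1 - (k * (n \<bullet> y) - i)) / k" by (simp add: sawtooth_def f)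
        show ?thesis unfolding sy inner_scaleR_left using \<open>k > 0\<close> by (simp add: field_simps)
      qed
      have "x \<in> slope_region ?s ((- \<theta>) *\<^sub>R n)"
      proof (rule affine_near_cong[OF _ 2 eq])
        show "open ({x. of_int i + \<theta> < k * (n \<bullet> x)} \<inter> {x. k * (n \<bullet> x) < of_int i + 1})"
          by (intro open_Int open_Collect_less continuous_intros)
        show "x \<in> slope_region (\<lambda>y. ((- \<theta>) *\<^sub>R n) \<bullet> y + \<theta> * (1 + i) / k) ((- \<theta>) *\<^sub>R n)"
          by (auto simp: affine_near_def inner_diff_right algebra_simps intro!: exI[of _ 1])
      qed
      then show ?thesis by blast
    qed
  qed
  ultimately show ?thesis unfolding piecewise_gradients_def
    by (elim negligible_subset) blast
qed

lemma piecewise_gradients_const: "piecewise_gradients Q (\<lambda>x. c) {0}"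
  unfolding piecewise_gradients_def affine_near_def by (auto simp: gt_ex)

lemma piecewise_gradients_scale:
  assumes "piecewise_gradients Q g (cball 0 1)" "\<delta> > 0"
  shows "piecewise_gradients Q (\<lambda>x. \<delta> * g x) (cball 0 \<delta>)"
proof -
  have "x \<in> slope_region (\<lambda>x. \<delta> * g x) (\<delta> *\<^sub>R v)" if "x \<in> slope_region g v" for v x
    using affine_near_linear_image[OF that, of "\<lambda>x. \<delta> * x"] by (simp add: linear_times)
  moreover have "\<delta> *\<^sub>R v \<in> cball 0 \<delta>" if "v \<in> cball 0 1" for v :: 'a
    using that assms(2) by (simp add: mult_left_le)
  ultimately have "(\<Union>v\<in>cball 0 1. slope_region g v) \<subseteq> (\<Union>v\<in>cball 0 \<delta>. slope_region (\<lambda>x. \<delta> * g x) v)"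
    by blast
  then show ?thesis using assms(1) unfolding piecewise_gradients_def by (elim negligible_subset) blast
qed

lemma lipschitz_continuous:
  fixes f :: "'a::real_normed_vector \<Rightarrow> 'b::real_normed_vector"
  assumes "\<And>x y. norm (f x - f y) \<le> L * norm (x - y)"
  shows "continuous_on UNIV f"
proof -
  have "\<bar>L\<bar>-lipschitz_on UNIV f"
  proof (rule lipschitz_onI)
    fix x y
    have "norm (f x - f y) \<le> L * norm (x - y)" by (rule assms)
    also have "\<dots> \<le> \<bar>L\<bar> * norm (x - y)" by (intro mult_right_mono) auto
    finally show "dist (f x) (f y) \<le> \<bar>L\<bar> * dist x y" by (simp add: dist_norm)
  qed simp
  then show ?thesis by (rule lipschitz_on_continuous_on)
qed

text \<open>
  The minimum of the constant \<open>1\<close> and of the signed distances to the facets, cut off at \<open>0\<close>. The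
  minimum is built up by induction over the coordinates, so that only minima of two functions occur.
\<close>

lemma ex_box_bump:
  fixes c d :: "'a::euclidean_space"
  obtains g where "\<And>x y. \<bar>g x - g y\<bar> \<le> norm (x - y)" "\<And>x. 0 \<le> g x"
    "\<And>x. 0 < g x \<longleftrightarrow> x \<in> box c d" "piecewise_gradients (box c d) g (cball 0 1)"
proof -
  have "\<exists>g. (\<forall>x y. \<bar>g x - g y\<bar> \<le> norm (x - y)) \<and> (\<forall>x. 0 < g x \<longleftrightarrow> (\<forall>i\<in>A. c \<bullet> i < x \<bullet> i \<and> x \<bullet> i < d \<bullet> i))
      \<and> piecewise_gradients UNIV g (cball 0 1)" if "A \<subseteq> Basis" "finite A" for A
    using that(2,1)
  proof (induction rule: finite_induct)
    case empty
    have "piecewise_gradients UNIV (\<lambda>x::'a. 1) (cball 0 1)"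
      by (rule piecewise_gradients_subset[OF piecewise_gradients_const order_refl]) simp
    then show ?case by (intro exI[of _ "\<lambda>_. 1"]) auto
  next
    case (insert i A)
    then have i: "norm i = 1" by auto
    from insert obtain g where g: "\<And>x y. \<bar>g x - g y\<bar> \<le> norm (x - y)"
        "\<And>x. 0 < g x \<longleftrightarrow> (\<forall>i\<in>A. c \<bullet> i < x \<bullet> i \<and> x \<bullet> i < d \<bullet> i)" "piecewise_gradients UNIV g (cball 0 1)"
      by auto
    let ?l = "\<lambda>x. i \<bullet> x - i \<bullet> c" and ?u = "\<lambda>x. (- i) \<bullet> x + i \<bullet> d"
    have l: "\<bar>?l x - ?l y\<bar> \<le> norm (x - y)" and u: "\<bar>?u x - ?u y\<bar> \<le> norm (x - y)" for x y
      using Cauchy_Schwarz_ineq2[of i "x - y"] i by (auto simp: inner_diff_right)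
    have pl: "piecewise_gradients UNIV ?l {i}" "piecewise_gradients UNIV ?u {-i}"
      unfolding piecewise_gradients_def affine_near_def
      by (auto simp: inner_diff_right intro!: exI[of _ 1])
    have cont: "continuous_on UNIV ?l" "continuous_on UNIV ?u" "continuous_on UNIV g"
      using lipschitz_continuous[of g 1] g(1) by (auto intro!: continuous_intros)
    let ?g = "\<lambda>x. min (g x) (min (?l x) (?u x))"
    have "piecewise_gradients UNIV ?g (cball 0 1 \<union> ({i} \<union> {-i}))"
      by (intro piecewise_gradients_min cont pl g continuous_on_min)
    then have G1: "piecewise_gradients UNIV ?g (cball 0 1)"
      by (rule piecewise_gradients_subset) (use i in auto)
    have G2: "\<bar>?g x - ?g y\<bar> \<le> norm (x - y)" for x y
      by (intro abs_min_diff_le l u g(1))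
    have G3: "0 < ?g x \<longleftrightarrow> (\<forall>i\<in>insert i A. c \<bullet> i < x \<bullet> i \<and> x \<bullet> i < d \<bullet> i)" for x
    proof -
      have "0 < ?l x \<longleftrightarrow> c \<bullet> i < x \<bullet> i" "0 < ?u x \<longleftrightarrow> x \<bullet> i < d \<bullet> i" by (auto simp: inner_commute[of i])
      then show ?thesis unfolding min_less_iff_conj g(2) by blast
    qed
    show ?case by (intro exI[of _ ?g] conjI allI G1 G2 G3)
  qed
  from this[OF order_refl finite_Basis] obtain g where g: "\<And>x y. \<bar>g x - g y\<bar> \<le> norm (x - y)"
      "\<And>x. 0 < g x \<longleftrightarrow> x \<in> box c d" "piecewise_gradients UNIV g (cball 0 1)"
    by (auto simp: mem_box)
  have "x \<in> affine_near (\<lambda>x. max 0 (g x)) A" if "x \<in> box c d" "x \<in> affine_near g A" for x A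
    by (rule affine_near_cong[OF open_box that(1) _ that(2)]) (use g(2) in \<open>auto simp: max_def not_le less_le\<close>)
  then have "box c d - (\<Union>v\<in>cball 0 1. slope_region (\<lambda>x. max 0 (g x)) v) \<subseteq> UNIV - (\<Union>v\<in>cball 0 1. slope_region g v)"
    by blast
  then have "piecewise_gradients (box c d) (\<lambda>x. max 0 (g x)) (cball 0 1)"
    using g(3) unfolding piecewise_gradients_def by (elim negligible_subset)
  moreover have "\<bar>max 0 (g x) - max 0 (g y)\<bar> \<le> norm (x - y)" for x y
    using g(1)[of x y] by linarith
  ultimately show ?thesis using that[of "\<lambda>x. max 0 (g x)"] g(2) by (auto simp: less_max_iff_disj)
qed

section \<open>Oscillating profiles on a box\<close>

text \<open>
  The function \<open>D\<close> is the derivative of \<open>h\<close> in direction \<open>n\<close>, with value \<open>0\<close> at the exceptional points.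
\<close>

lemma integral_gradient_zero:
  fixes h :: "'a::euclidean_space \<Rightarrow> real"
  assumes lip: "\<And>x y. \<bar>h x - h y\<bar> \<le> L * norm (x - y)"
    and off: "\<And>x. x \<notin> box c d \<Longrightarrow> h x = 0"
    and pg: "piecewise_gradients (box c d) h V"
  obtains D where "integrable lebesgue D" "integral\<^sup>L lebesgue D = 0"
    "\<And>x v. x \<in> slope_region h v \<Longrightarrow> D x = v \<bullet> n"
    "\<And>x. \<bar>D x\<bar> \<le> L * norm n"
    "\<And>x. x \<notin> cbox c d \<Longrightarrow> D x = 0"
proof -
  let ?W = "\<lambda>v. slope_region h v"
  define D where "D x = (if \<exists>v. x \<in> ?W v then (THE v. x \<in> ?W v) \<bullet> n else 0)" for x
  have D: "D x = v \<bullet> n" if "x \<in> ?W v" for x v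
    using the_equality[of "\<lambda>v. x \<in> ?W v" v] that affine_near_grad_unique unfolding D_def by metis
  have out: "x \<in> ?W 0" if "x \<notin> cbox c d" for x
  proof -
    have "x \<in> slope_region (\<lambda>x. 0) 0" unfolding affine_near_def by (auto simp: gt_ex)
    then show ?thesis
      by (rule affine_near_cong[of "- cbox c d", rotated -1]) (use that off box_subset_cbox in \<open>auto simp: closed_cbox open_Compl\<close>)
  qed
  have neg: "negligible (- (\<Union>v\<in>UNIV. ?W v))"
  proof (rule negligible_subset)
    show "negligible ((box c d - (\<Union>v\<in>V. ?W v)) \<union> (cbox c d - box c d))"
      using pg negligible_frontier_interval unfolding piecewise_gradients_def by (intro negligible_Un)
    show "- (\<Union>v\<in>UNIV. ?W v) \<subseteq> (box c d - (\<Union>v\<in>V. ?W v)) \<union> (cbox c d - box c d)"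
      using out by blast
  qed
  have "(\<lambda>x. indicator UNIV x *\<^sub>R D x) \<in> borel_measurable lebesgue"
    by (rule lebesgue_measurable_piecewise(1)[of UNIV UNIV ?W D "\<lambda>v. v \<bullet> n"])
      (use neg in \<open>auto intro: D open_affine_near linear_inner_left simp: Compl_eq_Diff_UNIV\<close>)
  then have meas: "D \<in> borel_measurable lebesgue" by simp
  have L: "\<bar>h (x + t *\<^sub>R n) - h x\<bar> \<le> (L * norm n) * \<bar>t\<bar>" for x t
    using lip[of "x + t *\<^sub>R n" x] by (simp add: mult_ac)
  have lim: "AE x in lebesgue. ((\<lambda>t. (1 / t) *\<^sub>R (h (x + t *\<^sub>R n) - h x)) \<longlongrightarrow> D x) (at 0)"
  proof (rule AE_I')
    show "- (\<Union>v\<in>UNIV. ?W v) \<in> null_sets lebesgue" using neg by (simp add: negligible_iff_null_sets)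
    show "{x \<in> space lebesgue. \<not> ((\<lambda>t. (1 / t) *\<^sub>R (h (x + t *\<^sub>R n) - h x)) \<longlongrightarrow> D x) (at 0)} \<subseteq> - (\<Union>v\<in>UNIV. ?W v)"
      using difference_quotient_affine_near[OF linear_inner_left] D by fastforce
  qed
  have cont: "continuous_on UNIV h" using lipschitz_continuous[of h L] lip by simp
  note * = integral_directional_derivative_zero[OF cont bounded_box[of c d] off _ meas lim, of "L * norm n"]
  have bd: "\<bar>D x\<bar> \<le> L * norm n" for x
  proof (cases "\<exists>v. x \<in> ?W v")
    case True
    then obtain v where v: "x \<in> ?W v" by blast
    have "norm (v \<bullet> n) \<le> L * norm n"
      by (rule norm_gradient_le[OF _ linear_inner_left v]) (use lip in simp)
    then show ?thesis using D[OF v] by simp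
  next
    case False
    have "0 \<le> L * norm n" using order_trans[OF abs_ge_zero lip[of n 0]] by simp
    then show ?thesis using False by (simp add: D_def)
  qed
  show ?thesis
  proof (rule that)
    show "integrable lebesgue D" "integral\<^sup>L lebesgue D = 0" using * L by simp_all
    show "D x = 0" if "x \<notin> cbox c d" for x using D[OF out[OF that]] by simp
  qed (use D bd in auto)
qed

lemma lmeasurable_box_Int: "open S \<Longrightarrow> box c d \<inter> S \<in> lmeasurable"
  by (intro lmeasurable_open) (auto intro: bounded_subset[OF bounded_box])

text \<open>
  The two main gradients are multiples \<open>1 - \<theta>\<close> and \<open>-\<theta>\<close> of \<open>n\<close>. As the integral of \<open>\<nabla>h \<bullet> n\<close> vanishes,
  \<open>(1 - \<theta>)a - \<theta>b\<close> is bounded by \<open>L / |n|\<close> times the volume \<open>q - a - b\<close> on which \<open>h\<close> has other gradients.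
  Hence \<open>a\<close> and \<open>b\<close> are close to \<open>\<theta>q\<close> and \<open>(1 - \<theta>)q\<close>.
\<close>

lemma gradient_fractions:
  fixes h :: "'a::euclidean_space \<Rightarrow> real"
  assumes lip: "\<And>x y. \<bar>h x - h y\<bar> \<le> L * norm (x - y)"
    and off: "\<And>x. x \<notin> box c d \<Longrightarrow> h x = 0"
    and pg: "piecewise_gradients (box c d) h V"
    and n: "n \<noteq> 0" and \<theta>: "0 < \<theta>" "\<theta> < 1"
  defines "a \<equiv> vol (box c d \<inter> slope_region h ((1 - \<theta>) *\<^sub>R n))"
    and "b \<equiv> vol (box c d \<inter> slope_region h ((- \<theta>) *\<^sub>R n))"
    and "q \<equiv> vol (box c d)"
  shows "\<theta> * q - (1 + L / norm n) * (q - a - b) \<le> a"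
    "(1 - \<theta>) * q - (1 + L / norm n) * (q - a - b) \<le> b" "a + b \<le> q"
proof -
  let ?Q = "box c d"
  let ?A = "?Q \<inter> slope_region h ((1 - \<theta>) *\<^sub>R n)"
  let ?B = "?Q \<inter> slope_region h ((- \<theta>) *\<^sub>R n)"
  let ?E = "?Q - ?A - ?B"
  obtain D where D: "integrable lebesgue D" "integral\<^sup>L lebesgue D = 0"
      "\<And>x v. x \<in> slope_region h v \<Longrightarrow> D x = v \<bullet> n" "\<And>x. \<bar>D x\<bar> \<le> L * norm n"
      "\<And>x. x \<notin> cbox c d \<Longrightarrow> D x = 0"
    using integral_gradient_zero[OF lip off pg, of n] by blast
  have A: "?A \<in> lmeasurable" and B: "?B \<in> lmeasurable"
    by (intro lmeasurable_box_Int open_affine_near linear_inner_left)+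
  have E: "?E \<in> lmeasurable" by (intro fmeasurable.Diff A B lmeasurable_box)
  have "?A \<inter> ?B = {}"
  proof (rule ccontr)
    assume "?A \<inter> ?B \<noteq> {}"
    then obtain x where "x \<in> slope_region h ((1 - \<theta>) *\<^sub>R n)" "x \<in> slope_region h ((- \<theta>) *\<^sub>R n)" by blast
    from affine_near_grad_unique[OF this] have "(1 - \<theta>) *\<^sub>R n = (- \<theta>) *\<^sub>R n" .
    then have "n = 0" by (simp add: scaleR_left_diff_distrib)
    then show False using n by simp
  qed
  then have dis: "?A \<inter> ?B = {}" .
  have mE: "vol ?E = q - a - b"
  proof -
    have "vol (?Q - ?A) = q - a" unfolding q_def a_def
      by (rule measurable_measure_Diff) (use A in \<open>auto\<close>)
    moreover have "vol (?Q - ?A - ?B) = vol (?Q - ?A) - b" unfolding b_def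
      by (rule measurable_measure_Diff) (use A B dis in \<open>auto intro: fmeasurable.Diff\<close>)
    ultimately show ?thesis by simp
  qed
  then show "a + b \<le> q" using measure_nonneg[of lebesgue ?E] by linarith
  define N where "N = n \<bullet> n"
  have N: "N = norm n * norm n" "norm n > 0" using n by (auto simp: N_def dot_square_norm power2_eq_square)
  (* The directional derivative lies between ?F (-1) and ?F 1 almost everywhere. *)
  let ?F = "\<lambda>s x. (1 - \<theta>) * N * indicator ?A x + (- \<theta>) * N * indicator ?B x + s * (L * norm n) * indicator ?E x :: real"
  have ind: "integrable lebesgue (indicator ?A :: _ \<Rightarrow> real)" "integrable lebesgue (indicator ?B :: _ \<Rightarrow> real)"
     "integrable lebesgue (indicator ?E :: _ \<Rightarrow> real)"
    using A B E by (auto simp: fmeasurable_def)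
  have Fi: "integrable lebesgue (?F s)" for s
    by (intro Bochner_Integration.integrable_add integrable_mult_right ind)
  have Fv: "integral\<^sup>L lebesgue (?F s) = (1 - \<theta>) * N * a - \<theta> * N * b + s * (L * norm n) * (q - a - b)" for s
  proof -
    have "integral\<^sup>L lebesgue (?F s) = (1 - \<theta>) * N * vol ?A + (- \<theta>) * N * vol ?B
        + s * (L * norm n) * vol ?E"
      using ind by simp
    then show ?thesis unfolding mE a_def b_def by simp
  qed
  have neg: "AE x in lebesgue. x \<notin> cbox c d - box c d"
    by (rule AE_not_in) (use negligible_frontier_interval[of c d] in \<open>simp add: negligible_iff_null_sets\<close>)
  have cases: "x \<in> ?A \<or> x \<in> ?B \<or> x \<in> ?E \<or> x \<notin> cbox c d" if "x \<notin> cbox c d - box c d" for x using that by blast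
  have DA: "D x = (1 - \<theta>) * N" if "x \<in> ?A" for x using that D(3) unfolding N_def by fastforce
  have DB: "D x = - \<theta> * N" if "x \<in> ?B" for x using that D(3) unfolding N_def by fastforce
  have nE: "x \<notin> ?A \<and> x \<notin> ?B \<and> x \<notin> ?E" if "x \<notin> cbox c d" for x using that box_subset_cbox by blast
  have "AE x in lebesgue. D x \<le> ?F 1 x"
    using neg
  proof eventually_elim
    case (elim x)
    show ?case using cases[OF elim] DA[of x] DB[of x] D(4)[of x] D(5)[of x] nE[of x] dis
      by (elim disjE) (auto simp: indicator_def abs_le_iff)
  qed
  from integral_mono_AE[OF D(1) Fi this]
  have 1: "0 \<le> (1 - \<theta>) * N * a - \<theta> * N * b + (L * norm n) * (q - a - b)" using D(2) Fv[of 1] by simp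
  have "AE x in lebesgue. ?F (-1) x \<le> D x"
    using neg
  proof eventually_elim
    case (elim x)
    show ?case using cases[OF elim] DA[of x] DB[of x] D(4)[of x] D(5)[of x] nE[of x] dis
      by (elim disjE) (auto simp: indicator_def abs_le_iff)
  qed
  from integral_mono_AE[OF Fi D(1) this]
  have 2: "(1 - \<theta>) * N * a - \<theta> * N * b - (L * norm n) * (q - a - b) \<le> 0" using D(2) Fv[of "-1"] by simp
  have 3: "(1 - \<theta>) * a - \<theta> * b + (L / norm n) * (q - a - b) = ((1 - \<theta>) * N * a - \<theta> * N * b + (L * norm n) * (q - a - b)) / N"
    "(1 - \<theta>) * a - \<theta> * b - (L / norm n) * (q - a - b) = ((1 - \<theta>) * N * a - \<theta> * N * b - (L * norm n) * (q - a - b)) / N"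
    using N(2) unfolding N(1) by (simp_all add: field_simps)
  have "N > 0" using N by simp
  have 4: "0 \<le> (1 - \<theta>) * a - \<theta> * b + (L / norm n) * (q - a - b)"
    unfolding 3 using 1 \<open>N > 0\<close> by simp
  have 5: "(1 - \<theta>) * a - \<theta> * b - (L / norm n) * (q - a - b) \<le> 0"
    unfolding 3 using 2 \<open>N > 0\<close> by (simp add: divide_nonpos_pos)
  have e: "0 \<le> q - a - b" using mE measure_nonneg[of lebesgue ?E] by linarith
  then have te: "\<theta> * (q - a - b) \<le> q - a - b" "(1 - \<theta>) * (q - a - b) \<le> q - a - b"
    using \<theta> by (simp_all add: mult_left_le_one_le)
  have "a - (\<theta> * q - (1 + L / norm n) * (q - a - b))
     = ((1 - \<theta>) * a - \<theta> * b + (L / norm n) * (q - a - b)) + ((q - a - b) - \<theta> * (q - a - b))"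
    by (simp add: algebra_simps)
  then show "\<theta> * q - (1 + L / norm n) * (q - a - b) \<le> a" using 4 te by linarith
  have "b - ((1 - \<theta>) * q - (1 + L / norm n) * (q - a - b))
     = - ((1 - \<theta>) * a - \<theta> * b - (L / norm n) * (q - a - b)) + ((q - a - b) - (1 - \<theta>) * (q - a - b))"
    by (simp add: algebra_simps)
  then show "(1 - \<theta>) * q - (1 + L / norm n) * (q - a - b) \<le> b" using 5 te by linarith
qed

text \<open>
  The minimum of a sawtooth of high frequency with \<open>\<delta>\<close> times a bump. The sawtooth has height at most
  \<open>1 / k\<close>, so it is the smaller one wherever \<open>\<delta>g > 1 / k\<close>, and these sets exhaust the box as \<open>k\<close> grows.
\<close>

lemma ex_laminate_profile_full:
  fixes n c d :: "'a::euclidean_space"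
  assumes n: "n \<noteq> 0" and \<theta>: "0 < \<theta>" "\<theta> < 1" and "\<delta> > 0" "\<rho> > 0" "\<eta> > 0"
  obtains h where "\<And>x y. \<bar>h x - h y\<bar> \<le> (norm n + \<delta>) * norm (x - y)" "\<And>x. x \<notin> box c d \<Longrightarrow> h x = 0"
    "\<And>x. 0 \<le> h x" "\<And>x. h x \<le> \<rho>"
    "piecewise_gradients (box c d) h ({(1 - \<theta>) *\<^sub>R n, (- \<theta>) *\<^sub>R n} \<union> cball 0 \<delta>)"
    "(\<theta> - \<eta>) * vol (box c d) \<le> vol (box c d \<inter> slope_region h ((1 - \<theta>) *\<^sub>R n))"
    "(1 - \<theta> - \<eta>) * vol (box c d) \<le> vol (box c d \<inter> slope_region h ((- \<theta>) *\<^sub>R n))"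
proof -
  let ?Q = "box c d"
  let ?q = "vol ?Q"
  let ?V = "{(1 - \<theta>) *\<^sub>R n, (- \<theta>) *\<^sub>R n}"
  obtain g where g: "\<And>x y. \<bar>g x - g y\<bar> \<le> norm (x - y)" "\<And>x. 0 \<le> g x"
    "\<And>x. 0 < g x \<longleftrightarrow> x \<in> box c d" "piecewise_gradients (box c d) g (cball 0 1)"
    using ex_box_bump[of c d] by blast
  define L where "L = norm n + \<delta>"
  have Lpos: "L > 0" "norm n > 0" using n \<open>\<delta> > 0\<close> by (auto simp: L_def add_pos_pos)
  (* Chosen so that an exceptional set of relative volume kappa costs at most eta
     in gradient_fractions. *)
  define \<kappa> where "\<kappa> = \<eta> / (1 + L / norm n)"
  have \<kappa>: "\<kappa> > 0" "(1 + L / norm n) * \<kappa> = \<eta>"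
  proof -
    have "1 + L / norm n > 0" using Lpos by (simp add: add_pos_pos)
    then show "\<kappa> > 0" "(1 + L / norm n) * \<kappa> = \<eta>" using \<open>\<eta> > 0\<close> by (simp_all add: \<kappa>_def)
  qed
  define P where "P k = ?Q \<inter> {x. 1 / real (Suc k) < \<delta> * g x}" for k
  have gc: "continuous_on UNIV g" using lipschitz_continuous[of g 1] g(1) by simp
  have oP: "open {x. 1 / real (Suc k) < \<delta> * g x}" for k
    by (intro open_Collect_less continuous_intros gc)
  then have Pm: "P k \<in> lmeasurable" for k unfolding P_def by (rule lmeasurable_box_Int)
  have Pinc: "incseq P"
  proof (rule incseq_SucI)
    fix k
    have "1 / real (Suc (Suc k)) \<le> 1 / real (Suc k)" by (simp add: frac_le)
    then show "P k \<le> P (Suc k)" unfolding P_def by (auto intro: order.strict_trans1)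
  qed
  have PU: "(\<Union>k. P k) = ?Q"
  proof -
    have "\<exists>k. x \<in> P k" if "x \<in> ?Q" for x
    proof -
      have "0 < \<delta> * g x" using g(3) that \<open>\<delta> > 0\<close> by simp
      then obtain k where "inverse (real (Suc k)) < \<delta> * g x" using reals_Archimedean by blast
      then show ?thesis using that unfolding P_def by (auto simp: inverse_eq_divide)
    qed
    then show ?thesis unfolding P_def by blast
  qed
  have "(\<lambda>k. vol (P k)) \<longlonglongrightarrow> vol (\<Union>k. P k)"
    by (rule Lim_measure_incseq) (use Pm Pinc PU lmeasurable_box[of c d] in \<open>auto simp: fmeasurable_def\<close>)
  then have lim: "(\<lambda>k. vol (P k)) \<longlonglongrightarrow> ?q" by (simp add: PU)
  have "\<exists>k. (1 - \<kappa>) * ?q \<le> vol (P k) \<and> 1 / real (Suc k) \<le> \<rho>"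
  proof -
    have "eventually (\<lambda>k. (1 - \<kappa>) * ?q \<le> vol (P k)) sequentially"
    proof (cases "?q = 0")
      case False
      then have "?q > 0" using measure_nonneg[of lebesgue ?Q] by linarith
      then have "(1 - \<kappa>) * ?q < ?q" using \<kappa>(1) by (simp add: algebra_simps)
      from order_tendstoD(1)[OF lim this] show ?thesis by eventually_elim simp
    qed simp
    moreover have "eventually (\<lambda>k. 1 / real (Suc k) \<le> \<rho>) sequentially"
      using order_tendstoD(2)[OF LIMSEQ_inverse_real_of_nat \<open>\<rho> > 0\<close>] by (auto simp: inverse_eq_divide elim: eventually_mono)
    ultimately have "eventually (\<lambda>k. (1 - \<kappa>) * ?q \<le> vol (P k) \<and> 1 / real (Suc k) \<le> \<rho>) sequentially"
      by (rule eventually_conj)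
    then show ?thesis using eventually_happens' sequentially_bot by blast
  qed
  then obtain k where k: "(1 - \<kappa>) * ?q \<le> vol (P k)" "1 / real (Suc k) \<le> \<rho>" by blast
  define K where "K = real (Suc k)"
  have K: "K > 0" by (simp add: K_def)
  define s where "s x = sawtooth \<theta> (K * (n \<bullet> x)) / K" for x
  have s: "0 \<le> s x" "s x \<le> 1 / K" for x
    using sawtooth_bounds[OF \<theta>, of "K * (n \<bullet> x)"] K by (auto simp: s_def divide_right_mono)
  have slip: "\<bar>s x - s y\<bar> \<le> norm n * norm (x - y)" for x y
  proof -
    have "\<bar>s x - s y\<bar> = \<bar>sawtooth \<theta> (K * (n \<bullet> x)) - sawtooth \<theta> (K * (n \<bullet> y))\<bar> / K"
      using K by (simp add: s_def diff_divide_distrib[symmetric] abs_divide)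
    also have "\<dots> \<le> \<bar>K * (n \<bullet> x) - K * (n \<bullet> y)\<bar> / K"
      using K sawtooth_lipschitz[OF \<theta>] by (intro divide_right_mono) auto
    also have "\<dots> = \<bar>n \<bullet> (x - y)\<bar>" using K by (simp add: inner_diff_right right_diff_distrib[symmetric] abs_mult)
    also have "\<dots> \<le> norm n * norm (x - y)" by (rule Cauchy_Schwarz_ineq2)
    finally show ?thesis .
  qed
  have sc: "continuous_on UNIV s" using lipschitz_continuous[of s "norm n"] slip by simp
  define h where "h x = min (s x) (\<delta> * g x)" for x
  have hlip: "\<bar>h x - h y\<bar> \<le> L * norm (x - y)" for x y
    unfolding h_def
  proof (rule abs_min_diff_le)
    show "\<bar>s x - s y\<bar> \<le> L * norm (x - y)"
      using slip[of x y] \<open>\<delta> > 0\<close> unfolding L_def by (auto simp: distrib_right intro: order_trans)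
    have "\<bar>\<delta> * g x - \<delta> * g y\<bar> = \<delta> * \<bar>g x - g y\<bar>" using \<open>\<delta> > 0\<close> by (simp add: right_diff_distrib[symmetric] abs_mult)
    also have "\<dots> \<le> \<delta> * norm (x - y)" using g(1) \<open>\<delta> > 0\<close> by (intro mult_left_mono) auto
    also have "\<dots> \<le> L * norm (x - y)" unfolding L_def by (intro mult_right_mono) auto
    finally show "\<bar>\<delta> * g x - \<delta> * g y\<bar> \<le> L * norm (x - y)" .
  qed
  have off: "h x = 0" if "x \<notin> ?Q" for x
  proof -
    have "g x = 0" using that g(2)[of x] g(3)[of x] by auto
    then show ?thesis using s(1)[of x] by (simp add: h_def)
  qed
  have hs: "0 \<le> h x" "h x \<le> s x" for x using s(1)[of x] g(2)[of x] \<open>\<delta> > 0\<close> by (auto simp: h_def)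
  have pgs: "piecewise_gradients UNIV s ?V"
    using piecewise_gradients_sawtooth[OF \<theta> n K] by (simp add: s_def[abs_def])
  have pg: "piecewise_gradients ?Q h (?V \<union> cball 0 \<delta>)"
    unfolding h_def
    by (intro piecewise_gradients_min sc piecewise_gradients_scale g(4) \<open>\<delta> > 0\<close> piecewise_gradients_subset[OF pgs] continuous_intros gc) auto
  let ?A = "?Q \<inter> slope_region h ((1 - \<theta>) *\<^sub>R n)"
  let ?B = "?Q \<inter> slope_region h ((- \<theta>) *\<^sub>R n)"
  have near: "x \<in> affine_near h A" if "x \<in> P k" "x \<in> affine_near s A" for x A
    unfolding h_def
  proof (rule affine_near_less_min[OF sc _ _ that(2)])
    show "continuous_on UNIV (\<lambda>x. \<delta> * g x)" by (intro continuous_intros gc)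
    show "s x < \<delta> * g x" using that(1) s(2)[of x] unfolding P_def K_def by auto
  qed
  have neg: "negligible (P k - (?A \<union> ?B))"
  proof (rule negligible_subset)
    show "negligible (UNIV - (\<Union>v\<in>?V. slope_region s v))" using pgs unfolding piecewise_gradients_def .
    have "P k \<subseteq> ?Q" by (auto simp: P_def)
    then show "P k - (?A \<union> ?B) \<subseteq> UNIV - (\<Union>v\<in>?V. slope_region s v)" using near by blast
  qed
  have mAB: "?A \<in> lmeasurable" "?B \<in> lmeasurable"
    by (intro lmeasurable_box_Int open_affine_near linear_inner_left)+
  have "vol (P k) \<le> vol ((?A \<union> ?B) \<union> (P k - (?A \<union> ?B)))"
    by (rule measure_mono_fmeasurable) (use mAB Pm neg in \<open>auto intro: negligible_imp_measurable\<close>)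
  also have "\<dots> \<le> vol (?A \<union> ?B) + vol (P k - (?A \<union> ?B))"
    by (rule measure_Un_le) (use mAB neg in \<open>auto intro: negligible_imp_sets\<close>)
  also have "vol (P k - (?A \<union> ?B)) = 0" using neg by (rule negligible_imp_measure0)
  also have "vol (?A \<union> ?B) + 0 \<le> vol ?A + vol ?B"
    using measure_Un_le[of ?A lebesgue ?B] mAB by auto
  finally have "(1 - \<kappa>) * ?q \<le> vol ?A + vol ?B" using k(1) by linarith
  then have "?q - vol ?A - vol ?B \<le> \<kappa> * ?q" by (simp add: algebra_simps)
  then have "(1 + L / norm n) * (?q - vol ?A - vol ?B) \<le> (1 + L / norm n) * (\<kappa> * ?q)"
    using Lpos by (intro mult_left_mono) (auto simp: add_nonneg_nonneg)
  also have "\<dots> = \<eta> * ?q" by (simp only: mult.assoc[symmetric] \<kappa>)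
  finally have e: "(1 + L / norm n) * (?q - vol ?A - vol ?B) \<le> \<eta> * ?q" .
  note fr = gradient_fractions(1,2)[OF hlip off pg n \<theta>]
  show ?thesis
  proof (rule that[of h])
    show "\<bar>h x - h y\<bar> \<le> (norm n + \<delta>) * norm (x - y)" for x y using hlip by (simp add: L_def)
    show "h x \<le> \<rho>" for x using hs(2)[of x] s(2)[of x] k(2) unfolding K_def by linarith
    show "(\<theta> - \<eta>) * ?q \<le> vol ?A" using fr(1) e by (simp add: left_diff_distrib)
    show "(1 - \<theta> - \<eta>) * ?q \<le> vol ?B" using fr(2) e by (simp add: left_diff_distrib)
  qed (use off hs pg in auto)
qed

lemma measure_box_scaled:
  fixes c d :: "'a::euclidean_space"
  assumes "0 \<le> r" "box c d \<noteq> {}"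
  shows "vol (box c (c + r *\<^sub>R (d - c))) = r ^ DIM('a) * vol (box c d)"
proof -
  have cd: "\<forall>i\<in>Basis. c \<bullet> i \<le> d \<bullet> i" using assms(2) by (auto simp: box_ne_empty less_imp_le)
  then have cd': "\<forall>i\<in>Basis. c \<bullet> i \<le> (c + r *\<^sub>R (d - c)) \<bullet> i"
    using assms(1) by (simp add: inner_simps)
  have "(\<Prod>i\<in>Basis. r * ((d - c) \<bullet> i)) = r ^ DIM('a) * (\<Prod>i\<in>Basis. (d - c) \<bullet> i)"
    by (simp add: prod.distrib)
  then show ?thesis using cd cd' by (simp add: measure_lborel_box_eq)
qed

text \<open>
  Splitting only a fraction \<open>\<tau>\<close> of the mass: the profile lives on a homothetic copy of the box, shrunk
  by the factor \<open>\<tau>\<close> in volume, and vanishes on the rest, where the gradient is \<open>0\<close>.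
\<close>

lemma ex_laminate_profile:
  fixes n c d :: "'a::euclidean_space"
  assumes n: "n \<noteq> 0" and \<theta>: "0 < \<theta>" "\<theta> < 1" and \<tau>: "0 < \<tau>" "\<tau> \<le> 1" and "\<delta> > 0" "\<rho> > 0" "\<eta> > 0"
    and ne: "box c d \<noteq> {}"
  shows "\<exists>h. (\<forall>x y. \<bar>h x - h y\<bar> \<le> (norm n + \<delta>) * norm (x - y)) \<and> (\<forall>x. x \<notin> box c d \<longrightarrow> h x = 0) \<and>
    (\<forall>x. 0 \<le> h x \<and> h x \<le> \<rho>) \<and>
    piecewise_gradients (box c d) h ({(1 - \<theta>) *\<^sub>R n, (- \<theta>) *\<^sub>R n} \<union> cball 0 \<delta>) \<and>
    (\<tau> * \<theta> - \<eta>) * vol (box c d) \<le> vol (box c d \<inter> slope_region h ((1 - \<theta>) *\<^sub>R n)) \<and>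
    (\<tau> * (1 - \<theta>) - \<eta>) * vol (box c d) \<le> vol (box c d \<inter> slope_region h ((- \<theta>) *\<^sub>R n)) \<and>
    (1 - \<tau> - \<eta>) * vol (box c d) \<le> vol (box c d \<inter> slope_region h 0)"
proof -
  define r where "r = root DIM('a) \<tau>"
  have r: "0 \<le> r" "r \<le> 1" "r ^ DIM('a) = \<tau>" using \<tau> by (auto simp: r_def)
  define e where "e = c + r *\<^sub>R (d - c)"
  let ?Q = "box c d" and ?P = "box c e"
  let ?q = "vol ?Q"
  have "(d - c) \<bullet> i > 0" if "i \<in> Basis" for i using ne that by (auto simp: box_ne_empty inner_simps)
  then have "r * ((d - c) \<bullet> i) \<le> (d - c) \<bullet> i" if "i \<in> Basis" for i
    using r that by (simp add: mult_left_le_one_le less_imp_le)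
  then have "e \<bullet> i \<le> d \<bullet> i" if "i \<in> Basis" for i using that by (auto simp: e_def inner_simps algebra_simps)
  then have PQ: "?P \<subseteq> ?Q" by (meson mem_box(1) order.strict_trans2 subsetI)
  have mP: "vol ?P = \<tau> * ?q" using measure_box_scaled[OF r(1) ne] r(3) by (simp add: e_def)
  obtain h where h: "\<And>x y. \<bar>h x - h y\<bar> \<le> (norm n + \<delta>) * norm (x - y)" "\<And>x. x \<notin> ?P \<Longrightarrow> h x = 0"
    "\<And>x. 0 \<le> h x" "\<And>x. h x \<le> \<rho>"
    "piecewise_gradients ?P h ({(1 - \<theta>) *\<^sub>R n, (- \<theta>) *\<^sub>R n} \<union> cball 0 \<delta>)"
    "(\<theta> - \<eta>) * vol ?P \<le> vol (?P \<inter> slope_region h ((1 - \<theta>) *\<^sub>R n))"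
    "(1 - \<theta> - \<eta>) * vol ?P \<le> vol (?P \<inter> slope_region h ((- \<theta>) *\<^sub>R n))"
    using ex_laminate_profile_full[OF n \<theta> \<open>\<delta> > 0\<close> \<open>\<rho> > 0\<close> \<open>\<eta> > 0\<close>, of c e] by blast
  have out: "x \<in> slope_region h 0" if "x \<notin> cbox c e" for x
  proof -
    have "x \<in> slope_region (\<lambda>x. 0) 0" unfolding affine_near_def by (auto simp: gt_ex)
    then show ?thesis
      by (rule affine_near_cong[of "- cbox c e", rotated -1]) (use that h(2) box_subset_cbox in \<open>auto simp: closed_cbox open_Compl\<close>)
  qed
  have pg: "piecewise_gradients ?Q h ({(1 - \<theta>) *\<^sub>R n, (- \<theta>) *\<^sub>R n} \<union> cball 0 \<delta>)" (is "piecewise_gradients ?Q h ?V")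
    unfolding piecewise_gradients_def
  proof (rule negligible_subset)
    show "negligible ((?P - (\<Union>v\<in>?V. slope_region h v)) \<union> (cbox c e - ?P))"
      using h(5) negligible_frontier_interval unfolding piecewise_gradients_def by (intro negligible_Un)
    have "0 \<in> ?V" using \<open>\<delta> > 0\<close> by simp
    then show "?Q - (\<Union>v\<in>?V. slope_region h v) \<subseteq> (?P - (\<Union>v\<in>?V. slope_region h v)) \<union> (cbox c e - ?P)"
      using out by blast
  qed
  have Qm: "?Q \<inter> slope_region h v \<in> lmeasurable" for v
    by (intro lmeasurable_box_Int open_affine_near linear_inner_left)
  have mono: "vol (?P \<inter> slope_region h v) \<le> vol (?Q \<inter> slope_region h v)" for v
    by (rule measure_mono_fmeasurable[OF _ _ Qm])
      (use PQ in \<open>auto intro!: fmeasurableD lmeasurable_box_Int open_affine_near linear_inner_left\<close>)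
  have le: "\<tau> * \<eta> * ?q \<le> \<eta> * ?q"
    using \<tau> \<open>\<eta> > 0\<close> by (intro mult_right_mono) (auto simp: mult_left_le_one_le)
  have A: "(\<tau> * \<theta> - \<eta>) * ?q \<le> vol (?Q \<inter> slope_region h ((1 - \<theta>) *\<^sub>R n))"
  proof -
    have "(\<tau> * \<theta> - \<eta>) * ?q \<le> (\<theta> - \<eta>) * (\<tau> * ?q)" using le by (simp add: algebra_simps)
    also have "\<dots> \<le> vol (?P \<inter> slope_region h ((1 - \<theta>) *\<^sub>R n))" using h(6) unfolding mP .
    also note mono finally show ?thesis .
  qed
  have B: "(\<tau> * (1 - \<theta>) - \<eta>) * ?q \<le> vol (?Q \<inter> slope_region h ((- \<theta>) *\<^sub>R n))"
  proof -
    have "(\<tau> * (1 - \<theta>) - \<eta>) * ?q \<le> (1 - \<theta> - \<eta>) * (\<tau> * ?q)" using le by (simp add: algebra_simps)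
    also have "\<dots> \<le> vol (?P \<inter> slope_region h ((- \<theta>) *\<^sub>R n))" using h(7) unfolding mP .
    also note mono finally show ?thesis .
  qed
  have C: "(1 - \<tau> - \<eta>) * ?q \<le> vol (?Q \<inter> slope_region h 0)"
  proof -
    have "vol (cbox c e) = \<tau> * ?q" using mP by (simp add: measure_lborel_cbox_eq measure_lborel_box_eq)
    moreover have "?q \<le> vol ((?Q \<inter> slope_region h 0) \<union> cbox c e)"
      by (rule measure_mono_fmeasurable) (use out Qm[of 0] in \<open>auto intro!: fmeasurable.Un\<close>)
    moreover have "\<dots> \<le> vol (?Q \<inter> slope_region h 0) + vol (cbox c e)"
      by (rule measure_Un_le) (use Qm[of 0] in \<open>auto\<close>)
    ultimately have "(1 - \<tau>) * ?q \<le> vol (?Q \<inter> slope_region h 0)" by (simp add: algebra_simps)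
    moreover have "(1 - \<tau> - \<eta>) * ?q \<le> (1 - \<tau>) * ?q" using \<open>\<eta> > 0\<close> by (intro mult_right_mono) auto
    ultimately show ?thesis by linarith
  qed
  have "h x = 0" if "x \<notin> ?Q" for x using h(2) that PQ by blast
  then show ?thesis by (intro exI[of _ h] conjI allI impI h(1,3,4) pg A B C)
qed

section \<open>Exhausting open sets by boxes\<close>

lemma box_decomposition:
  fixes S :: "'a::euclidean_space set"
  assumes "bounded S" "\<And>x. x \<in> S \<Longrightarrow> open (g x) \<and> x \<in> g x"
  obtains \<Q> where "countable \<Q>" "disjoint \<Q>" "\<forall>Q\<in>\<Q>. \<exists>c d. Q = box c d \<and> box c d \<noteq> {}"
    "\<forall>Q\<in>\<Q>. \<exists>x\<in>S. Q \<subseteq> g x" "negligible (S - \<Union>\<Q>)"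
proof (cases "S = {}")
  case True
  then show ?thesis using that[of "{}"] by simp
next
  case False
  obtain a where a: "S \<subseteq> box (- a) a" using bounded_subset_box_symmetric[OF assms(1)] by blast
  then have a': "S \<subseteq> cbox (- a) a" "box (- a) a \<noteq> {}" using False box_subset_cbox by blast+
  define g' where "g' x = (if x \<in> S then g x else UNIV)" for x
  have "gauge g'" using assms(2) by (auto simp: gauge_def g'_def)
  obtain \<D> where D: "countable \<D>" "\<And>K. K \<in> \<D> \<Longrightarrow> interior K \<noteq> {} \<and> (\<exists>c d. K = cbox c d)"
    "pairwise (\<lambda>A B. interior A \<inter> interior B = {}) \<D>"
    "\<And>K. K \<in> \<D> \<Longrightarrow> \<exists>x \<in> S \<inter> K. K \<subseteq> g' x" "S \<subseteq> \<Union>\<D>"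
    using covering_lemma[OF a' \<open>gauge g'\<close>] by metis
  show ?thesis
  proof (rule that[of "interior ` \<D>"])
    show "countable (interior ` \<D>)" using D(1) by simp
    show "disjoint (interior ` \<D>)" 
    proof (rule pairwiseI)
      fix Q R assume "Q \<in> interior ` \<D>" "R \<in> interior ` \<D>" "Q \<noteq> R"
      then obtain A B where "A \<in> \<D>" "B \<in> \<D>" "A \<noteq> B" "Q = interior A" "R = interior B" by blast
      then show "disjnt Q R" using D(3) by (auto simp: pairwise_def disjnt_def)
    qed
    show "\<forall>Q\<in>interior ` \<D>. \<exists>c d. Q = box c d \<and> box c d \<noteq> {}"
      using D(2) by (auto simp: interior_cbox) (metis interior_cbox)
    show "\<forall>Q\<in>interior ` \<D>. \<exists>x\<in>S. Q \<subseteq> g x"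
    proof
      fix Q assume "Q \<in> interior ` \<D>"
      then obtain K where K: "K \<in> \<D>" "Q \<subseteq> K" using interior_subset by blast
      obtain x where "x \<in> S" "K \<subseteq> g' x" using D(4)[OF K(1)] by blast
      then show "\<exists>x\<in>S. Q \<subseteq> g x" using K(2) by (auto simp: g'_def)
    qed
    have "negligible (K - interior K)" if "K \<in> \<D>" for K
      using D(2)[OF that] negligible_frontier_interval by (metis interior_cbox)
    then have "negligible (\<Union>K\<in>\<D>. K - interior K)"
      using D(1) by (intro negligible_countable_Union) auto
    then show "negligible (S - \<Union>(interior ` \<D>))"
      by (rule negligible_subset) (use D(5) in blast)
  qed
qed

text \<open>
  This transfers volume fractions from the boxes of a decomposition to the set that they exhaust.
\<close>

lemma measure_ge_of_boxes:
  fixes O' :: "'a::euclidean_space set"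
  assumes \<Q>: "countable \<Q>" "disjoint \<Q>" "\<And>Q. Q \<in> \<Q> \<Longrightarrow> open Q" "\<And>Q. Q \<in> \<Q> \<Longrightarrow> Q \<subseteq> O'"
    and neg: "negligible (O' - \<Union>\<Q>)" and O': "O' \<in> lmeasurable" and A: "A \<in> sets lebesgue"
    and le: "\<And>Q. Q \<in> \<Q> \<Longrightarrow> k * vol Q \<le> vol (Q \<inter> A)"
  shows "k * vol O' \<le> vol (O' \<inter> A)"
proof (cases "k \<le> 0")
  case True
  have "k * vol O' \<le> 0" using True by (intro mult_nonpos_nonneg) auto
  then show ?thesis using measure_nonneg[of lebesgue "O' \<inter> A"] by linarith
next
  case False
  have Qs: "Q \<in> sets lebesgue" if "Q \<in> \<Q>" for Q using \<Q>(3)[OF that] by (rule open_imp_sets_lebesgue)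
  have Qm: "Q \<in> lmeasurable" if "Q \<in> \<Q>" for Q
    using fmeasurableI2[OF O' \<Q>(4)[OF that] Qs[OF that]] .
  have UO: "\<Union>\<Q> \<subseteq> O'" using \<Q>(4) by blast
  have Us: "\<Union>\<Q> \<in> sets lebesgue" using Qs \<Q>(1) by (intro sets.countable_Union) auto
  have dis: "disjoint_family_on (\<lambda>Q. Q) \<Q>" using \<Q>(2) by (auto simp: disjoint_family_on_def pairwise_def disjnt_def)
  then have dis': "disjoint_family_on (\<lambda>Q. Q \<inter> A) \<Q>" by (auto simp: disjoint_family_on_def)
  have "emeasure lebesgue O' = emeasure lebesgue (\<Union>\<Q> \<union> (O' - \<Union>\<Q>))" using UO by (simp add: Un_absorb1)
  also have "\<dots> = emeasure lebesgue (\<Union>\<Q>)"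
    by (rule emeasure_Un_null_set) (use Us neg in \<open>auto simp: negligible_iff_null_sets\<close>)
  also have "\<dots> = (\<integral>\<^sup>+Q. emeasure lebesgue Q \<partial>count_space \<Q>)"
    using emeasure_UN_countable[OF Qs \<Q>(1) dis] by simp
  finally have e: "ennreal k * emeasure lebesgue O' = (\<integral>\<^sup>+Q. ennreal k * emeasure lebesgue Q \<partial>count_space \<Q>)"
    by (simp add: nn_integral_cmult)
  also have "\<dots> \<le> (\<integral>\<^sup>+Q. emeasure lebesgue (Q \<inter> A) \<partial>count_space \<Q>)"
  proof (rule nn_integral_mono)
    fix Q assume "Q \<in> space (count_space \<Q>)"
    then have Q: "Q \<in> \<Q>" by simp
    have "Q \<inter> A \<in> lmeasurable" using Qm[OF Q] A by (rule fmeasurable_Int_fmeasurable)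
    then show "ennreal k * emeasure lebesgue Q \<le> emeasure lebesgue (Q \<inter> A)"
      using le[OF Q] Qm[OF Q] False by (simp add: emeasure_eq_measure2 ennreal_mult'[symmetric] ennreal_leI)
  qed
  also have "\<dots> = emeasure lebesgue (\<Union>Q\<in>\<Q>. Q \<inter> A)"
    by (rule emeasure_UN_countable[symmetric, OF _ \<Q>(1) dis']) (use Qs A in auto)
  also have "\<dots> \<le> emeasure lebesgue (O' \<inter> A)"
    by (rule emeasure_mono) (use UO A O' in auto)
  finally have "ennreal k * emeasure lebesgue O' \<le> emeasure lebesgue (O' \<inter> A)" .
  moreover have "O' \<inter> A \<in> lmeasurable" using O' A by (rule fmeasurable_Int_fmeasurable)
  ultimately show ?thesis using O' False
    by (simp add: emeasure_eq_measure2 ennreal_mult'[symmetric])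
qed

text \<open>
  Interpolation: a difference that is at most \<open>\<rho>\<close> and at most \<open>L |x - y|\<close> is at most
  \<open>\<rho>\<^bsup>1-\<alpha>\<^esup> (L |x - y|)\<^bsup>\<alpha>\<^esup>\<close>. The bound \<open>\<rho>\<close> serves all functions \<open>h\<close> at once.
\<close>

lemma holder_of_lipschitz:
  assumes "0 < \<alpha>" "\<alpha> < 1" "L > 0" "\<eta> > 0"
  obtains \<rho> where "\<rho> > 0" "\<rho> \<le> \<eta>"
    "\<And>(h :: 'a::real_normed_vector \<Rightarrow> real) x y. \<lbrakk>\<And>x y. \<bar>h x - h y\<bar> \<le> L * norm (x - y); \<And>x. 0 \<le> h x \<and> h x \<le> \<rho>\<rbrakk>
      \<Longrightarrow> \<bar>h x - h y\<bar> \<le> \<eta> * norm (x - y) powr \<alpha>"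
proof -
  define r where "r = (\<eta> / L powr \<alpha>) powr (1 / (1 - \<alpha>))"
  have r: "r > 0" "r powr (1 - \<alpha>) = \<eta> / L powr \<alpha>" using assms by (simp_all add: r_def powr_powr)
  show ?thesis
  proof (rule that[of "min r \<eta>"])
    fix h :: "'a \<Rightarrow> real" and x y
    assume lip: "\<And>x y. \<bar>h x - h y\<bar> \<le> L * norm (x - y)" and b: "\<And>x. 0 \<le> h x \<and> h x \<le> min r \<eta>"
    let ?d = "\<bar>h x - h y\<bar>"
    have "?d \<le> r" using b[of x] b[of y] by auto
    show "?d \<le> \<eta> * norm (x - y) powr \<alpha>"
    proof (cases "?d = 0")
      case False
      then have "?d = ?d powr (1 - \<alpha>) * ?d powr \<alpha>" by (simp add: powr_add[symmetric])
      also have "\<dots> \<le> r powr (1 - \<alpha>) * (L * norm (x - y)) powr \<alpha>"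
        using \<open>?d \<le> r\<close> lip[of x y] assms by (intro mult_mono powr_mono2) auto
      also have "\<dots> = \<eta> * norm (x - y) powr \<alpha>" using assms r(2) by (simp add: powr_mult)
      finally show ?thesis .
    qed (use assms in auto)
  qed (use assms r in auto)
qed

section \<open>Realizing one rank-one splitting\<close>

abbreviation grad_region :: "(real^'m \<Rightarrow> real^'d) \<Rightarrow> real^'m^'d \<Rightarrow> (real^'m) set" where
  "grad_region w X \<equiv> affine_near w (\<lambda>y. X *v y)"

lemma linear_matrix_vector: "linear (\<lambda>y. (X :: real^'m^'d) *v y)"
  by (rule matrix_vector_mul_linear)

lemma open_grad_region: "open (grad_region w X)"
  by (rule open_affine_near[OF linear_matrix_vector])

lemma grad_region_unique:
  assumes "x \<in> grad_region w X" "x \<in> grad_region w Y" shows "X = Y"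
  using affine_near_unique[OF linear_matrix_vector linear_matrix_vector assms]
  by (simp add: matrix_eq fun_eq_iff)

definition lipschitz_map :: "(real^'m \<Rightarrow> real^'d) \<Rightarrow> bool" where
  "lipschitz_map w \<longleftrightarrow> (\<exists>L. \<forall>x y. norm (w x - w y) \<le> L * norm (x - y))"

text \<open>
  The tolerance \<open>\<eta>\<close> bounds both the sup norm and the \<open>\<alpha>\<close>-Hoelder seminorm of the change \<open>w' - w\<close>; both
  add up along successive modifications. Nothing is said about the Lipschitz constant of \<open>w'\<close>, which
  may grow without bound in an infinite construction.
\<close>

definition modification ::
    "real \<Rightarrow> real \<Rightarrow> (real^'m) set \<Rightarrow> (real^'m \<Rightarrow> real^'d) \<Rightarrow> (real^'m \<Rightarrow> real^'d) \<Rightarrow> bool" where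
  "modification \<alpha> \<eta> S w w' \<longleftrightarrow> lipschitz_map w' \<and> (\<forall>x. x \<notin> S \<longrightarrow> w' x = w x) \<and>
     (\<forall>x. norm (w' x - w x) \<le> \<eta>) \<and>
     (\<forall>x y. norm ((w' x - w x) - (w' y - w y)) \<le> \<eta> * norm (x - y) powr \<alpha>)"

lemma modification_refl: "lipschitz_map w \<Longrightarrow> 0 \<le> \<eta> \<Longrightarrow> modification \<alpha> \<eta> S w w"
  by (simp add: modification_def)

lemma modification_trans:
  assumes "modification \<alpha> \<eta>1 S w w1" "modification \<alpha> \<eta>2 T w1 w2" "T \<subseteq> S"
  shows "modification \<alpha> (\<eta>1 + \<eta>2) S w w2"
  unfolding modification_def
proof (intro conjI allI impI)
  show "lipschitz_map w2" using assms(2) by (simp add: modification_def)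
  fix x y
  show "x \<notin> S \<Longrightarrow> w2 x = w x" using assms by (auto simp: modification_def)
  have "w2 x - w x = (w1 x - w x) + (w2 x - w1 x)" by simp
  also have "norm \<dots> \<le> \<eta>1 + \<eta>2" using assms by (intro norm_triangle_mono) (auto simp: modification_def)
  finally show "norm (w2 x - w x) \<le> \<eta>1 + \<eta>2" .
  have "(w2 x - w x) - (w2 y - w y) = ((w1 x - w x) - (w1 y - w y)) + ((w2 x - w1 x) - (w2 y - w1 y))" by simp
  also have "norm \<dots> \<le> \<eta>1 * norm (x - y) powr \<alpha> + \<eta>2 * norm (x - y) powr \<alpha>"
    using assms by (intro norm_triangle_mono) (auto simp: modification_def)
  finally show "norm ((w2 x - w x) - (w2 y - w y)) \<le> (\<eta>1 + \<eta>2) * norm (x - y) powr \<alpha>"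
    by (simp add: distrib_right)
qed

definition outer :: "real^'d \<Rightarrow> real^'m \<Rightarrow> real^'m^'d" where
  "outer a v = (\<chi> i. (a $ i) *\<^sub>R v)"

lemma outer_mult_vector: "outer a v *v y = (v \<bullet> y) *\<^sub>R a"
  by (simp add: vec_eq_iff matrix_vector_mult_def outer_def inner_vec_def sum_distrib_left mult_ac)

lemma norm_outer: "norm (outer a v) = norm a * norm v"
proof -
  have "norm (outer a v) = L2_set (\<lambda>i. norm (outer a v $ i)) UNIV" by (rule norm_vec_def)
  also have "\<dots> = L2_set (\<lambda>i. norm (a $ i) * norm v) UNIV"
    by (simp only: outer_def vec_lambda_beta norm_scaleR real_norm_def)
  also have "\<dots> = norm a * norm v"
    by (simp only: norm_vec_def[of a] L2_set_left_distrib norm_ge_zero)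
  finally show ?thesis .
qed

lemma rank_one_factor:
  fixes D :: "real^'m^'d"
  assumes "rank D = 1"
  obtains a n where "n \<noteq> 0" "\<And>y. D *v y = (n \<bullet> y) *\<^sub>R a"
proof -
  let ?V = "range (\<lambda>x. D *v x)"
  have "dim ?V = 1" using assms by (simp add: rank_dim_range)
  obtain B where B: "B \<subseteq> ?V" "independent B" "?V \<subseteq> span B" "card B = dim ?V"
    using basis_exists by blast
  then obtain a where a: "B = {a}" using \<open>dim ?V = 1\<close> card_1_singletonE by metis
  have "a \<noteq> 0" using B(2) a dependent_zero by blast
  then have aa: "a \<bullet> a \<noteq> 0" by simp
  define n where "n = (1 / (a \<bullet> a)) *\<^sub>R (a v* D)"
  have n: "D *v y = (n \<bullet> y) *\<^sub>R a" for y
  proof -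
    have "D *v y \<in> span {a}" using B(3) a by blast
    then obtain k where k: "D *v y = k *\<^sub>R a" by (auto simp: span_singleton)
    have "n \<bullet> y = (a \<bullet> (D *v y)) / (a \<bullet> a)" by (simp add: n_def dot_lmul_matrix)
    then show ?thesis using aa by (simp add: k)
  qed
  have "n \<noteq> 0"
  proof
    assume "n = 0"
    then have "?V \<subseteq> {0}" using n by auto
    then show False using B(1) a \<open>a \<noteq> 0\<close> by blast
  qed
  then show ?thesis using that n by blast
qed

text \<open>
  On each box of a decomposition of \<open>S\<close> a multiple of a profile is added in the direction \<open>a\<close> of the
  rank-one matrix \<open>B - C = a \<otimes> n\<close>. A slope \<open>v\<close> of the profile changes the gradient \<open>X\<close> to \<open>X + a \<otimes> v\<close>,
  which is \<open>B\<close>, \<open>C\<close> or within \<open>\<delta>\<close> of \<open>X\<close>. The profiles vanish outside their boxes, so gluing them at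
  most doubles their moduli of continuity.
\<close>

lemma rank_one_splitting:
  fixes w :: "real^'m \<Rightarrow> real^'d"
  assumes w: "lipschitz_map w" and S: "open S" "bounded S" "S \<subseteq> grad_region w X"
    and X: "X = \<theta> *\<^sub>R B + (1 - \<theta>) *\<^sub>R C" and \<theta>: "0 < \<theta>" "\<theta> < 1" and rank: "rank (C - B) = 1"
    and \<tau>: "0 < \<tau>" "\<tau> \<le> 1" and \<alpha>: "0 < \<alpha>" "\<alpha> < 1" and "\<delta> > 0" "\<eta> > 0"
  shows "\<exists>w'. modification \<alpha> \<eta> S w w' \<and>
    negligible (S - (\<Union>Y\<in>{B, C} \<union> cball X \<delta>. grad_region w' Y)) \<and>
    (\<tau> * \<theta> - \<eta>) * vol S \<le> vol (S \<inter> grad_region w' B) \<and>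
    (\<tau> * (1 - \<theta>) - \<eta>) * vol S \<le> vol (S \<inter> grad_region w' C) \<and>
    (1 - \<tau> - \<eta>) * vol S \<le> vol (S \<inter> grad_region w' X)"
proof -
  obtain a' n where n: "n \<noteq> 0" "\<And>y. (C - B) *v y = (n \<bullet> y) *\<^sub>R a'"
    using rank_one_factor[OF rank] by metis
  define a where "a = - a'"
  have BX: "X *v y + (((1 - \<theta>) *\<^sub>R n) \<bullet> y) *\<^sub>R a = B *v y" and CX: "X *v y + (((- \<theta>) *\<^sub>R n) \<bullet> y) *\<^sub>R a = C *v y" for y
  proof -
    have e: "(n \<bullet> y) *\<^sub>R a = B *v y - C *v y" unfolding a_def scaleR_minus_right n(2)[symmetric] by (simp add: matrix_vector_mult_diff_rdistrib)
    have Xy: "X *v y = \<theta> *\<^sub>R (B *v y) + (1 - \<theta>) *\<^sub>R (C *v y)"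
      unfolding X by (simp add: matrix_vector_mult_add_rdistrib scaleR_matrix_vector_assoc)
    have "(((1 - \<theta>) *\<^sub>R n) \<bullet> y) *\<^sub>R a = (1 - \<theta>) *\<^sub>R (B *v y - C *v y)"
      "(((- \<theta>) *\<^sub>R n) \<bullet> y) *\<^sub>R a = - \<theta> *\<^sub>R (B *v y - C *v y)"
      unfolding e[symmetric] by simp_all
    then show "X *v y + (((1 - \<theta>) *\<^sub>R n) \<bullet> y) *\<^sub>R a = B *v y" "X *v y + (((- \<theta>) *\<^sub>R n) \<bullet> y) *\<^sub>R a = C *v y"
      unfolding Xy by (simp_all add: algebra_simps)
  qed
  (* The added 1 keeps the denominators positive. *)
  define \<delta>' where "\<delta>' = \<delta> / (norm a + 1)"
  have na: "norm a + 1 > 0" by (simp add: add_nonneg_pos)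
  have \<delta>': "\<delta>' > 0" "norm a * \<delta>' \<le> \<delta>"
  proof -
    show "\<delta>' > 0" using \<open>\<delta> > 0\<close> na by (simp add: \<delta>'_def)
    have "norm a * \<delta> \<le> (norm a + 1) * \<delta>" using \<open>\<delta> > 0\<close> by (intro mult_right_mono) auto
    then show "norm a * \<delta>' \<le> \<delta>" using na by (simp add: \<delta>'_def divide_le_eq mult.commute)
  qed
  define L where "L = norm n + \<delta>'"
  have "L > 0" using \<delta>'(1) by (simp add: L_def add_nonneg_pos)
  define \<eta>' where "\<eta>' = \<eta> / (2 * (norm a + 1))"
  have \<eta>': "\<eta>' > 0" "2 * \<eta>' * norm a \<le> \<eta>"
  proof -
    show "\<eta>' > 0" using \<open>\<eta> > 0\<close> na by (simp add: \<eta>'_def)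
    have "norm a * \<eta> \<le> (norm a + 1) * \<eta>" using \<open>\<eta> > 0\<close> by (intro mult_right_mono) auto
    then show "2 * \<eta>' * norm a \<le> \<eta>" using na by (simp add: \<eta>'_def field_simps)
  qed
  obtain \<rho> where \<rho>: "\<rho> > 0" "\<rho> \<le> \<eta>'"
    "\<And>(h :: real^'m \<Rightarrow> real) x y. \<lbrakk>\<And>x y. \<bar>h x - h y\<bar> \<le> L * norm (x - y); \<And>x. 0 \<le> h x \<and> h x \<le> \<rho>\<rbrakk>
      \<Longrightarrow> \<bar>h x - h y\<bar> \<le> \<eta>' * norm (x - y) powr \<alpha>"
    using holder_of_lipschitz[OF \<alpha> \<open>L > 0\<close> \<eta>'(1)] by blast
  have gS: "open S \<and> x \<in> S" if "x \<in> S" for x using that S(1) by blast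
  obtain \<Q> where Q0: "countable \<Q>" "disjoint \<Q>" "\<forall>Q\<in>\<Q>. \<exists>c d. Q = box c d \<and> box c d \<noteq> {}"
    "\<forall>Q\<in>\<Q>. \<exists>x\<in>S. Q \<subseteq> S" "negligible (S - \<Union>\<Q>)"
    by (rule box_decomposition[OF S(2) gS])
  then have \<Q>: "countable \<Q>" "disjoint \<Q>" "\<And>Q. Q \<in> \<Q> \<Longrightarrow> \<exists>c d. Q = box c d \<and> box c d \<noteq> {}"
    "\<And>Q. Q \<in> \<Q> \<Longrightarrow> Q \<subseteq> S" "negligible (S - \<Union>\<Q>)"
    by blast+
  let ?V = "{(1 - \<theta>) *\<^sub>R n, (- \<theta>) *\<^sub>R n} \<union> cball 0 \<delta>'"
  define good where "good Q h \<longleftrightarrow> (\<forall>x y. \<bar>h x - h y\<bar> \<le> L * norm (x - y)) \<and> (\<forall>x. x \<notin> Q \<longrightarrow> h x = 0) \<and> (\<forall>x. 0 \<le> h x \<and> h x \<le> \<rho>) \<and>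
    piecewise_gradients Q h ?V \<and>
    (\<tau> * \<theta> - \<eta>) * vol Q \<le> vol (Q \<inter> slope_region h ((1 - \<theta>) *\<^sub>R n)) \<and>
    (\<tau> * (1 - \<theta>) - \<eta>) * vol Q \<le> vol (Q \<inter> slope_region h ((- \<theta>) *\<^sub>R n)) \<and>
    (1 - \<tau> - \<eta>) * vol Q \<le> vol (Q \<inter> slope_region h 0)" for Q h
  have "\<exists>h. good Q h" if Q: "Q \<in> \<Q>" for Q
  proof -
    obtain c d where cd: "Q = box c d" "box c d \<noteq> {}" using \<Q>(3)[OF Q] by blast
    show ?thesis unfolding good_def cd(1) L_def
      by (rule ex_laminate_profile[OF n(1) \<theta> \<tau> \<delta>'(1) \<rho>(1) \<open>\<eta> > 0\<close> cd(2)])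
  qed
  then obtain h where hg: "\<And>Q. Q \<in> \<Q> \<Longrightarrow> good Q (h Q)" by metis
  then have h: "\<And>Q x y. Q \<in> \<Q> \<Longrightarrow> \<bar>h Q x - h Q y\<bar> \<le> L * norm (x - y)"
      "\<And>Q x. Q \<in> \<Q> \<Longrightarrow> x \<notin> Q \<Longrightarrow> h Q x = 0" "\<And>Q x. Q \<in> \<Q> \<Longrightarrow> 0 \<le> h Q x \<and> h Q x \<le> \<rho>"
      "\<And>Q. Q \<in> \<Q> \<Longrightarrow> piecewise_gradients Q (h Q) ?V"
    and hm: "\<And>Q. Q \<in> \<Q> \<Longrightarrow> (\<tau> * \<theta> - \<eta>) * vol Q \<le> vol (Q \<inter> slope_region (h Q) ((1 - \<theta>) *\<^sub>R n))"
      "\<And>Q. Q \<in> \<Q> \<Longrightarrow> (\<tau> * (1 - \<theta>) - \<eta>) * vol Q \<le> vol (Q \<inter> slope_region (h Q) ((- \<theta>) *\<^sub>R n))"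
      "\<And>Q. Q \<in> \<Q> \<Longrightarrow> (1 - \<tau> - \<eta>) * vol Q \<le> vol (Q \<inter> slope_region (h Q) 0)"
    unfolding good_def by blast+
  define H where "H x = (if \<exists>Q\<in>\<Q>. x \<in> Q then h (SOME Q. Q \<in> \<Q> \<and> x \<in> Q) x else 0)" for x
  have H: "H x = h Q x" if "Q \<in> \<Q>" "x \<in> Q" for Q x
  proof -
    have "(SOME Q. Q \<in> \<Q> \<and> x \<in> Q) = Q"
      using that \<Q>(2) by (intro some_equality) (auto simp: pairwise_def disjnt_def)
    then show ?thesis using that by (auto simp: H_def)
  qed
  have H0: "H x = 0" if "\<And>Q. Q \<in> \<Q> \<Longrightarrow> x \<notin> Q" for x using that by (auto simp: H_def)
  (* For x and y in different boxes both profiles vanish at the other point, so the difference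
     splits into two differences of a single profile. *)
  have Hm: "\<bar>H x - H y\<bar> \<le> 2 * m x y"
    if m: "\<And>Q x y. Q \<in> \<Q> \<Longrightarrow> \<bar>h Q x - h Q y\<bar> \<le> m x y" "\<And>x y. 0 \<le> m x y" for m :: "real^'m \<Rightarrow> real^'m \<Rightarrow> real" and x y
  proof -
    consider Q Q' where "Q \<in> \<Q>" "x \<in> Q" "Q' \<in> \<Q>" "y \<in> Q'"
      | Q where "Q \<in> \<Q>" "x \<in> Q" "H y = 0" "y \<notin> Q" | Q where "Q \<in> \<Q>" "y \<in> Q" "H x = 0" "x \<notin> Q" | "H x = 0" "H y = 0"
      using H0 by metis
    then show ?thesis
    proof cases
      case 1
      show ?thesis
      proof (cases "Q = Q'")
        case True
        then show ?thesis using m(1)[OF 1(1), of x y] m(2)[of x y] H[OF 1(1,2)] H[OF 1(3,4)] by simp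
      next
        case False
        then have "y \<notin> Q" "x \<notin> Q'" using 1 \<Q>(2) by (auto simp: pairwise_def disjnt_def)
        then have "h Q y = 0" "h Q' x = 0" using h(2) 1 by auto
        then show ?thesis using m(1)[OF 1(1), of x y] m(1)[OF 1(3), of x y] H[OF 1(1,2)] H[OF 1(3,4)] by linarith
      qed
    next
      case 2
      then show ?thesis using m(1)[OF 2(1), of x y] m(2)[of x y] H[OF 2(1,2)] h(2)[OF 2(1,4)] by simp
    next
      case 3
      then show ?thesis using m(1)[OF 3(1), of x y] m(2)[of x y] H[OF 3(1,2)] h(2)[OF 3(1,4)] by simp
    qed (use m(2)[of x y] in simp)
  qed
  have Hlip: "\<bar>H x - H y\<bar> \<le> 2 * (L * norm (x - y))" for x y
    by (rule Hm) (use h(1) \<open>L > 0\<close> in auto)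
  have Hhol: "\<bar>H x - H y\<bar> \<le> 2 * (\<eta>' * norm (x - y) powr \<alpha>)" for x y
    by (rule Hm) (use \<rho>(3) h(1,3) \<eta>'(1) in auto)
  have Hb: "\<bar>H x\<bar> \<le> \<eta>'" for x
  proof (cases "\<exists>Q\<in>\<Q>. x \<in> Q")
    case True
    then obtain Q where "Q \<in> \<Q>" "x \<in> Q" by blast
    then show ?thesis using H[of Q x] h(3)[of Q x] \<rho>(2) by auto
  qed (use H0 \<eta>'(1) in auto)
  define w' where "w' x = w x + H x *\<^sub>R a" for x
  have mod: "modification \<alpha> \<eta> S w w'"
    unfolding modification_def
  proof (intro conjI allI impI)
    obtain Lw where Lw: "\<And>x y. norm (w x - w y) \<le> Lw * norm (x - y)" using w unfolding lipschitz_map_def by blast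
    have "norm (w' x - w' y) \<le> (Lw + 2 * L * norm a) * norm (x - y)" for x y
    proof -
      have "w' x - w' y = (w x - w y) + (H x - H y) *\<^sub>R a" by (simp add: w'_def algebra_simps)
      also have "norm \<dots> \<le> Lw * norm (x - y) + \<bar>H x - H y\<bar> * norm a"
        using Lw by (intro norm_triangle_mono) auto
      also have "\<bar>H x - H y\<bar> * norm a \<le> (2 * (L * norm (x - y))) * norm a"
        using Hlip by (intro mult_right_mono) auto
      finally show ?thesis by (simp add: algebra_simps)
    qed
    then show "lipschitz_map w'" unfolding lipschitz_map_def by blast
    fix x y
    show "x \<notin> S \<Longrightarrow> w' x = w x" using H0 \<Q>(4) by (force simp: w'_def)
    have "norm (w' x - w x) = \<bar>H x\<bar> * norm a" by (simp add: w'_def)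
    also have "\<dots> \<le> \<eta>' * norm a" using Hb by (intro mult_right_mono) auto
    also have "\<dots> \<le> \<eta>" using \<eta>' mult_nonneg_nonneg[of \<eta>' "norm a"] norm_ge_zero[of a] by linarith
    finally show "norm (w' x - w x) \<le> \<eta>" .
    have "norm ((w' x - w x) - (w' y - w y)) = \<bar>H x - H y\<bar> * norm a"
      by (simp add: w'_def scaleR_left_diff_distrib[symmetric])
    also have "\<dots> \<le> (2 * (\<eta>' * norm (x - y) powr \<alpha>)) * norm a" using Hhol by (intro mult_right_mono) auto
    also have "\<dots> = (2 * \<eta>' * norm a) * norm (x - y) powr \<alpha>" by simp
    also have "\<dots> \<le> \<eta> * norm (x - y) powr \<alpha>" using \<eta>'(2) by (intro mult_right_mono) auto
    finally show "norm ((w' x - w x) - (w' y - w y)) \<le> \<eta> * norm (x - y) powr \<alpha>" .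
  qed
  have oQ: "open Q" if "Q \<in> \<Q>" for Q using \<Q>(3)[OF that] by auto
  have key: "x \<in> grad_region w' Y"
    if "Q \<in> \<Q>" "x \<in> Q" "x \<in> slope_region (h Q) v" "\<And>y. X *v y + (v \<bullet> y) *\<^sub>R a = Y *v y" for Q x v Y
  proof -
    have "x \<in> slope_region H v"
      by (rule affine_near_cong[OF oQ[OF that(1)] that(2) _ that(3)]) (use H[OF that(1)] in simp)
    then have "x \<in> affine_near (\<lambda>y. H y *\<^sub>R a) (\<lambda>y. (v \<bullet> y) *\<^sub>R a)"
      by (rule affine_near_linear_image[where L = "\<lambda>t. t *\<^sub>R a"]) (simp add: linear_iff scaleR_left_distrib)
    moreover have "x \<in> grad_region w X" using S(3) \<Q>(4) that by blast
    ultimately have "x \<in> affine_near (\<lambda>y. w y + H y *\<^sub>R a) (\<lambda>y. X *v y + (v \<bullet> y) *\<^sub>R a)"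
      by (intro affine_near_add)
    then show ?thesis unfolding that(4) w'_def[abs_def] .
  qed
  have neg: "negligible (S - (\<Union>Y\<in>{B, C} \<union> cball X \<delta>. grad_region w' Y))"
  proof (rule negligible_subset)
    show "negligible ((S - \<Union>\<Q>) \<union> (\<Union>Q\<in>\<Q>. Q - (\<Union>v\<in>?V. slope_region (h Q) v)))"
      using \<Q>(1,5) h(4) unfolding piecewise_gradients_def by (intro negligible_Un negligible_countable_Union) auto
    have "\<exists>Y\<in>{B, C} \<union> cball X \<delta>. x \<in> grad_region w' Y"
      if "Q \<in> \<Q>" "x \<in> Q" "v \<in> ?V" "x \<in> slope_region (h Q) v" for Q x v
    proof -
      have "\<exists>Y\<in>{B, C} \<union> cball X \<delta>. \<forall>y. X *v y + (v \<bullet> y) *\<^sub>R a = Y *v y"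
      proof -
        consider "v = (1 - \<theta>) *\<^sub>R n" | "v = (- \<theta>) *\<^sub>R n" | "v \<in> cball 0 \<delta>'" using \<open>v \<in> ?V\<close> by blast
        then show ?thesis
        proof cases
          case 1 show ?thesis unfolding 1 by (intro bexI[of _ B]) (use BX in auto)
        next
          case 2 show ?thesis unfolding 2 by (intro bexI[of _ C]) (use CX in auto)
        next
          case 3
          have "norm (outer a v) \<le> norm a * \<delta>'" unfolding norm_outer using 3 by (intro mult_left_mono) auto
          then have "X + outer a v \<in> cball X \<delta>" using \<delta>'(2) by (simp add: dist_norm)
          moreover have "X *v y + (v \<bullet> y) *\<^sub>R a = (X + outer a v) *v y" for y
            by (simp add: matrix_vector_mult_add_rdistrib outer_mult_vector)
          ultimately show ?thesis by blast
        qed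
      qed
      then show ?thesis using key[OF that(1,2,4)] by blast
    qed
    then show "S - (\<Union>Y\<in>{B, C} \<union> cball X \<delta>. grad_region w' Y) \<subseteq>
        (S - \<Union>\<Q>) \<union> (\<Union>Q\<in>\<Q>. Q - (\<Union>v\<in>?V. slope_region (h Q) v))"
      by blast
  qed
  have Sm: "S \<in> lmeasurable" using S by (intro lmeasurable_open)
  have bound: "k * vol S \<le> vol (S \<inter> grad_region w' Y)"
    if k: "\<And>Q. Q \<in> \<Q> \<Longrightarrow> k * vol Q \<le> vol (Q \<inter> slope_region (h Q) v)"
      and Y: "\<And>y. X *v y + (v \<bullet> y) *\<^sub>R a = Y *v y" for k v Y
  proof (rule measure_ge_of_boxes[OF \<Q>(1,2) oQ \<Q>(4,5) Sm])
    show "grad_region w' Y \<in> sets lebesgue" by (intro open_imp_sets_lebesgue open_grad_region)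
    fix Q assume Q: "Q \<in> \<Q>"
    have bQ: "bounded Q" using \<Q>(4)[OF Q] S(2) bounded_subset by blast
    have "vol (Q \<inter> slope_region (h Q) v) \<le> vol (Q \<inter> grad_region w' Y)"
    proof (rule measure_mono_fmeasurable)
      show "Q \<inter> slope_region (h Q) v \<subseteq> Q \<inter> grad_region w' Y" using key[OF Q _ _ Y] by blast
      show "Q \<inter> slope_region (h Q) v \<in> sets lebesgue"
        by (intro open_imp_sets_lebesgue open_Int oQ[OF Q] open_affine_near linear_inner_left)
      show "Q \<inter> grad_region w' Y \<in> lmeasurable"
        by (intro lmeasurable_open open_Int oQ[OF Q] open_grad_region) (use bQ bounded_Int in blast)
    qed
    then show "k * vol Q \<le> vol (Q \<inter> grad_region w' Y)" using k[OF Q] by linarith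
  qed auto
  have XX: "X *v y + ((0 :: real^'m) \<bullet> y) *\<^sub>R a = X *v y" for y by simp
  show ?thesis
    by (intro exI[of _ w'] conjI mod neg bound[OF hm(1) BX] bound[OF hm(2) CX] bound[OF hm(3) XX])
qed

section \<open>Realizing laminates of finite order\<close>

lemma measure_convex_mix:
  assumes "borel_prob \<mu>" "borel_prob \<nu>" "\<theta> \<in> {0..1}" "E \<in> sets borel"
  shows "measure (convex_mix \<theta> \<mu> \<nu>) E = \<theta> * measure \<mu> E + (1 - \<theta>) * measure \<nu> E"
proof -
  interpret \<mu>: prob_space \<mu> using assms(1) by (simp add: borel_prob_def)
  interpret \<nu>: prob_space \<nu> using assms(2) by (simp add: borel_prob_def)
  have "emeasure (convex_mix \<theta> \<mu> \<nu>) E = ennreal (\<theta> * measure \<mu> E + (1 - \<theta>) * measure \<nu> E)"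
    using assms by (subst emeasure_convex_mix)
      (auto simp: borel_prob_def \<mu>.emeasure_eq_measure \<nu>.emeasure_eq_measure ennreal_mult'[symmetric] ennreal_plus[symmetric]
        simp del: ennreal_plus)
  then show ?thesis using assms(3) by (intro measure_eq_emeasure_eq_ennreal) auto
qed

lemma borel_prob_return: "borel_prob (return borel X)"
  by (simp add: borel_prob_def prob_space_return)

lemma borel_prob_convex_mix:
  assumes "borel_prob \<mu>" "borel_prob \<nu>" "\<theta> \<in> {0..1}"
  shows "borel_prob (convex_mix \<theta> \<mu> \<nu>)"
  unfolding borel_prob_def
proof (intro conjI prob_spaceI)
  interpret \<mu>: prob_space \<mu> using assms(1) by (simp add: borel_prob_def)
  interpret \<nu>: prob_space \<nu> using assms(2) by (simp add: borel_prob_def)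
  have sp: "space (convex_mix \<theta> \<mu> \<nu>) = UNIV" "space \<mu> = UNIV" "space \<nu> = UNIV"
    using sets_eq_imp_space_eq[OF sets_convex_mix, of \<theta> \<mu> \<nu>] assms sets_eq_imp_space_eq[of \<mu> borel] sets_eq_imp_space_eq[of \<nu> borel]
    by (auto simp: borel_prob_def)
  show "emeasure (convex_mix \<theta> \<mu> \<nu>) (space (convex_mix \<theta> \<mu> \<nu>)) = 1"
    using assms \<mu>.emeasure_space_1 \<nu>.emeasure_space_1 unfolding sp
    by (subst emeasure_convex_mix) (auto simp: borel_prob_def ennreal_plus[symmetric] simp del: ennreal_plus)
qed simp

lemma measure_return_singleton: "measure (return borel X) {Y :: 'a::t1_space} = (if Y = X then 1 else 0)"
  by (simp add: measure_return indicator_def)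

text \<open>
  An elementary splitting may act on a part \<open>s\<close> of the
  mass at \<open>X\<close>, and \<open>B\<close> and \<open>C\<close> may already carry mass.
\<close>

lemma splitting_weights:
  fixes \<nu> \<mu> :: "(real^'m^'d) measure"
  assumes "elementary_splitting U \<nu> \<mu>"
  obtains s X \<theta> B C where "0 < s" "s \<le> measure \<nu> {X}" "X \<in> U" "0 < \<theta>" "\<theta> < 1"
    "X = \<theta> *\<^sub>R B + (1 - \<theta>) *\<^sub>R C" "rank (C - B) = 1"
    "\<forall>Y. measure \<mu> {Y} = measure \<nu> {Y} - (if Y = X then s else 0) + (if Y = B then s * \<theta> else 0) + (if Y = C then s * (1 - \<theta>) else 0)"
proof -
  obtain s X \<nu>' B C \<theta> where *: "s \<in> {0<..1}" "borel_prob \<nu>'" "\<nu> = convex_mix s (return borel X) \<nu>'"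
      "X \<in> U" "\<theta> \<in> {0<..<1}" "X = \<theta> *\<^sub>R B + (1 - \<theta>) *\<^sub>R C" "rank (C - B) = 1"
      "\<mu> = convex_mix s (convex_mix \<theta> (return borel B) (return borel C)) \<nu>'"
    using assms unfolding elementary_splitting_def by blast
  have \<nu>: "measure \<nu> {Y} = s * (if Y = X then 1 else 0) + (1 - s) * measure \<nu>' {Y}" for Y
    unfolding *(3) using *(1,2) by (subst measure_convex_mix) (auto simp: borel_prob_return measure_return_singleton)
  have m: "measure (convex_mix \<theta> (return borel B) (return borel C)) {Y} = \<theta> * (if Y = B then 1 else 0) + (1 - \<theta>) * (if Y = C then 1 else 0)" for Y
    using *(5) by (subst measure_convex_mix) (auto simp: borel_prob_return measure_return_singleton)
  have \<mu>: "measure \<mu> {Y} = s * measure (convex_mix \<theta> (return borel B) (return borel C)) {Y} + (1 - s) * measure \<nu>' {Y}" for Y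
    unfolding *(8) using *(1,2,5) by (subst measure_convex_mix) (auto intro!: borel_prob_convex_mix borel_prob_return)
  show ?thesis
  proof (rule that)
    show "s \<le> measure \<nu> {X}" using \<nu>[of X] *(1) by simp
    show "\<forall>Y. measure \<mu> {Y} = measure \<nu> {Y} - (if Y = X then s else 0) + (if Y = B then s * \<theta> else 0) + (if Y = C then s * (1 - \<theta>) else 0)"
      unfolding \<mu> \<nu> m by (auto simp: algebra_simps)
  qed (use * in auto)
qed

text \<open>
  Gradients are either atoms of \<open>\<omega>\<close> or errors in a bounded part of \<open>U\<close>. Errors whose gradient happens
  to be an atom are not distinguished from it. Since the weights of a finitely supported \<open>\<omega>\<close> sum to
  \<open>1\<close>, the lower bounds on the volumes determine them up to a multiple of \<open>\<eta>\<close>.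
\<close>

definition realizes ::
    "real \<Rightarrow> real \<Rightarrow> (real^'m^'d) set \<Rightarrow> real \<Rightarrow> (real^'m^'d) measure \<Rightarrow>
     (real^'m) set \<Rightarrow> (real^'m \<Rightarrow> real^'d) \<Rightarrow> (real^'m \<Rightarrow> real^'d) \<Rightarrow> bool" where
  "realizes \<alpha> \<eta> U \<rho> \<omega> S w w' \<longleftrightarrow> modification \<alpha> \<eta> S w w' \<and>
     negligible (S - (\<Union>Y\<in>{Y. 0 < measure \<omega> {Y}} \<union> {Y\<in>U. norm Y \<le> \<rho>}. grad_region w' Y)) \<and>
     (\<forall>Y. (measure \<omega> {Y} - \<eta>) * vol S \<le> vol (S \<inter> grad_region w' Y))"

text \<open>
  The bound \<open>\<rho>\<close> for the errors is fixed before the tolerance \<open>\<eta>\<close>. A smaller \<open>\<eta>\<close> thus makes the volume of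
  the error set times any power of \<open>\<rho>\<close> as small as desired, which is how the \<open>L\<^sup>q\<close> bound is achieved
  for all \<open>q\<close>.
\<close>

definition realizable :: "real \<Rightarrow> (real^'m^'d) set \<Rightarrow> real \<Rightarrow> real^'m^'d \<Rightarrow> (real^'m^'d) measure \<Rightarrow> bool" where
  "realizable \<alpha> U \<rho> X \<omega> \<longleftrightarrow> (\<forall>\<eta>>0. \<forall>w S. lipschitz_map w \<longrightarrow> open S \<longrightarrow> bounded S \<longrightarrow> S \<subseteq> grad_region w X \<longrightarrow>
     (\<exists>w'. realizes \<alpha> \<eta> U \<rho> \<omega> S w w'))"

text \<open>
  First \<open>\<nu>\<close> is realized; then, in the region \<open>P\<close> with gradient \<open>X\<close>, a fraction \<open>\<tau> = s / \<nu>{X}\<close> of the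
  volume is split into \<open>B\<close> and \<open>C\<close>. The new errors are close to \<open>X\<close>, which lies in the open set \<open>U\<close>
  because the splitting originates from \<open>U\<close>.
\<close>

lemma realizable_splitting:
  fixes \<nu> \<mu> :: "(real^'m^'d) measure"
  assumes U: "open U" and \<alpha>: "0 < \<alpha>" "\<alpha> < 1" and re: "realizable \<alpha> U \<rho> X0 \<nu>" and spl: "elementary_splitting U \<nu> \<mu>"
  shows "\<exists>\<rho>'. realizable \<alpha> U \<rho>' X0 \<mu>"
proof -
  obtain s X \<theta> B C where s: "0 < s" "s \<le> measure \<nu> {X}" and X: "X \<in> U" and \<theta>: "0 < \<theta>" "\<theta> < 1"
    and XBC: "X = \<theta> *\<^sub>R B + (1 - \<theta>) *\<^sub>R C" and rk: "rank (C - B) = 1"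
    and \<mu>': "\<forall>Y. measure \<mu> {Y} = measure \<nu> {Y} - (if Y = X then s else 0) + (if Y = B then s * \<theta> else 0) + (if Y = C then s * (1 - \<theta>) else 0)"
    by (rule splitting_weights[OF spl])
  note \<mu> = \<mu>'[rule_format]
  have "B \<noteq> C" using rk by (auto simp: rank_eq_0)
  have "B - X = (1 - \<theta>) *\<^sub>R (B - C)" "X - C = \<theta> *\<^sub>R (B - C)"
    unfolding XBC by (simp_all add: algebra_simps)
  then have XB: "X \<noteq> B" and XC: "X \<noteq> C" using \<theta> \<open>B \<noteq> C\<close> by auto
  define v where "v = measure \<nu> {X}"
  define \<tau> where "\<tau> = s / v"
  have \<tau>: "0 < \<tau>" "\<tau> \<le> 1" "\<tau> * v = s" using s by (auto simp: \<tau>_def v_def)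
  obtain \<delta>0 where \<delta>0: "\<delta>0 > 0" "cball X \<delta>0 \<subseteq> U" using U X open_contains_cball by blast
  define \<delta> where "\<delta> = min \<delta>0 1"
  define \<rho>' where "\<rho>' = max \<rho> (norm X + 1)"
  have \<delta>: "\<delta> > 0" "cball X \<delta> \<subseteq> {Y\<in>U. norm Y \<le> \<rho>'}"
  proof -
    show "\<delta> > 0" using \<delta>0 by (simp add: \<delta>_def)
    have "norm Y \<le> norm X + 1" if "Y \<in> cball X \<delta>" for Y
      using that norm_triangle_ineq2[of Y X] by (auto simp: \<delta>_def dist_norm norm_minus_commute)
    then show "cball X \<delta> \<subseteq> {Y\<in>U. norm Y \<le> \<rho>'}" using \<delta>0 by (fastforce simp: \<delta>_def \<rho>'_def)
  qed
  have "realizable \<alpha> U \<rho>' X0 \<mu>"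
    unfolding realizable_def
  proof (intro allI impI)
    fix \<eta> :: real and w S
    assume \<eta>: "\<eta> > 0" and w: "lipschitz_map w" and S: "open S" "bounded S" "S \<subseteq> grad_region w X0"
    (* One third each for realizing nu, for the splitting, and for the effect of the error in the
       volume of P on the volume that is split off. *)
    define e where "e = \<eta> / 3"
    have e: "e > 0" "3 * e = \<eta>" using \<eta> by (auto simp: e_def)
    obtain w1 where w1: "modification \<alpha> e S w w1"
      "negligible (S - (\<Union>Y\<in>{Y. 0 < measure \<nu> {Y}} \<union> {Y\<in>U. norm Y \<le> \<rho>}. grad_region w1 Y))"
      "\<And>Y. (measure \<nu> {Y} - e) * vol S \<le> vol (S \<inter> grad_region w1 Y)"
      using re w S e(1) unfolding realizable_def realizes_def by meson
    define P where "P = S \<inter> grad_region w1 X"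
    have P: "open P" "bounded P" "P \<subseteq> grad_region w1 X" "P \<subseteq> S"
      using S open_grad_region by (auto simp: P_def intro: bounded_Int)
    have "lipschitz_map w1" using w1(1) by (simp add: modification_def)
    obtain w2 where w2: "modification \<alpha> e P w1 w2"
      "negligible (P - (\<Union>Y\<in>{B, C} \<union> cball X \<delta>. grad_region w2 Y))"
      "(\<tau> * \<theta> - e) * vol P \<le> vol (P \<inter> grad_region w2 B)"
      "(\<tau> * (1 - \<theta>) - e) * vol P \<le> vol (P \<inter> grad_region w2 C)"
      "(1 - \<tau> - e) * vol P \<le> vol (P \<inter> grad_region w2 X)"
      using rank_one_splitting[OF \<open>lipschitz_map w1\<close> P(1-3) XBC \<theta> rk \<tau>(1,2) \<alpha> \<delta>(1) e(1)] by blast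
    (* The second modification does not touch the regions with gradient different from X. *)
    have keep: "x \<in> grad_region w2 Y" if "x \<in> grad_region w1 Y" "Y \<noteq> X" for x Y
    proof (rule affine_near_cong[OF open_grad_region that(1) _ that(1)])
      fix y assume "y \<in> grad_region w1 Y"
      then have "y \<notin> P" using grad_region_unique that(2) unfolding P_def by blast
      then show "w1 y = w2 y" using w2(1) by (simp add: modification_def)
    qed
    have mod: "modification \<alpha> \<eta> S w w2"
    proof -
      have "modification \<alpha> (e + e) S w w2" by (rule modification_trans[OF w1(1) w2(1) P(4)])
      moreover have "(e + e) * r \<le> \<eta> * r" if "0 \<le> r" for r using e that by (intro mult_right_mono) auto
      ultimately show ?thesis unfolding modification_def using e
        by (smt (verit) powr_ge_zero)
    qed
    let ?T = "{Y. 0 < measure \<mu> {Y}} \<union> {Y\<in>U. norm Y \<le> \<rho>'}"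
    have pos: "0 < measure \<mu> {Y}" if "0 < measure \<nu> {Y}" "Y \<noteq> X" for Y
      using that s(1) \<theta> unfolding \<mu> by (auto intro!: add_pos_nonneg)
    have posBC: "0 < measure \<mu> {B}" "0 < measure \<mu> {C}"
      using s(1) \<theta> XB XC measure_nonneg[of \<nu> "{B}"] measure_nonneg[of \<nu> "{C}"] unfolding \<mu>
      by (auto intro!: add_nonneg_pos)
    have neg: "negligible (S - (\<Union>Y\<in>?T. grad_region w2 Y))"
    proof (rule negligible_subset)
      show "negligible ((S - (\<Union>Y\<in>{Y. 0 < measure \<nu> {Y}} \<union> {Y\<in>U. norm Y \<le> \<rho>}. grad_region w1 Y)) \<union>
          (P - (\<Union>Y\<in>{B, C} \<union> cball X \<delta>. grad_region w2 Y)))"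
        by (intro negligible_Un w1 w2)
      have 1: "{B, C} \<union> cball X \<delta> \<subseteq> ?T" using posBC \<delta>(2) by auto
      have 2: "Y \<in> ?T" if "Y \<in> {Y. 0 < measure \<nu> {Y}} \<union> {Y\<in>U. norm Y \<le> \<rho>}" "Y \<noteq> X" for Y
        using that pos by (auto simp: \<rho>'_def)
      show "S - (\<Union>Y\<in>?T. grad_region w2 Y) \<subseteq> (S - (\<Union>Y\<in>{Y. 0 < measure \<nu> {Y}} \<union> {Y\<in>U. norm Y \<le> \<rho>}. grad_region w1 Y)) \<union>
          (P - (\<Union>Y\<in>{B, C} \<union> cball X \<delta>. grad_region w2 Y))"
      proof
        fix x assume x: "x \<in> S - (\<Union>Y\<in>?T. grad_region w2 Y)"
        show "x \<in> (S - (\<Union>Y\<in>{Y. 0 < measure \<nu> {Y}} \<union> {Y\<in>U. norm Y \<le> \<rho>}. grad_region w1 Y)) \<union>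
          (P - (\<Union>Y\<in>{B, C} \<union> cball X \<delta>. grad_region w2 Y))"
        proof (cases "x \<in> P")
          case True then show ?thesis using x 1 by blast
        next
          case False then show ?thesis using x 2 keep unfolding P_def by blast
        qed
      qed
    qed
    let ?o = "vol S" and ?p = "vol P"
    have lm: "S \<inter> grad_region f Y \<in> lmeasurable" "P \<inter> grad_region f Y \<in> lmeasurable" for f :: "real^'m \<Rightarrow> real^'d" and Y
      by (rule lmeasurable_open; use S(1,2) P(1,2) open_grad_region[of f Y] in \<open>blast intro: bounded_Int open_Int\<close>)+
    note lms = lm[THEN fmeasurableD]
    have po: "?p \<le> ?o" "0 \<le> ?p"
      using measure_mono_fmeasurable[OF P(4) open_imp_sets_lebesgue[OF P(1)] lmeasurable_open[OF S(2,1)]] by auto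
    have p: "(v - e) * ?o \<le> ?p" using w1(3)[of X] by (simp add: v_def P_def)
    have low: "(measure \<mu> {Y} - \<eta>) * ?o \<le> vol (S \<inter> grad_region w2 Y)" for Y
    proof (cases "Y = X")
      case True
      have "(measure \<mu> {X} - \<eta>) * ?o = ((1 - \<tau>) * (v - e)) * ?o - e * ?o - (1 + \<tau>) * e * ?o"
        using XB XC \<tau>(3) unfolding \<mu> e(2)[symmetric] v_def[symmetric] by (simp add: algebra_simps)
      also have "\<dots> \<le> ((1 - \<tau>) * (v - e)) * ?o - e * ?o" using \<tau> e by simp
      also have "\<dots> \<le> (1 - \<tau>) * ?p - e * ?p"
      proof -
        have "(1 - \<tau>) * ((v - e) * ?o) \<le> (1 - \<tau>) * ?p" using p \<tau> by (intro mult_left_mono) auto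
        moreover have "e * ?p \<le> e * ?o" using e po by (intro mult_left_mono) auto
        ultimately show ?thesis by (simp only: mult.assoc)
      qed
      also have "\<dots> \<le> vol (P \<inter> grad_region w2 X)" using w2(5) by (simp add: left_diff_distrib)
      also have "\<dots> \<le> vol (S \<inter> grad_region w2 X)"
        by (rule measure_mono_fmeasurable[OF _ lms(2) lm(1)]) (use P(4) in blast)
      finally show ?thesis using True by simp
    next
      case False
      let ?c = "(if Y = B then \<theta> else 0) + (if Y = C then 1 - \<theta> else 0)"
      have c: "0 \<le> ?c" "?c \<le> 1" using \<theta> \<open>B \<noteq> C\<close> by auto
      have "(measure \<mu> {Y} - \<eta>) * ?o = (measure \<nu> {Y} - e) * ?o + (\<tau> * ?c) * ((v - e) * ?o) - e * ?o - (1 - \<tau> * ?c) * e * ?o"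
      proof -
        have "measure \<mu> {Y} = measure \<nu> {Y} + (\<tau> * v) * ?c" unfolding \<mu> \<tau>(3) using False by (auto simp: algebra_simps)
        then show ?thesis unfolding e(2)[symmetric] by (simp add: algebra_simps)
      qed
      also have "\<dots> \<le> (measure \<nu> {Y} - e) * ?o + (\<tau> * ?c) * ?p - e * ?p"
      proof -
        have "(\<tau> * ?c) * ((v - e) * ?o) \<le> (\<tau> * ?c) * ?p" using p \<tau> c by (intro mult_left_mono) auto
        moreover have "e * ?p \<le> e * ?o" using e po by (intro mult_left_mono) auto
        moreover have "0 \<le> (1 - \<tau> * ?c) * e * ?o" using c \<tau> e by (intro mult_nonneg_nonneg) (auto intro: mult_le_one)
        ultimately show ?thesis by linarith
      qed
      also have "\<dots> \<le> vol (S \<inter> grad_region w1 Y) + vol (P \<inter> grad_region w2 Y)"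
      proof -
        have "(\<tau> * ?c) * ?p - e * ?p \<le> vol (P \<inter> grad_region w2 Y)"
        proof (cases "Y = B \<or> Y = C")
          case True
          then show ?thesis using w2(3,4) \<open>B \<noteq> C\<close> by (auto simp: left_diff_distrib)
        next
          case False
          have "0 \<le> e * ?p" using e po by simp
          then have "(\<tau> * ?c) * ?p - e * ?p \<le> 0" using False by simp
          also have "0 \<le> vol (P \<inter> grad_region w2 Y)" by (rule measure_nonneg)
          finally show ?thesis .
        qed
        then show ?thesis using w1(3)[of Y] by linarith
      qed
      also have "\<dots> = vol ((S \<inter> grad_region w1 Y) \<union> (P \<inter> grad_region w2 Y))"
      proof -
        have "(S \<inter> grad_region w1 Y) \<inter> (P \<inter> grad_region w2 Y) = {}"
          using grad_region_unique[of _ w1 X Y] False unfolding P_def by blast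
        then show ?thesis by (simp add: measure_Un3[OF lm(1) lm(2)])
      qed
      also have "\<dots> \<le> vol (S \<inter> grad_region w2 Y)"
        by (rule measure_mono_fmeasurable[OF _ sets.Un[OF lms] lm(1)]) (use P(4) keep[OF _ False] in blast)
      finally show ?thesis .
    qed
    show "\<exists>w'. realizes \<alpha> \<eta> U \<rho>' \<mu> S w w'" unfolding realizes_def
      using mod neg low by blast
  qed
  then show ?thesis by blast
qed

lemma finite_order_laminate_realizable:
  fixes \<omega> :: "(real^'m^'d) measure"
  assumes "open U" "0 < \<alpha>" "\<alpha> < 1" "finite_order_laminate U X0 \<omega>"
  shows "\<exists>\<rho>. realizable \<alpha> U \<rho> X0 \<omega>"
  using assms(4)
proof (induction rule: finite_order_laminate.induct)
  case dirac
  have "realizable \<alpha> U 0 X0 (return borel X0)"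
    unfolding realizable_def
  proof (intro allI impI)
    fix \<eta> :: real and w :: "real^'m \<Rightarrow> real^'d" and S
    assume \<eta>: "\<eta> > 0" and w: "lipschitz_map w" and S: "open S" "bounded S" "S \<subseteq> grad_region w X0"
    have "(measure (return borel X0) {Y} - \<eta>) * vol S \<le> vol (S \<inter> grad_region w Y)" for Y
    proof (cases "Y = X0")
      case True
      then have "S \<inter> grad_region w Y = S" using S by blast
      then show ?thesis using True \<eta> by (simp add: measure_return_singleton left_diff_distrib)
    next
      case False
      have "(0 - \<eta>) * vol S \<le> 0" using \<eta> by (intro mult_nonpos_nonneg) auto
      also have "0 \<le> vol (S \<inter> grad_region w Y)" by (rule measure_nonneg)
      finally show ?thesis using False by (simp add: measure_return_singleton)
    qed
    moreover have "S - (\<Union>Y\<in>{Y. 0 < measure (return borel X0) {Y}} \<union> {Y\<in>U. norm Y \<le> 0}. grad_region w Y) = {}"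
      using S(3) by (auto simp: measure_return_singleton)
    ultimately show "\<exists>w'. realizes \<alpha> \<eta> U 0 (return borel X0) S w w'" unfolding realizes_def
      using modification_refl[OF w, of \<eta>] \<eta> by (intro exI[of _ w]) auto
  qed
  then show ?case by blast
next
  case (split \<nu> \<mu>)
  then show ?case using realizable_splitting[OF assms(1-3)] by blast
qed

section \<open>Weak gradients of Lipschitz maps and of their limits\<close>

lemma set_integrable_bounded:
  fixes f :: "'a::euclidean_space \<Rightarrow> 'b::euclidean_space"
  assumes "S \<in> lmeasurable" "(\<lambda>x. indicator S x *\<^sub>R f x) \<in> borel_measurable lebesgue"
    and B: "\<And>x. x \<in> S \<Longrightarrow> norm (f x) \<le> B"
  shows "set_integrable lebesgue S f"
  unfolding set_integrable_def
proof (rule integrableI_bounded_set[where A = S])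
  show "AE x \<in> S in lebesgue. norm (indicator S x *\<^sub>R f x) \<le> B" using B by (intro AE_I2) simp
qed (use assms in \<open>auto simp: fmeasurable_def\<close>)

lemma set_integrable_scaleR_bounded:
  fixes f :: "'a::euclidean_space \<Rightarrow> 'b::euclidean_space"
  assumes f: "set_integrable lebesgue S f" and \<psi>: "continuous_on UNIV \<psi>" "\<And>x. \<bar>\<psi> x\<bar> \<le> C"
  shows "set_integrable lebesgue S (\<lambda>x. \<psi> x *\<^sub>R f x)"
proof -
  have m: "\<psi> \<in> borel_measurable lebesgue"
    by (intro measurable_completion) (use borel_measurable_continuous_onI[OF \<psi>(1)] in simp)
  have C: "0 \<le> C" using \<psi>(2)[of undefined] by linarith
  have "integrable lebesgue (\<lambda>x. \<psi> x *\<^sub>R (indicator S x *\<^sub>R f x))"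
  proof (rule Bochner_Integration.integrable_bound)
    show "integrable lebesgue (\<lambda>x. C *\<^sub>R norm (indicator S x *\<^sub>R f x))"
      using f unfolding set_integrable_def by (intro integrable_scaleR_right integrable_norm)
    show "(\<lambda>x. \<psi> x *\<^sub>R (indicator S x *\<^sub>R f x)) \<in> borel_measurable lebesgue"
      by (rule borel_measurable_scaleR[OF m borel_measurable_integrable[OF f[unfolded set_integrable_def]]])
    show "AE x in lebesgue. norm (\<psi> x *\<^sub>R (indicator S x *\<^sub>R f x)) \<le> norm (C *\<^sub>R norm (indicator S x *\<^sub>R f x))"
    proof (rule AE_I2)
      fix x show "norm (\<psi> x *\<^sub>R (indicator S x *\<^sub>R f x)) \<le> norm (C *\<^sub>R norm (indicator S x *\<^sub>R f x))"
        using \<psi>(2)[of x] C by (cases "x \<in> S") (auto simp: abs_mult mult_right_mono)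
    qed
  qed
  then show ?thesis unfolding set_integrable_def by (simp add: mult.commute)
qed

lemma norm_column_le: "norm (column j A) \<le> norm (A :: real^'m^'d)"
  unfolding norm_vec_def[of "column j A"] norm_vec_def[of A]
  by (intro L2_set_mono) (simp_all add: column_def component_le_norm_cart[of _ j, simplified])

lemma continuous_column: "continuous_on UNIV (column j :: real^'m^'d \<Rightarrow> real^'d)"
  unfolding column_def by (intro continuous_intros)

lemma set_integrable_column:
  fixes G :: "real^'m \<Rightarrow> real^'m^'d"
  assumes "set_integrable lebesgue S G"
  shows "set_integrable lebesgue S (\<lambda>x. column j (G x))"
proof -
  have e: "indicator S x *\<^sub>R column j (G x) = column j (indicator S x *\<^sub>R G x)" for x
    by (simp add: column_def vec_eq_iff)
  show ?thesis unfolding set_integrable_def e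
  proof (rule Bochner_Integration.integrable_bound[OF assms[unfolded set_integrable_def]])
    show "(\<lambda>x. column j (indicator S x *\<^sub>R G x)) \<in> borel_measurable lebesgue"
      by (rule measurable_compose[OF borel_measurable_integrable[OF assms[unfolded set_integrable_def]]])
        (rule borel_measurable_continuous_onI[OF continuous_column])
  qed (intro AE_I2 norm_column_le)
qed

text \<open>
  One constant \<open>C\<close> bounds both the function and the partial derivative, since these are continuous with
  compact support.
\<close>

lemma test_functionD:
  fixes \<phi> :: "real^'m \<Rightarrow> real"
  assumes "test_function \<Omega> \<phi>"
  obtains C where "0 \<le> C" "\<And>x. \<bar>\<phi> x\<bar> \<le> C" "\<And>x. \<bar>partial_deriv j \<phi> x\<bar> \<le> C"
    "continuous_on UNIV \<phi>" "continuous_on UNIV (partial_deriv j \<phi>)"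
    "compact (closure {x. \<phi> x \<noteq> 0})" "closure {x. \<phi> x \<noteq> 0} \<subseteq> \<Omega>"
    "\<And>x. x \<notin> closure {x. \<phi> x \<noteq> 0} \<Longrightarrow> partial_deriv j \<phi> x = 0"
    "\<And>x s. ((\<lambda>s. \<phi> (x + s *\<^sub>R axis j 1)) has_real_derivative partial_deriv j \<phi> (x + s *\<^sub>R axis j 1)) (at s)"
proof -
  let ?S = "closure {x. \<phi> x \<noteq> 0}"
  have S: "compact ?S" "?S \<subseteq> \<Omega>" using assms by (auto simp: test_function_def)
  have "C_k (Suc 0) \<phi>" "C_k 0 \<phi>" using assms unfolding test_function_def by blast+
  then have diff: "\<And>x. \<phi> differentiable (at x)" and c: "continuous_on UNIV \<phi>" "continuous_on UNIV (partial_deriv j \<phi>)"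
    by auto
  have der: "(\<phi> has_derivative frechet_derivative \<phi> (at x)) (at x)" for x
    using diff frechet_derivative_works by blast
  have z: "partial_deriv j \<phi> x = 0" if "x \<notin> ?S" for x
  proof -
    have "((\<lambda>x. 0) has_derivative (\<lambda>x. 0)) (at x)" by simp
    then have "(\<phi> has_derivative (\<lambda>x. 0)) (at x)"
      by (rule has_derivative_transform_within_open[of _ _ _ _ "- ?S"]) (use that closure_subset[of "{x. \<phi> x \<noteq> 0}"] in auto)
    then have "frechet_derivative \<phi> (at x) = (\<lambda>x. 0)" by (rule frechet_derivative_at[symmetric])
    then show ?thesis by (simp add: partial_deriv_def)
  qed
  obtain C1 where C1: "\<And>x. x \<in> ?S \<Longrightarrow> \<bar>\<phi> x\<bar> \<le> C1"
    using compact_imp_bounded[OF compact_continuous_image[OF continuous_on_subset[OF c(1)] S(1)]] unfolding bounded_iff by auto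
  obtain C2 where C2: "\<And>x. x \<in> ?S \<Longrightarrow> \<bar>partial_deriv j \<phi> x\<bar> \<le> C2"
    using compact_imp_bounded[OF compact_continuous_image[OF continuous_on_subset[OF c(2)] S(1)]] unfolding bounded_iff by auto
  define C where "C = max 0 (max C1 C2)"
  show ?thesis
  proof (rule that[of C])
    show "\<bar>\<phi> x\<bar> \<le> C" for x
    proof (cases "x \<in> ?S")
      case False
      then have "\<phi> x = 0" using closure_subset[of "{x. \<phi> x \<noteq> 0}"] by blast
      then show ?thesis by (simp add: C_def)
    qed (use C1[of x] in \<open>auto simp: C_def\<close>)
    show "\<bar>partial_deriv j \<phi> x\<bar> \<le> C" for x
      using C2[of x] z[of x] by (cases "x \<in> ?S") (auto simp: C_def)
    show "((\<lambda>s. \<phi> (x + s *\<^sub>R axis j 1)) has_real_derivative partial_deriv j \<phi> (x + s *\<^sub>R axis j 1)) (at s)" for x s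
    proof -
      have "((\<lambda>s. \<phi> (x + s *\<^sub>R axis j 1)) has_derivative (\<lambda>h. frechet_derivative \<phi> (at (x + s *\<^sub>R axis j 1)) (h *\<^sub>R axis j 1))) (at s)"
        by (rule has_derivative_compose[OF _ der]) (auto intro!: derivative_eq_intros)
      moreover have "frechet_derivative \<phi> (at y) (h *\<^sub>R axis j 1) = partial_deriv j \<phi> y * h" for y h
        using linear_scale[OF has_derivative_linear[OF der]] by (simp add: partial_deriv_def)
      ultimately show ?thesis unfolding has_field_derivative_def by (simp add: fun_eq_iff)
    qed
  qed (use S c z in \<open>auto simp: C_def\<close>)
qed

lemma grad_region_norm_le:
  fixes w :: "real^'m \<Rightarrow> real^'d" and L :: real
  assumes "\<And>x y. norm (w x - w y) \<le> L * norm (x - y)" "x \<in> grad_region w Y"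
  shows "norm Y \<le> CARD('d) * CARD('m) * L"
proof -
  have "\<bar>Y $ i $ j\<bar> \<le> L" for i j
  proof -
    have "norm (Y *v axis j 1) \<le> L * norm (axis j (1::real))"
      by (rule norm_gradient_le[OF assms(1) linear_matrix_vector assms(2)])
    then have "norm (column j Y) \<le> L" by (simp add: matrix_vector_mult_basis)
    then show ?thesis using component_le_norm_cart[of "column j Y" i] by (simp add: column_def)
  qed
  then have "norm (Y $ i) \<le> CARD('m) * L" for i
    using order_trans[OF norm_le_l1_cart sum_bounded_above[of UNIV "\<lambda>j. \<bar>Y $ i $ j\<bar>" L]] by simp
  then have "(\<Sum>i\<in>UNIV. norm (Y $ i)) \<le> CARD('d) * (CARD('m) * L)"
    using sum_bounded_above[of UNIV "\<lambda>i. norm (Y $ i)" "CARD('m) * L"] by simp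
  moreover have "norm Y \<le> (\<Sum>i\<in>UNIV. norm (Y $ i))"
    unfolding norm_vec_def[of Y] by (rule L2_set_le_sum) simp
  ultimately show ?thesis by simp
qed

text \<open>
  For a test function \<open>\<phi>\<close> the map \<open>\<phi> w\<close> has compact support, and its derivative in direction \<open>e\<^sub>j\<close> is
  \<open>(\<partial>\<^sub>j \<phi>) w + \<phi> G\<^sub>j\<close> almost everywhere; the integral of this derivative vanishes.
\<close>

lemma W11_gradient_lipschitz:
  fixes w :: "real^'m \<Rightarrow> real^'d"
  assumes \<Omega>: "open \<Omega>" "bounded \<Omega>" and w: "lipschitz_map w"
    and neg: "negligible (\<Omega> - (\<Union>Y. grad_region w Y))"
    and G: "\<And>x Y. x \<in> \<Omega> \<Longrightarrow> x \<in> grad_region w Y \<Longrightarrow> G x = Y"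
    and G0: "\<And>x. x \<in> \<Omega> \<Longrightarrow> x \<notin> (\<Union>Y. grad_region w Y) \<Longrightarrow> G x = 0"
  shows "W11_gradient \<Omega> w G"
proof -
  obtain L where L: "\<And>x y. norm (w x - w y) \<le> L * norm (x - y)" using w unfolding lipschitz_map_def by blast
  have wc: "continuous_on UNIV w" by (rule lipschitz_continuous[OF L])
  have Om: "\<Omega> \<in> lmeasurable" using \<Omega> by (intro lmeasurable_open)
  have L0: "0 \<le> L" using order_trans[OF norm_ge_zero L[of "axis undefined 1" 0]] by (simp add: norm_axis_1)
  define B where "B = CARD('d) * CARD('m) * L"
  have Gb: "norm (G x) \<le> B" if "x \<in> \<Omega>" for x
    using grad_region_norm_le[OF L] G[OF that] G0[OF that] L0 by (cases "x \<in> (\<Union>Y. grad_region w Y)") (auto simp: B_def)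
  have Gm: "(\<lambda>x. indicator \<Omega> x *\<^sub>R G x) \<in> borel_measurable lebesgue"
  proof (rule lebesgue_measurable_piecewise(1))
    show "\<Omega> \<in> sets lebesgue" using \<Omega> by (simp add: open_imp_sets_lebesgue)
    show "open (\<Omega> \<inter> grad_region w Y)" for Y by (intro open_Int \<Omega> open_grad_region)
    show "negligible (\<Omega> - (\<Union>Y\<in>UNIV. \<Omega> \<inter> grad_region w Y))" using neg by (rule negligible_subset) blast
  qed (use G in auto)
  have Gi: "set_integrable lebesgue \<Omega> G" by (rule set_integrable_bounded[OF Om Gm Gb])
  have wm: "(\<lambda>x. indicator \<Omega> x *\<^sub>R w x) \<in> borel_measurable lebesgue"
    using borel_measurable_continuous_onI[OF wc] \<Omega> open_imp_sets_lebesgue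
    by (intro borel_measurable_scaleR borel_measurable_indicator measurable_completion) auto
  have "compact (closure \<Omega>)" using \<Omega> by simp
  then have "bounded (w ` closure \<Omega>)"
    by (intro compact_imp_bounded compact_continuous_image continuous_on_subset[OF wc]) auto
  then obtain W where "0 < W" "\<And>x. x \<in> closure \<Omega> \<Longrightarrow> norm (w x) \<le> W" unfolding bounded_pos by auto
  then have W0: "0 \<le> W" and W: "\<And>x. x \<in> \<Omega> \<Longrightarrow> norm (w x) \<le> W" using closure_subset by auto
  have wi: "set_integrable lebesgue \<Omega> w" by (rule set_integrable_bounded[OF Om wm W])
  have "(LINT x:\<Omega>|lebesgue. partial_deriv j \<phi> x *\<^sub>R w x) = - (LINT x:\<Omega>|lebesgue. \<phi> x *\<^sub>R column j (G x))"
    if \<phi>: "test_function \<Omega> \<phi>" for \<phi> j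
  proof -
    let ?S = "closure {x. \<phi> x \<noteq> 0}"
    let ?e = "axis j 1 :: real^'m"
    obtain C where C: "0 \<le> C" "\<And>x. \<bar>\<phi> x\<bar> \<le> C" "\<And>x. \<bar>partial_deriv j \<phi> x\<bar> \<le> C"
      "continuous_on UNIV \<phi>" "continuous_on UNIV (partial_deriv j \<phi>)" "compact ?S" "?S \<subseteq> \<Omega>"
      "\<And>x. x \<notin> ?S \<Longrightarrow> partial_deriv j \<phi> x = 0"
      "\<And>x s. ((\<lambda>s. \<phi> (x + s *\<^sub>R ?e)) has_real_derivative partial_deriv j \<phi> (x + s *\<^sub>R ?e)) (at s)"
      using test_functionD[OF \<phi>, of j] by blast
    have \<phi>0: "\<phi> x = 0" if "x \<notin> ?S" for x using that closure_subset[of "{x. \<phi> x \<noteq> 0}"] by blast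
    define f where "f x = \<phi> x *\<^sub>R w x" for x
    have f0: "f y = 0" if "y \<notin> ?S" for y unfolding f_def \<phi>0[OF that] by simp
    define g where "g x = indicator \<Omega> x *\<^sub>R (partial_deriv j \<phi> x *\<^sub>R w x) + indicator \<Omega> x *\<^sub>R (\<phi> x *\<^sub>R column j (G x))" for x
    have i1: "set_integrable lebesgue \<Omega> (\<lambda>x. partial_deriv j \<phi> x *\<^sub>R w x)"
      by (rule set_integrable_scaleR_bounded[OF wi C(5,3)])
    have i2: "set_integrable lebesgue \<Omega> (\<lambda>x. \<phi> x *\<^sub>R column j (G x))"
      by (rule set_integrable_scaleR_bounded[OF set_integrable_column[OF Gi] C(4,2)])
    have gm: "g \<in> borel_measurable lebesgue"
      unfolding g_def[abs_def] using i1 i2 unfolding set_integrable_def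
      by (intro borel_measurable_add borel_measurable_integrable)
    have \<phi>lip: "\<bar>\<phi> (x + t *\<^sub>R ?e) - \<phi> x\<bar> \<le> C * \<bar>t\<bar>" for x t
      using field_differentiable_bound[of UNIV "\<lambda>s. \<phi> (x + s *\<^sub>R ?e)" "\<lambda>s. partial_deriv j \<phi> (x + s *\<^sub>R ?e)" C t 0] C(3,9)
      by simp
    (* Differences are expanded at a point in the support of phi, where w is bounded by W. *)
    have flip: "norm (f (x + t *\<^sub>R ?e) - f x) \<le> (C * L + C * W) * \<bar>t\<bar>" for x t
    proof -
      let ?y = "x + t *\<^sub>R ?e"
      have wl: "norm (w ?y - w x) \<le> L * \<bar>t\<bar>" using L[of ?y x] by (simp add: norm_axis_1)
      have CL: "0 \<le> C * L * \<bar>t\<bar>" using C(1) L0 by simp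
      show ?thesis
      proof (cases "x \<in> ?S")
        case True
        have "f ?y - f x = \<phi> ?y *\<^sub>R (w ?y - w x) + (\<phi> ?y - \<phi> x) *\<^sub>R w x" by (simp add: f_def algebra_simps)
        also have "norm \<dots> \<le> C * (L * \<bar>t\<bar>) + (C * \<bar>t\<bar>) * W"
          using True C(1,2,7) wl \<phi>lip W by (intro norm_triangle_mono) (auto intro!: mult_mono)
        finally show ?thesis by (simp add: algebra_simps)
      next
        case False
        show ?thesis
        proof (cases "?y \<in> ?S")
          case True
          have "f ?y - f x = (\<phi> ?y - \<phi> x) *\<^sub>R w ?y" using \<phi>0[OF False] by (simp add: f_def)
          also have "norm \<dots> \<le> (C * \<bar>t\<bar>) * W"
            using True C(1,7) \<phi>lip W by (auto intro!: mult_mono)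
          finally show ?thesis using CL by (simp add: algebra_simps)
        next
          case F2: False
          show ?thesis using \<phi>0[OF False] \<phi>0[OF F2] C(1) L0 W0 by (simp add: f_def)
        qed
      qed
    qed
    have fc: "continuous_on UNIV f" unfolding f_def[abs_def] by (intro continuous_intros C wc)
    have lim: "AE x in lebesgue. ((\<lambda>t. (1 / t) *\<^sub>R (f (x + t *\<^sub>R ?e) - f x)) \<longlongrightarrow> g x) (at 0)"
    proof (rule AE_I')
      show "\<Omega> - (\<Union>Y. grad_region w Y) \<in> null_sets lebesgue" using neg by (simp add: negligible_iff_null_sets)
      have "((\<lambda>t. (1 / t) *\<^sub>R (f (x + t *\<^sub>R ?e) - f x)) \<longlongrightarrow> g x) (at 0)"
        if good: "x \<notin> \<Omega> - (\<Union>Y. grad_region w Y)" for x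
      proof (cases "x \<in> \<Omega>")
        case True
        then obtain Y where Y: "x \<in> grad_region w Y" using good by blast
        have 1: "((\<lambda>t. (1 / t) *\<^sub>R (w (x + t *\<^sub>R ?e) - w x)) \<longlongrightarrow> Y *v ?e) (at 0)"
          by (rule difference_quotient_affine_near[OF linear_matrix_vector Y])
        have 2: "((\<lambda>t. (\<phi> (x + t *\<^sub>R ?e) - \<phi> x) / t) \<longlongrightarrow> partial_deriv j \<phi> x) (at 0)"
          using C(9)[of x 0] by (simp add: DERIV_def)
        have "isCont (\<lambda>t. \<phi> (x + t *\<^sub>R ?e)) 0" using C(9)[of x 0] by (rule DERIV_isCont)
        then have 3: "((\<lambda>t. \<phi> (x + t *\<^sub>R ?e)) \<longlongrightarrow> \<phi> x) (at 0)" by (simp add: isCont_def)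
        have "((\<lambda>t. \<phi> (x + t *\<^sub>R ?e) *\<^sub>R ((1 / t) *\<^sub>R (w (x + t *\<^sub>R ?e) - w x)) + ((\<phi> (x + t *\<^sub>R ?e) - \<phi> x) / t) *\<^sub>R w x)
            \<longlongrightarrow> \<phi> x *\<^sub>R (Y *v ?e) + partial_deriv j \<phi> x *\<^sub>R w x) (at 0)"
          by (intro tendsto_intros 1 2 3)
        also have "(\<lambda>t. \<phi> (x + t *\<^sub>R ?e) *\<^sub>R ((1 / t) *\<^sub>R (w (x + t *\<^sub>R ?e) - w x)) + ((\<phi> (x + t *\<^sub>R ?e) - \<phi> x) / t) *\<^sub>R w x)
            = (\<lambda>t. (1 / t) *\<^sub>R (f (x + t *\<^sub>R ?e) - f x))"
          by (auto simp: f_def fun_eq_iff algebra_simps diff_divide_distrib)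
        also have "\<phi> x *\<^sub>R (Y *v ?e) + partial_deriv j \<phi> x *\<^sub>R w x = g x"
          using True G[OF True Y] by (simp add: g_def matrix_vector_mult_basis)
        finally show ?thesis .
      next
        case False
        then have x: "x \<notin> ?S" using C(7) by blast
        have "x \<in> affine_near (\<lambda>x. 0) (\<lambda>y. 0)" using affine_near_const by blast
        then have "x \<in> affine_near f (\<lambda>y. 0)"
        proof (rule affine_near_cong[of "- ?S", rotated -1])
          show "x \<in> - ?S" using x by blast
          show "0 = f y" if "y \<in> - ?S" for y using f0 that by force
        qed (simp add: open_Compl)
        then have "((\<lambda>t. (1 / t) *\<^sub>R (f (x + t *\<^sub>R ?e) - f x)) \<longlongrightarrow> 0) (at 0)"
          by (rule difference_quotient_affine_near[rotated]) (simp add: linear_zero)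
        then show ?thesis using False by (simp add: g_def)
      qed
      then show "{x \<in> space lebesgue. \<not> ((\<lambda>t. (1 / t) *\<^sub>R (f (x + t *\<^sub>R ?e) - f x)) \<longlongrightarrow> g x) (at 0)}
          \<subseteq> \<Omega> - (\<Union>Y. grad_region w Y)" by blast
    qed
    have "integral\<^sup>L lebesgue g = 0"
      by (rule integral_directional_derivative_zero(2)[OF fc compact_imp_bounded[OF C(6)] _ flip gm lim])
        (rule f0)
    moreover have "integral\<^sup>L lebesgue g = (LINT x:\<Omega>|lebesgue. partial_deriv j \<phi> x *\<^sub>R w x) + (LINT x:\<Omega>|lebesgue. \<phi> x *\<^sub>R column j (G x))"
      unfolding g_def[abs_def] set_lebesgue_integral_def
      by (rule Bochner_Integration.integral_add) (use i1 i2 in \<open>auto simp: set_integrable_def\<close>)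
    ultimately show ?thesis by (simp add: eq_neg_iff_add_eq_0)
  qed
  then show ?thesis unfolding W11_gradient_def using wi Gi by blast
qed

lemma L1_limit_scaleR:
  fixes f :: "nat \<Rightarrow> 'a::euclidean_space \<Rightarrow> 'b::euclidean_space"
  assumes f: "\<And>n. set_integrable lebesgue S (f n)" and h: "set_integrable lebesgue S h"
    and \<psi>: "continuous_on UNIV \<psi>" "\<And>x. \<bar>\<psi> x\<bar> \<le> C"
    and lim: "(\<lambda>n. LINT x:S|lebesgue. norm (f n x - h x)) \<longlonglongrightarrow> 0"
  shows "(\<lambda>n. LINT x:S|lebesgue. \<psi> x *\<^sub>R f n x) \<longlonglongrightarrow> (LINT x:S|lebesgue. \<psi> x *\<^sub>R h x)"
proof (rule LIM_zero_cancel, rule Lim_null_comparison)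
  have i: "set_integrable lebesgue S (\<lambda>x. f n x - h x)" for n using f h by (intro set_integral_diff)
  show "\<forall>\<^sub>F n in sequentially. norm ((LINT x:S|lebesgue. \<psi> x *\<^sub>R f n x) - (LINT x:S|lebesgue. \<psi> x *\<^sub>R h x))
      \<le> C * (LINT x:S|lebesgue. norm (f n x - h x))"
  proof (rule always_eventually, rule allI)
    fix n
    have "(LINT x:S|lebesgue. \<psi> x *\<^sub>R f n x) - (LINT x:S|lebesgue. \<psi> x *\<^sub>R h x) = (LINT x:S|lebesgue. \<psi> x *\<^sub>R f n x - \<psi> x *\<^sub>R h x)"
      by (intro set_integral_diff(2)[symmetric] set_integrable_scaleR_bounded[OF f \<psi>] set_integrable_scaleR_bounded[OF h \<psi>])
    also have "norm \<dots> \<le> (LINT x:S|lebesgue. norm (\<psi> x *\<^sub>R f n x - \<psi> x *\<^sub>R h x))"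
      by (intro set_integral_norm_bound set_integral_diff(1) set_integrable_scaleR_bounded[OF f \<psi>] set_integrable_scaleR_bounded[OF h \<psi>])
    also have "\<dots> \<le> (LINT x:S|lebesgue. C * norm (f n x - h x))"
    proof (rule set_integral_mono)
      show "set_integrable lebesgue S (\<lambda>x. norm (\<psi> x *\<^sub>R f n x - \<psi> x *\<^sub>R h x))"
        by (intro set_integrable_norm set_integral_diff(1) set_integrable_scaleR_bounded[OF f \<psi>] set_integrable_scaleR_bounded[OF h \<psi>])
      show "set_integrable lebesgue S (\<lambda>x. C * norm (f n x - h x))"
        by (intro set_integrable_mult_right set_integrable_norm i)
      show "norm (\<psi> x *\<^sub>R f n x - \<psi> x *\<^sub>R h x) \<le> C * norm (f n x - h x)" for x
        using \<psi>(2)[of x] by (simp add: scaleR_diff_right[symmetric] mult_right_mono)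
    qed
    also have "\<dots> = C * (LINT x:S|lebesgue. norm (f n x - h x))" by (rule set_integral_mult_right)
    finally show "norm ((LINT x:S|lebesgue. \<psi> x *\<^sub>R f n x) - (LINT x:S|lebesgue. \<psi> x *\<^sub>R h x))
      \<le> C * (LINT x:S|lebesgue. norm (f n x - h x))" .
  qed
  show "(\<lambda>n. C * (LINT x:S|lebesgue. norm (f n x - h x))) \<longlonglongrightarrow> 0"
    using tendsto_mult_right_zero[OF lim] by simp
qed

text \<open>
  Convergence of the maps and of their weak gradients in \<open>L\<^sup>1\<close> suffices.
\<close>

lemma W11_gradient_limit:
  fixes w :: "nat \<Rightarrow> real^'m \<Rightarrow> real^'d"
  assumes W: "\<And>n. W11_gradient \<Omega> (w n) (G n)" and i: "set_integrable lebesgue \<Omega> v" "set_integrable lebesgue \<Omega> H"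
    and lim: "(\<lambda>n. LINT x:\<Omega>|lebesgue. norm (w n x - v x)) \<longlonglongrightarrow> 0" "(\<lambda>n. LINT x:\<Omega>|lebesgue. norm (G n x - H x)) \<longlonglongrightarrow> 0"
  shows "W11_gradient \<Omega> v H"
  unfolding W11_gradient_def
proof (intro conjI allI impI i)
  fix \<phi> :: "real^'m \<Rightarrow> real" and j
  assume \<phi>: "test_function \<Omega> \<phi>"
  obtain C where C: "\<And>x. \<bar>\<phi> x\<bar> \<le> C" "\<And>x. \<bar>partial_deriv j \<phi> x\<bar> \<le> C"
      "continuous_on UNIV \<phi>" "continuous_on UNIV (partial_deriv j \<phi>)"
    using test_functionD[OF \<phi>, of j] by metis
  have wi: "set_integrable lebesgue \<Omega> (w n)" "set_integrable lebesgue \<Omega> (G n)" for n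
    using W[of n] by (auto simp: W11_gradient_def)
  have 1: "(\<lambda>n. LINT x:\<Omega>|lebesgue. partial_deriv j \<phi> x *\<^sub>R w n x) \<longlonglongrightarrow> (LINT x:\<Omega>|lebesgue. partial_deriv j \<phi> x *\<^sub>R v x)"
    by (rule L1_limit_scaleR[OF wi(1) i(1) C(4,2) lim(1)])
  have cl: "(\<lambda>n. LINT x:\<Omega>|lebesgue. norm (column j (G n x) - column j (H x))) \<longlonglongrightarrow> 0"
  proof (rule Lim_null_comparison[OF always_eventually lim(2)], rule allI)
    fix n
    have nn: "0 \<le> (LINT x:\<Omega>|lebesgue. norm (column j (G n x) - column j (H x)))"
      unfolding set_lebesgue_integral_def by (intro Bochner_Integration.integral_nonneg) auto
    have "(LINT x:\<Omega>|lebesgue. norm (column j (G n x) - column j (H x))) \<le> (LINT x:\<Omega>|lebesgue. norm (G n x - H x))"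
    proof (rule set_integral_mono)
      show "set_integrable lebesgue \<Omega> (\<lambda>x. norm (column j (G n x) - column j (H x)))"
        by (intro set_integrable_norm set_integral_diff(1) set_integrable_column wi i)
      show "set_integrable lebesgue \<Omega> (\<lambda>x. norm (G n x - H x))"
        by (intro set_integrable_norm set_integral_diff(1) wi i)
      have "column j (A - B) = column j A - column j B" for A B :: "real^'m^'d" by (simp add: column_def vec_eq_iff)
      then show "norm (column j (G n x) - column j (H x)) \<le> norm (G n x - H x)" for x
        using norm_column_le[of j "G n x - H x"] by simp
    qed
    then show "norm (LINT x:\<Omega>|lebesgue. norm (column j (G n x) - column j (H x))) \<le> (LINT x:\<Omega>|lebesgue. norm (G n x - H x))"
      using nn by simp
  qed
  have 2: "(\<lambda>n. LINT x:\<Omega>|lebesgue. \<phi> x *\<^sub>R column j (G n x)) \<longlonglongrightarrow> (LINT x:\<Omega>|lebesgue. \<phi> x *\<^sub>R column j (H x))"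
    by (rule L1_limit_scaleR[OF set_integrable_column[OF wi(2)] set_integrable_column[OF i(2)] C(3,1) cl])
  have "(LINT x:\<Omega>|lebesgue. partial_deriv j \<phi> x *\<^sub>R w n x) = - (LINT x:\<Omega>|lebesgue. \<phi> x *\<^sub>R column j (G n x))" for n
    using W[of n] \<phi> by (simp add: W11_gradient_def)
  then have "(\<lambda>n. LINT x:\<Omega>|lebesgue. partial_deriv j \<phi> x *\<^sub>R w n x) \<longlonglongrightarrow> - (LINT x:\<Omega>|lebesgue. \<phi> x *\<^sub>R column j (H x))"
    using tendsto_minus[OF 2] by simp
  from LIMSEQ_unique[OF 1 this]
  show "(LINT x:\<Omega>|lebesgue. partial_deriv j \<phi> x *\<^sub>R v x) = - (LINT x:\<Omega>|lebesgue. \<phi> x *\<^sub>R column j (H x))" .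
qed

text \<open>
  The pieces can be taken to be open boxes inside balls on which the map is affine.
\<close>

lemma piecewise_affine_of_grad_regions:
  fixes w :: "real^'m \<Rightarrow> real^'d"
  assumes \<Omega>: "regular_domain \<Omega>" and w: "w \<in> W11 \<Omega>" and neg: "negligible (\<Omega> - (\<Union>Y. grad_region w Y))"
  shows "piecewise_affine \<Omega> w"
proof -
  have o: "open \<Omega>" and b: "bounded \<Omega>" using \<Omega> by (auto simp: regular_domain_def)
  define S where "S = \<Omega> \<inter> (\<Union>Y. grad_region w Y)"
  have "\<exists>e Y. e > 0 \<and> ball x e \<subseteq> \<Omega> \<and> (\<forall>y\<in>ball x e. w y - w x = Y *v (y - x))" if x: "x \<in> S" for x
  proof -
    obtain Y where Y: "x \<in> grad_region w Y" using x by (auto simp: S_def)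
    obtain e1 where e1: "e1 > 0" "\<forall>y\<in>ball x e1. w y - w x = Y *v (y - x)"
      using Y unfolding affine_near_def by blast
    obtain e2 where e2: "e2 > 0" "ball x e2 \<subseteq> \<Omega>" using openE[OF o, of x] x by (auto simp: S_def)
    show ?thesis by (rule exI[of _ "min e1 e2"], rule exI[of _ Y]) (use e1 e2 in auto)
  qed
  then obtain e Y where eY: "\<And>x. x \<in> S \<Longrightarrow> e x > 0 \<and> ball x (e x) \<subseteq> \<Omega> \<and> (\<forall>y\<in>ball x (e x). w y - w x = Y x *v (y - x))"
    by metis
  have bS: "bounded S" using b by (auto simp: S_def intro: bounded_Int)
  have g: "open (ball x (e x)) \<and> x \<in> ball x (e x)" if "x \<in> S" for x using eY[OF that] by simp
  obtain \<Q> where \<Q>: "countable \<Q>" "disjoint \<Q>" "\<forall>Q\<in>\<Q>. \<exists>c d. Q = box c d \<and> box c d \<noteq> {}"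
      "\<forall>Q\<in>\<Q>. \<exists>x\<in>S. Q \<subseteq> ball x (e x)" "negligible (S - \<Union>\<Q>)"
    by (rule box_decomposition[OF bS g])
  have sub: "Q \<subseteq> \<Omega>" if "Q \<in> \<Q>" for Q using \<Q>(4) that eY by blast
  have reg: "regular_domain Q" if QQ: "Q \<in> \<Q>" for Q
  proof -
    obtain c d where Q: "Q = box c d" "box c d \<noteq> {}" using bspec[OF \<Q>(3) QQ] by (elim exE conjE)
    have "negligible (frontier (box c d))" by (rule negligible_convex_frontier) simp
    then show ?thesis using Q by (simp add: regular_domain_def negligible_iff_null_sets convex_connected open_box)
  qed
  have aff: "\<exists>X b. \<forall>x\<in>Q. w x = X *v x + b" if QQ: "Q \<in> \<Q>" for Q
  proof -
    obtain x where x: "x \<in> S" "Q \<subseteq> ball x (e x)" using \<Q>(4) QQ by blast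
    have "w y = Y x *v y + (w x - Y x *v x)" if "y \<in> Q" for y
    proof -
      have "w y - w x = Y x *v (y - x)" using eY[OF x(1)] x(2) that by blast
      then show ?thesis by (simp add: matrix_vector_mult_diff_distrib algebra_simps)
    qed
    then show ?thesis by blast
  qed
  have "negligible ((\<Omega> - (\<Union>Y. grad_region w Y)) \<union> (S - \<Union>\<Q>))" by (intro negligible_Un neg \<Q>)
  then have "negligible (\<Omega> - \<Union>\<Q>)" by (rule negligible_subset) (auto simp: S_def)
  then have null: "\<Omega> - \<Union>\<Q> \<in> null_sets lebesgue" by (simp add: negligible_iff_null_sets)
  have dec: "\<Omega> = \<Union>\<Q> \<union> (\<Omega> - \<Union>\<Q>)" using sub by blast
  show ?thesis
    unfolding piecewise_affine_def
    by (intro conjI exI[of _ \<Q>] exI[of _ "\<Omega> - \<Union>\<Q>"] ballI \<Omega> w \<Q>(1,2) null dec reg sub aff)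
qed

section \<open>Staircase laminates as discrete data\<close>

text \<open>
  The volume that is not claimed by the other pieces bounds each piece from above.
\<close>

lemma upper_of_lower_fractions:
  fixes A :: "'i \<Rightarrow> 'a::euclidean_space set" and c :: "'i \<Rightarrow> real" and e :: real
  assumes fin: "finite S" and R: "R \<in> lmeasurable" and A: "\<And>i. i \<in> S \<Longrightarrow> A i \<in> sets lebesgue"
    and dis: "\<And>i j. i \<in> S \<Longrightarrow> j \<in> S \<Longrightarrow> i \<noteq> j \<Longrightarrow> A i \<inter> A j = {}"
    and c: "sum c S = 1" and e: "0 \<le> e" and low: "\<And>i. i \<in> S \<Longrightarrow> (c i - e) * vol R \<le> vol (R \<inter> A i)"
  shows "vol (R - (\<Union>i\<in>S. A i)) \<le> card S * e * vol R"
    and "i \<in> S \<Longrightarrow> vol (R \<inter> A i) \<le> (c i + card S * e) * vol R"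
proof -
  have m: "R \<inter> A i \<in> lmeasurable" if "i \<in> S" for i using R A[OF that] by (rule fmeasurable_Int_fmeasurable)
  have dj: "disjoint_family_on (\<lambda>i. R \<inter> A i) T" if "T \<subseteq> S" for T
    unfolding disjoint_family_on_def using dis that by blast
  have sumT: "vol (\<Union>i\<in>T. R \<inter> A i) = (\<Sum>i\<in>T. vol (R \<inter> A i))" if T: "T \<subseteq> S" for T
  proof (rule measure_finite_Union[OF finite_subset[OF T fin] _ dj[OF T]])
    show "(\<lambda>i. R \<inter> A i) ` T \<subseteq> sets lebesgue" using m T by auto
    show "emeasure lebesgue (R \<inter> A i) \<noteq> \<infinity>" if "i \<in> T" for i
      using m[OF subsetD[OF T that]] by (auto simp: fmeasurable_def)
  qed
  have US: "(\<Union>i\<in>T. R \<inter> A i) \<in> sets lebesgue" if T: "T \<subseteq> S" for T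
    by (rule sets.finite_UN[OF finite_subset[OF T fin]]) (use m T in auto)
  have UR: "vol (\<Union>i\<in>T. R \<inter> A i) \<le> vol R" if "T \<subseteq> S" for T
    by (rule measure_mono_fmeasurable[OF _ US[OF that] R]) blast
  have "(1 - card S * e) * vol R = (\<Sum>i\<in>S. (c i - e) * vol R)"
    by (simp add: sum_distrib_right[symmetric] sum_subtractf c)
  also have "\<dots> \<le> vol (\<Union>i\<in>S. R \<inter> A i)" unfolding sumT[OF order_refl] by (intro sum_mono low)
  finally have 1: "(1 - card S * e) * vol R \<le> vol (\<Union>i\<in>S. R \<inter> A i)" .
  have "vol (R - (\<Union>i\<in>S. R \<inter> A i)) = vol R - vol (\<Union>i\<in>S. R \<inter> A i)"
    by (rule measurable_measure_Diff[OF R US[OF order_refl]]) blast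
  moreover have "R - (\<Union>i\<in>S. A i) = R - (\<Union>i\<in>S. R \<inter> A i)" by blast
  ultimately show "vol (R - (\<Union>i\<in>S. A i)) \<le> card S * e * vol R"
    using 1 by (simp add: left_diff_distrib)
  assume i: "i \<in> S"
  have "(1 - c i - (real (card S) - 1) * e) * vol R = (\<Sum>j\<in>S - {i}. (c j - e) * vol R)"
    using i fin c card_gt_0_iff[of S] by (auto simp: sum_distrib_right[symmetric] sum_subtractf sum_diff1 of_nat_diff)
  also have "\<dots> \<le> (\<Sum>j\<in>S - {i}. vol (R \<inter> A j))" by (intro sum_mono low) auto
  also have "\<dots> = (\<Sum>j\<in>S. vol (R \<inter> A j)) - vol (R \<inter> A i)"
    using fin i by (simp add: sum_diff1)
  also have "\<dots> \<le> vol R - vol (R \<inter> A i)" using UR[OF order_refl] sumT[OF order_refl] by simp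
  finally have "vol (R \<inter> A i) \<le> (c i + (real (card S) - 1) * e) * vol R" by (simp add: algebra_simps)
  also have "\<dots> \<le> (c i + card S * e) * vol R" using e by (intro mult_right_mono add_left_mono) auto
  finally show "vol (R \<inter> A i) \<le> (c i + card S * e) * vol R" .
qed

text \<open>
  A staircase laminate in terms of the masses \<open>c n Y\<close> of the points \<open>Y\<close> under the \<open>n\<close>-th building
  block, a laminate of finite order with barycenter \<open>X n\<close>, and the remaining mass \<open>\<beta> n\<close>. The
  blocks are counted from \<open>0\<close>, so the block \<open>n\<close> leads from \<open>X n\<close> to \<open>X (n + 1)\<close>.
\<close>

locale staircase_data =
  fixes K :: "(real^'m^'d) set" and \<nu> :: "(real^'m^'d) measure"
    and X :: "nat \<Rightarrow> real^'m^'d" and c :: "nat \<Rightarrow> real^'m^'d \<Rightarrow> real" and \<beta> :: "nat \<Rightarrow> real"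
  assumes \<nu>: "borel_prob \<nu>" "has_barycenter \<nu> (X 0)"
    and finS': "\<And>n. finite {Y. 0 < c n Y}" and sum_c': "\<And>n. sum (c n) {Y. 0 < c n Y} = 1"
    and TK': "\<And>n. {Y. 0 < c n Y} \<subseteq> insert (X (Suc n)) K" and XS': "\<And>n. 0 < c n (X (Suc n))"
    and bary': "\<And>n. (\<Sum>Y | 0 < c n Y. c n Y *\<^sub>R Y) = X n"
    and \<beta>0: "\<beta> 0 = 1" and \<beta>Suc: "\<And>n. \<beta> (Suc n) = \<beta> n * c n (X (Suc n))"
    and \<beta>lim: "\<beta> \<longlonglongrightarrow> 0"
    and \<nu>_sums': "\<And>E. E \<in> sets borel \<Longrightarrow>
      (\<lambda>n. \<beta> n * (\<Sum>Y\<in>{Y. 0 < c n Y} - {X (Suc n)}. c n Y * indicator E Y)) sums measure \<nu> E"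
begin

definition S :: "nat \<Rightarrow> (real^'m^'d) set" where "S n = {Y. 0 < c n Y}"
definition T :: "nat \<Rightarrow> (real^'m^'d) set" where "T n = S n - {X (Suc n)}"

lemma finS: "finite (S n)" and sum_c: "sum (c n) (S n) = 1" and XS: "X (Suc n) \<in> S n"
  and bary: "(\<Sum>Y\<in>S n. c n Y *\<^sub>R Y) = X n"
  using finS' sum_c' XS' bary' by (simp_all add: S_def)

lemma TK: "T n \<subseteq> K" using TK'[of n] by (auto simp: T_def S_def)

lemma \<nu>_sums: "E \<in> sets borel \<Longrightarrow> (\<lambda>n. \<beta> n * (\<Sum>Y\<in>T n. c n Y * indicator E Y)) sums measure \<nu> E"
  using \<nu>_sums' by (simp add: T_def S_def)

lemma c_pos: "Y \<in> S n \<Longrightarrow> 0 < c n Y" by (simp add: S_def)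

lemma \<beta>_pos: "0 < \<beta> n"
  by (induction n) (use \<beta>0 \<beta>Suc c_pos[OF XS] in auto)

lemma finT: "finite (T n)" using finS by (simp add: T_def)

text \<open>
  The weight in \<open>\<nu>\<close> of the atom \<open>Y\<close> of the block \<open>n\<close>. The same matrix may occur in several blocks,
  hence the index \<open>(n, Y)\<close>.
\<close>

definition mass :: "nat \<times> (real^'m^'d) \<Rightarrow> real" where
  "mass i = (if snd i \<in> T (fst i) then \<beta> (fst i) * c (fst i) (snd i) else 0)"

lemma mass_nonneg: "0 \<le> mass i"
  using \<beta>_pos[of "fst i"] c_pos[of "snd i" "fst i"] by (auto simp: mass_def T_def)

text \<open>
  A discrete representation of \<open>\<nu>\<close> turns integrals with respect to \<open>\<nu>\<close> into sums over the index \<open>(n, Y)\<close>.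
\<close>

lemma \<nu>_eq: "\<nu> = distr (density (count_space UNIV) (\<lambda>i. ennreal (mass i))) borel snd"
proof (rule measure_eqI)
  interpret prob_space \<nu> using \<nu>(1) by (simp add: borel_prob_def)
  show "sets \<nu> = sets (distr (density (count_space UNIV) (\<lambda>i. ennreal (mass i))) borel snd)"
    using \<nu>(1) by (simp add: borel_prob_def)
  fix E assume "E \<in> sets \<nu>"
  then have E: "E \<in> sets borel" using \<nu>(1) by (simp add: borel_prob_def)
  have "emeasure (distr (density (count_space UNIV) (\<lambda>i. ennreal (mass i))) borel snd) E
      = (\<integral>\<^sup>+i. ennreal (mass i) * indicator E (snd i) \<partial>count_space UNIV)"
    using E by (subst emeasure_distr) (auto simp: emeasure_density indicator_def intro!: nn_integral_cong)
  also have "\<dots> = (\<integral>\<^sup>+n. \<integral>\<^sup>+Y. ennreal (mass (n, Y)) * indicator E Y \<partial>count_space UNIV \<partial>count_space UNIV)"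
    by (subst nn_integral_fst_count_space[symmetric]) simp
  also have "\<dots> = (\<Sum>n. \<integral>\<^sup>+Y. ennreal (mass (n, Y)) * indicator E Y \<partial>count_space UNIV)"
    by (rule nn_integral_count_space_nat)
  also have "\<dots> = (\<Sum>n. ennreal (\<beta> n * (\<Sum>Y\<in>T n. c n Y * indicator E Y)))"
  proof (rule arg_cong[where f = suminf], rule ext)
    fix n
    have "(\<integral>\<^sup>+Y. ennreal (mass (n, Y)) * indicator E Y \<partial>count_space UNIV) = (\<Sum>Y\<in>T n. ennreal (mass (n, Y)) * indicator E Y)"
      by (rule nn_integral_count_space'[OF finT]) (auto simp: mass_def)
    also have "\<dots> = (\<Sum>Y\<in>T n. ennreal (mass (n, Y) * indicator E Y))"
      by (intro sum.cong) (auto simp: indicator_def)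
    also have "\<dots> = ennreal (\<Sum>Y\<in>T n. mass (n, Y) * indicator E Y)"
      by (rule sum_ennreal) (use mass_nonneg in auto)
    also have "(\<Sum>Y\<in>T n. mass (n, Y) * indicator E Y) = \<beta> n * (\<Sum>Y\<in>T n. c n Y * indicator E Y)"
      by (simp add: mass_def sum_distrib_left mult.assoc)
    finally show "(\<integral>\<^sup>+Y. ennreal (mass (n, Y)) * indicator E Y \<partial>count_space UNIV) = ennreal (\<beta> n * (\<Sum>Y\<in>T n. c n Y * indicator E Y))" .
  qed
  also have "\<dots> = ennreal (measure \<nu> E)"
  proof -
    have "0 \<le> \<beta> n * (\<Sum>Y\<in>T n. c n Y * indicator E Y)" for n
      using \<beta>_pos[of n] c_pos by (intro mult_nonneg_nonneg sum_nonneg) (auto simp: T_def less_imp_le)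
    then show ?thesis using \<nu>_sums[OF E] sums_unique[OF \<nu>_sums[OF E]] by (subst suminf_ennreal2) (auto simp: sums_iff)
  qed
  also have "\<dots> = emeasure \<nu> E" by (simp add: emeasure_eq_measure)
  finally show "emeasure \<nu> E = emeasure (distr (density (count_space UNIV) (\<lambda>i. ennreal (mass i))) borel snd) E" by simp
qed

lemma nn_integral_\<nu>:
  assumes "f \<in> borel_measurable borel"
  shows "(\<integral>\<^sup>+Y. f Y \<partial>\<nu>) = (\<integral>\<^sup>+i. ennreal (mass i) * f (snd i) \<partial>count_space UNIV)"
  unfolding \<nu>_eq using assms by (subst nn_integral_distr) (auto simp: nn_integral_density)

lemma integral_\<nu>: "integrable (count_space UNIV) (\<lambda>i. mass i *\<^sub>R snd i)"
  "(\<integral>i. mass i *\<^sub>R snd i \<partial>count_space UNIV) = X 0"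
proof -
  have b: "integrable \<nu> (\<lambda>X. X)" "integral\<^sup>L \<nu> (\<lambda>X. X) = X 0" using \<nu>(2) by (auto simp: has_barycenter_def)
  have "integrable (density (count_space UNIV) (\<lambda>i. ennreal (mass i))) snd"
    using b(1) unfolding \<nu>_eq by (subst (asm) integrable_distr_eq) auto
  then show "integrable (count_space UNIV) (\<lambda>i. mass i *\<^sub>R snd i)"
    by (subst (asm) integrable_density) (auto simp: mass_nonneg)
  have "X 0 = integral\<^sup>L (density (count_space UNIV) (\<lambda>i. ennreal (mass i))) snd"
    using b(2) unfolding \<nu>_eq by (subst (asm) integral_distr) auto
  also have "\<dots> = (\<integral>i. mass i *\<^sub>R snd i \<partial>count_space UNIV)"
    by (subst integral_density) (auto simp: mass_nonneg)
  finally show "(\<integral>i. mass i *\<^sub>R snd i \<partial>count_space UNIV) = X 0" by simp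
qed

text \<open>
  The sum of \<open>mass (n, Y) Y\<close> over the first \<open>N\<close> blocks telescopes to \<open>X 0 - \<beta> N X N\<close>, and it converges to
  the barycenter \<open>X 0\<close> of \<open>\<nu>\<close>.
\<close>

lemma soaring_vanishes: "(\<lambda>n. \<beta> n *\<^sub>R X n) \<longlonglongrightarrow> 0"
proof -
  let ?F = "\<lambda>N i. indicator {i. fst i < N} i *\<^sub>R (mass i *\<^sub>R snd i)"
  have "(\<lambda>N. \<integral>i. ?F N i \<partial>count_space UNIV) \<longlonglongrightarrow> (\<integral>i. mass i *\<^sub>R snd i \<partial>count_space UNIV)"
  proof (rule integral_dominated_convergence)
    show "integrable (count_space UNIV) (\<lambda>i. norm (mass i *\<^sub>R snd i))"
      by (rule integrable_norm[OF integral_\<nu>(1)])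
    show "AE i in count_space UNIV. (\<lambda>N. ?F N i) \<longlonglongrightarrow> mass i *\<^sub>R snd i"
    proof (rule AE_I2)
      fix i :: "nat \<times> (real^'m^'d)"
      have "eventually (\<lambda>N. mass i *\<^sub>R snd i = ?F N i) sequentially"
        using eventually_gt_at_top[of "fst i"] by eventually_elim simp
      then show "(\<lambda>N. ?F N i) \<longlonglongrightarrow> mass i *\<^sub>R snd i" by (rule Lim_transform_eventually[OF tendsto_const])
    qed
  qed (auto simp: indicator_def)
  moreover have "(\<integral>i. ?F N i \<partial>count_space UNIV) = X 0 - \<beta> N *\<^sub>R X N" for N
  proof -
    let ?I = "SIGMA n:{..<N}. T n"
    have fin: "finite ?I" using finT by auto
    have sub: "{i. ?F N i \<noteq> 0} \<subseteq> ?I" by (auto simp: mass_def indicator_def split: if_splits)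
    have "(\<integral>i. ?F N i \<partial>count_space UNIV) = (\<Sum>i | ?F N i \<noteq> 0. ?F N i)"
      using lebesgue_integral_count_space_finite_support[of UNIV "?F N"] finite_subset[OF sub fin] by simp
    also have "\<dots> = (\<Sum>i\<in>?I. ?F N i)" by (rule sum.mono_neutral_left[OF fin sub]) auto
    also have "\<dots> = (\<Sum>n<N. \<Sum>Y\<in>T n. ?F N (n, Y))" by (subst sum.Sigma) (auto simp: finT case_prod_beta)
    also have "\<dots> = (\<Sum>n<N. \<beta> n *\<^sub>R X n - \<beta> (Suc n) *\<^sub>R X (Suc n))"
    proof (rule sum.cong[OF refl])
      fix n assume "n \<in> {..<N}"
      then have "(\<Sum>Y\<in>T n. ?F N (n, Y)) = \<beta> n *\<^sub>R (\<Sum>Y\<in>T n. c n Y *\<^sub>R Y)"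
        by (simp add: mass_def scaleR_sum_right)
      also have "(\<Sum>Y\<in>T n. c n Y *\<^sub>R Y) = X n - c n (X (Suc n)) *\<^sub>R X (Suc n)"
        unfolding T_def bary[of n, symmetric] using finS XS by (simp add: sum_diff1)
      finally show "(\<Sum>Y\<in>T n. ?F N (n, Y)) = \<beta> n *\<^sub>R X n - \<beta> (Suc n) *\<^sub>R X (Suc n)"
        by (simp add: scaleR_diff_right \<beta>Suc)
    qed
    also have "\<dots> = X 0 - \<beta> N *\<^sub>R X N" by (subst sum_lessThan_telescope') (simp add: \<beta>0)
    finally show ?thesis .
  qed
  ultimately have "(\<lambda>N. X 0 - \<beta> N *\<^sub>R X N) \<longlonglongrightarrow> X 0" using integral_\<nu>(2) by simp
  then have "(\<lambda>N. X 0 - (X 0 - \<beta> N *\<^sub>R X N)) \<longlonglongrightarrow> X 0 - X 0" by (intro tendsto_diff tendsto_const)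
  then show ?thesis by simp
qed

end

lemma barycenter_finite_support:
  fixes \<omega> :: "('a::euclidean_space) measure"
  assumes \<omega>: "borel_prob \<omega>" and F: "finite F" and sum: "(\<Sum>Y\<in>F. measure \<omega> {Y}) = 1"
  shows "integral\<^sup>L \<omega> (\<lambda>Y. Y) = (\<Sum>Y\<in>F. measure \<omega> {Y} *\<^sub>R Y)"
proof -
  interpret prob_space \<omega> using \<omega> by (simp add: borel_prob_def)
  have s: "sets \<omega> = sets borel" using \<omega> by (simp add: borel_prob_def)
  have Fs: "F \<in> sets \<omega>" "{Y} \<in> sets \<omega>" for Y using F by (auto simp: s intro: borel_closed finite_imp_closed)
  have "measure \<omega> F = 1"
    using finite_measure_eq_sum_singleton[OF F] Fs sum by simp
  then have ae: "AE Y in \<omega>. Y \<in> F" using prob_eq_1[OF Fs(1)] by simp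
  have idm: "(\<lambda>Y. Y) \<in> borel_measurable \<omega>" by (simp add: measurable_def s sets_eq_imp_space_eq[OF s])
  have im: "(\<lambda>Y. \<Sum>Z\<in>F. indicator {Z} Y *\<^sub>R Z) \<in> borel_measurable \<omega>"
    using Fs by (intro borel_measurable_sum borel_measurable_scaleR borel_measurable_indicator) auto
  have "integral\<^sup>L \<omega> (\<lambda>Y. Y) = integral\<^sup>L \<omega> (\<lambda>Y. \<Sum>Z\<in>F. indicator {Z} Y *\<^sub>R Z)"
  proof (rule integral_cong_AE[OF idm im])
    show "AE Y in \<omega>. Y = (\<Sum>Z\<in>F. indicator {Z} Y *\<^sub>R Z)"
      using ae
    proof eventually_elim
      case (elim Y)
      have "(\<Sum>Z\<in>F. indicator {Z} Y *\<^sub>R Z) = (\<Sum>Z\<in>F. if Z = Y then Y else 0)"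
        by (intro sum.cong) (auto simp: indicator_def)
      then show ?case using F elim by simp
    qed
  qed
  also have "\<dots> = (\<Sum>Z\<in>F. integral\<^sup>L \<omega> (\<lambda>Y. indicator {Z} Y *\<^sub>R Z))"
    using Fs by (intro Bochner_Integration.integral_sum integrable_scaleR_left integrable_real_indicator) (auto simp: emeasure_eq_measure)
  also have "\<dots> = (\<Sum>Z\<in>F. measure \<omega> {Z} *\<^sub>R Z)"
    using Fs by (intro sum.cong) (auto simp: emeasure_eq_measure)
  finally show ?thesis .
qed

text \<open>
  The mass of the block \<open>n\<close> at \<open>X (n + 1)\<close> is \<open>\<gamma> (n + 1)\<close>, as \<open>\<mu> (n + 1)\<close> lives on \<open>K\<close> and \<open>X (n + 1)\<close> is outside
  \<open>K\<close>; the other atoms belong to \<open>\<mu> (n + 1)\<close>.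
\<close>

lemma staircase_laminate_data:
  fixes \<nu> :: "(real^'m^'d) measure"
  assumes "staircase_laminate U K X0 \<nu>"
  obtains X \<omega> \<beta> where "X 0 = X0" "\<forall>n. finite_order_laminate U (X n) (\<omega> n)"
    "staircase_data K \<nu> X (\<lambda>n Y. measure (\<omega> n) {Y}) \<beta>"
proof -
  have \<nu>: "borel_prob \<nu>" "has_barycenter \<nu> X0" using assms by (auto simp: staircase_laminate_def)
  obtain X \<mu> \<gamma> where X: "X 0 = X0" "\<And>n. X n \<notin> K" and \<mu>: "\<And>n. n \<ge> 1 \<Longrightarrow> finite_dirac_combination K (\<mu> n)"
    and \<gamma>: "\<And>n. n \<ge> 1 \<Longrightarrow> \<gamma> n \<in> {0<..<1}"
    and lam: "\<And>n. n \<ge> 1 \<Longrightarrow> finite_order_laminate U (X (n - 1)) (convex_mix (1 - \<gamma> n) (\<mu> n) (return borel (X n)))"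
    and bar: "\<And>n. n \<ge> 1 \<Longrightarrow> has_barycenter (convex_mix (1 - \<gamma> n) (\<mu> n) (return borel (X n))) (X (n - 1))"
    and lim0: "stair_weight \<gamma> \<longlonglongrightarrow> 0"
    and limE: "\<And>E. E \<in> sets borel \<Longrightarrow> (\<lambda>N. partial_staircase X \<mu> \<gamma> N E) \<longlonglongrightarrow> measure \<nu> E"
    using assms unfolding staircase_laminate_def Let_def by blast
  define \<omega> where "\<omega> n = convex_mix (1 - \<gamma> (Suc n)) (\<mu> (Suc n)) (return borel (X (Suc n)))" for n
  define c where "c n Y = measure (\<omega> n) {Y}" for n Y
  have \<mu>p: "borel_prob (\<mu> (Suc n))" for n using \<mu>[of "Suc n"] by (simp add: finite_dirac_combination_def)
  have g: "0 < \<gamma> (Suc n)" "\<gamma> (Suc n) < 1" for n using \<gamma>[of "Suc n"] by auto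
  have \<omega>p: "borel_prob (\<omega> n)" for n
    unfolding \<omega>_def using g[of n] by (intro borel_prob_convex_mix \<mu>p borel_prob_return) auto
  have c: "c n Y = (1 - \<gamma> (Suc n)) * measure (\<mu> (Suc n)) {Y} + (if Y = X (Suc n) then \<gamma> (Suc n) else 0)" for n Y
    unfolding c_def \<omega>_def using g[of n]
    by (subst measure_convex_mix[OF \<mu>p borel_prob_return]) (auto simp: measure_return_singleton)
  define good where "good n F a \<longleftrightarrow> finite F \<and> F \<subseteq> K \<and> (\<forall>Y\<in>F. 0 \<le> a Y) \<and> (\<Sum>Y\<in>F. a Y) = 1 \<and>
      (\<forall>E\<in>sets borel. measure (\<mu> (Suc n)) E = (\<Sum>Y\<in>F. a Y * indicator E Y))" for n F and a :: "real^'m^'d \<Rightarrow> real"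
  have "\<forall>n. \<exists>F a. good n F a"
    using \<mu> unfolding finite_dirac_combination_def good_def by simp
  then obtain F a where "\<And>n. good n (F n) (a n)" by metis
  then have F: "\<And>n. finite (F n)" "\<And>n. F n \<subseteq> K" "\<And>n Y. Y \<in> F n \<Longrightarrow> 0 \<le> a n Y" "\<And>n. (\<Sum>Y\<in>F n. a n Y) = 1"
    "\<And>n E. E \<in> sets borel \<Longrightarrow> measure (\<mu> (Suc n)) E = (\<Sum>Y\<in>F n. a n Y * indicator E Y)"
    unfolding good_def by blast+
  have \<mu>s: "measure (\<mu> (Suc n)) {Y} = (if Y \<in> F n then a n Y else 0)" for n Y
  proof -
    have "measure (\<mu> (Suc n)) {Y} = (\<Sum>Z\<in>F n. a n Z * indicator {Y} Z)" by (rule F(5)) simp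
    also have "\<dots> = (\<Sum>Z\<in>F n. if Z = Y then a n Z else 0)" by (intro sum.cong) (auto simp: indicator_def)
    finally show ?thesis using F(1) by simp
  qed
  have XF: "X (Suc n) \<notin> F n" for n using X(2) F(2) by blast
  have cX: "c n (X (Suc n)) = \<gamma> (Suc n)" for n using XF by (simp add: c \<mu>s)
  have cF: "c n Y = (1 - \<gamma> (Suc n)) * a n Y" if "Y \<in> F n" for n Y
    using that XF[of n] by (auto simp: c \<mu>s)
  have c0: "c n Y = 0" if "Y \<notin> insert (X (Suc n)) (F n)" for n Y using that by (simp add: c \<mu>s)
  have S: "{Y. 0 < c n Y} = insert (X (Suc n)) {Y\<in>F n. 0 < a n Y}" for n
  proof (rule set_eqI)
    fix Y show "Y \<in> {Y. 0 < c n Y} \<longleftrightarrow> Y \<in> insert (X (Suc n)) {Y\<in>F n. 0 < a n Y}"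
      using cX[of n] cF[of Y n] c0[of Y n] g[of n] XF[of n]
      by (cases "Y \<in> F n"; cases "Y = X (Suc n)") (auto simp: zero_less_mult_iff)
  qed
  have sumF: "(\<Sum>Y\<in>F n. a n Y * h Y) = (\<Sum>Y\<in>{Y\<in>F n. 0 < a n Y}. a n Y * h Y)" for n and h :: "real^'m^'d \<Rightarrow> real"
    by (rule sum.mono_neutral_right) (use F(1,3) in \<open>auto simp: less_le\<close>)
  have sc: "sum (c n) {Y. 0 < c n Y} = 1" for n
  proof -
    have "sum (c n) {Y. 0 < c n Y} = \<gamma> (Suc n) + (\<Sum>Y\<in>{Y\<in>F n. 0 < a n Y}. (1 - \<gamma> (Suc n)) * a n Y)"
      unfolding S using F(1) XF cX cF by (subst sum.insert) (auto intro!: sum.cong)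
    also have "\<dots> = \<gamma> (Suc n) + (1 - \<gamma> (Suc n)) * (\<Sum>Y\<in>F n. a n Y)"
      using sumF[of n "\<lambda>_. 1"] by (simp add: sum_distrib_left)
    finally show ?thesis by (simp add: F(4))
  qed
  have fin: "finite {Y. 0 < c n Y}" for n unfolding S using F(1) by simp
  have "staircase_data K \<nu> X c (stair_weight \<gamma>)"
  proof (unfold_locales)
    show "borel_prob \<nu>" "has_barycenter \<nu> (X 0)" using \<nu> X by auto
    show "finite {Y. 0 < c n Y}" "sum (c n) {Y. 0 < c n Y} = 1" for n by (rule fin, rule sc)
    show "{Y. 0 < c n Y} \<subseteq> insert (X (Suc n)) K" for n unfolding S using F(2) by blast
    show "0 < c n (X (Suc n))" for n using cX g by simp
    show "(\<Sum>Y | 0 < c n Y. c n Y *\<^sub>R Y) = X n" for n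
      using barycenter_finite_support[OF \<omega>p fin[of n], of n] sc[of n] bar[of "Suc n"]
      by (simp add: c_def has_barycenter_def \<omega>_def)
    show "stair_weight \<gamma> 0 = 1" by (simp add: stair_weight_def)
    show sw: "stair_weight \<gamma> (Suc n) = stair_weight \<gamma> n * c n (X (Suc n))" for n by (simp add: stair_weight_def cX)
    show "stair_weight \<gamma> \<longlonglongrightarrow> 0" by (rule lim0)
    fix E :: "(real^'m^'d) set" assume E: "E \<in> sets borel"
    have ps: "partial_staircase X \<mu> \<gamma> N E = (\<Sum>n<N. stair_weight \<gamma> n * ((1 - \<gamma> (Suc n)) * measure (\<mu> (Suc n)) E)) + stair_weight \<gamma> N * indicator E (X N)" for N
    proof -
      have "(\<Sum>n=1..N. stair_weight \<gamma> (n - 1) * (1 - \<gamma> n) * measure (\<mu> n) E)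
          = (\<Sum>n<N. stair_weight \<gamma> (Suc n - 1) * (1 - \<gamma> (Suc n)) * measure (\<mu> (Suc n)) E)"
        by (rule sum.reindex_bij_witness[of _ Suc "\<lambda>n. n - 1"]) auto
      then show ?thesis by (simp add: partial_staircase_def mult.assoc)
    qed
    have "(\<lambda>N. stair_weight \<gamma> N * indicator E (X N) :: real) \<longlonglongrightarrow> 0"
    proof (rule Lim_null_comparison[OF always_eventually])
      show "\<forall>N. norm (stair_weight \<gamma> N * indicator E (X N) :: real) \<le> \<bar>stair_weight \<gamma> N\<bar>" by (auto simp: indicator_def)
      show "(\<lambda>N. \<bar>stair_weight \<gamma> N\<bar>) \<longlonglongrightarrow> 0" using tendsto_rabs_zero[OF lim0] .
    qed
    from tendsto_diff[OF limE[OF E] this]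
    have "(\<lambda>N. \<Sum>n<N. stair_weight \<gamma> n * ((1 - \<gamma> (Suc n)) * measure (\<mu> (Suc n)) E)) \<longlonglongrightarrow> measure \<nu> E" by (simp add: ps)
    moreover have "(1 - \<gamma> (Suc n)) * measure (\<mu> (Suc n)) E = (\<Sum>Y\<in>{Y. 0 < c n Y} - {X (Suc n)}. c n Y * indicator E Y)" for n
    proof -
      have eq: "{Y. 0 < c n Y} - {X (Suc n)} = {Y\<in>F n. 0 < a n Y}" unfolding S using XF by blast
      have "(\<Sum>Y\<in>{Y. 0 < c n Y} - {X (Suc n)}. c n Y * indicator E Y) = (\<Sum>Y\<in>{Y\<in>F n. 0 < a n Y}. (1 - \<gamma> (Suc n)) * (a n Y * indicator E Y))"
        by (rule sum.cong[OF eq]) (simp add: cF)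
      also have "\<dots> = (1 - \<gamma> (Suc n)) * (\<Sum>Y\<in>F n. a n Y * indicator E Y)" unfolding sumF by (simp add: sum_distrib_left)
      finally show ?thesis by (simp add: F(5)[OF E])
    qed
    ultimately show "(\<lambda>n. stair_weight \<gamma> n * (\<Sum>Y\<in>{Y. 0 < c n Y} - {X (Suc n)}. c n Y * indicator E Y)) sums measure \<nu> E"
      unfolding sums_def by simp
  qed
  then have "staircase_data K \<nu> X (\<lambda>n Y. measure (\<omega> n) {Y}) (stair_weight \<gamma>)" by (simp add: c_def[abs_def])
  moreover have "\<forall>n. finite_order_laminate U (X n) (\<omega> n)" using lam[of "Suc n" for n] by (simp add: \<omega>_def)
  ultimately show ?thesis using that X(1) by blast
qed

lemma ex_realization_sequence:
  fixes X :: "nat \<Rightarrow> real^'m^'d"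
  assumes re: "\<And>n. realizable \<alpha> U (\<rho> n) (X n) (\<omega> n)" and e: "\<And>n. 0 < e n"
    and \<Omega>: "open \<Omega>" "bounded \<Omega>" and w0: "lipschitz_map w0" "\<Omega> \<subseteq> grad_region w0 (X 0)"
  obtains w R where "w 0 = w0" "R 0 = \<Omega>" "\<forall>n. lipschitz_map (w n)" "\<forall>n. open (R n)"
    "\<forall>n. R n \<subseteq> grad_region (w n) (X n)" "\<forall>n. R (Suc n) = R n \<inter> grad_region (w (Suc n)) (X (Suc n))"
    "\<forall>n. realizes \<alpha> (e n) U (\<rho> n) (\<omega> n) (R n) (w n) (w (Suc n))"
proof -
  define P where "P n x \<longleftrightarrow> lipschitz_map (fst x) \<and> open (snd x) \<and> bounded (snd x) \<and> snd x \<subseteq> grad_region (fst x) (X n) \<and>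
      (n = 0 \<longrightarrow> x = (w0, \<Omega>))" for n :: nat and x :: "(real^'m \<Rightarrow> real^'d) \<times> (real^'m) set"
  define Q where "Q n x y \<longleftrightarrow> snd y = snd x \<inter> grad_region (fst y) (X (Suc n)) \<and>
      realizes \<alpha> (e n) U (\<rho> n) (\<omega> n) (snd x) (fst x) (fst y)"
    for n :: nat and x y :: "(real^'m \<Rightarrow> real^'d) \<times> (real^'m) set"
  have "\<exists>f. \<forall>n. P n (f n) \<and> Q n (f n) (f (Suc n))"
  proof (rule dependent_nat_choice)
    show "\<exists>x. P 0 x" unfolding P_def using \<Omega> w0 by (intro exI[of _ "(w0, \<Omega>)"]) simp
    fix x n assume Px: "P n x"
    obtain w' where w': "realizes \<alpha> (e n) U (\<rho> n) (\<omega> n) (snd x) (fst x) w'"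
      using re[of n] e[of n] Px unfolding realizable_def P_def by meson
    show "\<exists>y. P (Suc n) y \<and> Q n x y"
    proof (intro exI conjI)
      show "P (Suc n) (w', snd x \<inter> grad_region w' (X (Suc n)))"
        using Px w' by (auto simp: P_def realizes_def modification_def intro: bounded_Int open_Int[OF _ open_grad_region])
      show "Q n x (w', snd x \<inter> grad_region w' (X (Suc n)))" using w' by (simp add: Q_def)
    qed
  qed
  then obtain f where f: "\<And>n. P n (f n)" "\<And>n. Q n (f n) (f (Suc n))" by blast
  have f0: "f 0 = (w0, \<Omega>)" using f(1)[of 0] by (simp add: P_def)
  show ?thesis
    by (rule that[of "\<lambda>n. fst (f n)" "\<lambda>n. snd (f n)"])
      (use f f0 in \<open>simp_all add: P_def Q_def\<close>)
qed

section \<open>The infinite construction\<close>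

lemma modification_mono:
  assumes "modification \<alpha> \<eta> S w w'" "\<eta> \<le> \<eta>'"
  shows "modification \<alpha> \<eta>' S w w'"
proof -
  have "\<eta> * r \<le> \<eta>' * r" if "0 \<le> r" for r using that assms(2) by (rule mult_right_mono[rotated])
  then show ?thesis using assms unfolding modification_def by (meson order_trans powr_ge_zero)
qed

text \<open>
  The gradient at the points near which the map is affine, and \<open>0\<close> elsewhere.
\<close>

definition gradient_map :: "(real^'m \<Rightarrow> real^'d) \<Rightarrow> real^'m \<Rightarrow> real^'m^'d" where
  "gradient_map w x = (if \<exists>Y. x \<in> grad_region w Y then THE Y. x \<in> grad_region w Y else 0)"

lemma gradient_map_eq: "x \<in> grad_region w Y \<Longrightarrow> gradient_map w x = Y"
  unfolding gradient_map_def using grad_region_unique by (metis the_equality)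

lemma gradient_map_eq_0: "x \<notin> (\<Union>Y. grad_region w Y) \<Longrightarrow> gradient_map w x = 0"
  by (auto simp: gradient_map_def)

lemma grad_region_affine: "grad_region (\<lambda>x. X *v x + b) X = UNIV"
  unfolding affine_near_def by (auto simp: matrix_vector_mult_diff_distrib intro!: exI[of _ 1])

text \<open>
  The sequence of maps for one staircase. The tolerance \<open>e n\<close> is small in three respects: it makes the
  modifications summable, it is small relative to all weights of the block \<open>n\<close>, and it compensates
  the bound \<open>\<rho> n\<close> on the errors of the block to the power \<open>r\<close>. The cardinalities come from
  \<open>upper_of_lower_fractions\<close>.
\<close>

locale staircase_realization = staircase_data K \<nu> X c \<beta>
  for K :: "(real^'m^'d) set" and \<nu> X c \<beta> +
  fixes U :: "(real^'m^'d) set" and \<alpha> r \<delta> :: real and \<rho> e :: "nat \<Rightarrow> real" and \<Omega> :: "(real^'m) set"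
    and b :: "real^'d" and w :: "nat \<Rightarrow> real^'m \<Rightarrow> real^'d" and R :: "nat \<Rightarrow> (real^'m) set"
  assumes \<alpha>: "0 < \<alpha>" "\<alpha> < 1" and r: "1 \<le> r" and \<delta>: "0 < \<delta>" and \<rho>: "\<And>n. 0 \<le> \<rho> n" and \<Omega>: "regular_domain \<Omega>"
    and w0: "w 0 = (\<lambda>x. X 0 *v x + b)" and R0: "R 0 = \<Omega>"
    and lip: "\<And>n. lipschitz_map (w n)" and oR: "\<And>n. open (R n)" and Rgrad: "\<And>n. R n \<subseteq> grad_region (w n) (X n)"
    and mod: "\<And>n. modification \<alpha> (e n) (R n) (w n) (w (Suc n))"
    and RSuc: "\<And>n. R (Suc n) = R n \<inter> grad_region (w (Suc n)) (X (Suc n))"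
    and neg: "\<And>n. negligible (R n - (\<Union>Y\<in>{Y. 0 < c n Y} \<union> {Y\<in>U. norm Y \<le> \<rho> n}. grad_region (w (Suc n)) Y))"
    and low: "\<And>n Y. (c n Y - e n) * vol (R n) \<le> vol (R n \<inter> grad_region (w (Suc n)) Y)"
    and e_pos: "\<And>n. 0 < e n" and e1: "\<And>n. e n \<le> 1 / 2 ^ Suc n"
    and e2: "\<And>n Y. 0 < c n Y \<Longrightarrow> card {Y. 0 < c n Y} * e n \<le> c n Y / 2 ^ (n + 2)"
    and e3: "\<And>n. card {Y. 0 < c n Y} * e n * (1 + \<rho> n) powr r \<le> \<delta> * (1 / 2) ^ Suc n"
begin

lemma R_decreasing: "m \<le> n \<Longrightarrow> R n \<subseteq> R m"
  by (rule lift_Suc_antimono_le[of R]) (use RSuc in auto)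

lemma R_subset: "R n \<subseteq> \<Omega>" using R_decreasing[of 0 n] R0 by simp

lemma \<Omega>_facts: "open \<Omega>" "bounded \<Omega>" "\<Omega> \<noteq> {}" "\<Omega> \<in> lmeasurable"
  using \<Omega> by (auto simp: regular_domain_def intro: lmeasurable_open)

lemma R_lmeasurable: "R n \<in> lmeasurable"
  using oR R_subset \<Omega>_facts(2) by (intro lmeasurable_open) (auto intro: bounded_subset)

lemma modification_between: "m \<le> n \<Longrightarrow> modification \<alpha> (1 / 2 ^ m - 1 / 2 ^ n) (R m) (w m) (w n)"
proof (induction n rule: dec_induct)
  case base
  show ?case by (simp add: modification_refl lip)
next
  case (step n)
  have "modification \<alpha> ((1 / 2 ^ m - 1 / 2 ^ n) + e n) (R m) (w m) (w (Suc n))"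
    by (rule modification_trans[OF step.IH mod R_decreasing[OF step.hyps(1)]])
  then show ?case by (rule modification_mono) (use e1[of n] in \<open>simp add: field_simps\<close>)
qed

lemma w_eq_off: "m \<le> n \<Longrightarrow> x \<notin> R m \<Longrightarrow> w n x = w m x"
  using modification_between by (auto simp: modification_def)

lemma w_close: "m \<le> n \<Longrightarrow> norm (w n x - w m x) \<le> 1 / 2 ^ m"
proof -
  assume "m \<le> n"
  then have "norm (w n x - w m x) \<le> 1 / 2 ^ m - 1 / 2 ^ n"
    using modification_between unfolding modification_def by blast
  also have "\<dots> \<le> 1 / 2 ^ m" by simp
  finally show ?thesis .
qed

definition W :: "real^'m \<Rightarrow> real^'d" where "W x = lim (\<lambda>n. w n x)"

lemma w_lim: "(\<lambda>n. w n x) \<longlonglongrightarrow> W x"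
proof -
  have "Cauchy (\<lambda>n. w n x)"
  proof (rule CauchyI')
    fix \<epsilon> :: real assume "0 < \<epsilon>"
    then obtain N where N: "(1 / 2) ^ N < \<epsilon>" using real_arch_pow_inv[of \<epsilon> "1 / 2"] by auto
    have "norm (w m x - w n x) < \<epsilon>" if "m \<ge> N" "n > m" for m n
    proof -
      have "norm (w m x - w n x) \<le> 1 / 2 ^ m" using w_close[of m n x] that by (simp add: norm_minus_commute)
      also have "\<dots> \<le> 1 / 2 ^ N" using that by (simp add: frac_le)
      also have "\<dots> < \<epsilon>" using N by (simp add: power_one_over)
      finally show ?thesis .
    qed
    then show "\<exists>M. \<forall>m\<ge>M. \<forall>n>m. dist (w m x) (w n x) < \<epsilon>" unfolding dist_norm by blast
  qed
  then show ?thesis unfolding W_def by (simp add: Cauchy_convergent_iff convergent_LIMSEQ_iff)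
qed

lemma W_close: "norm (W x - w m x) \<le> 1 / 2 ^ m"
proof (rule tendsto_upperbound)
  show "(\<lambda>n. norm (w n x - w m x)) \<longlonglongrightarrow> norm (W x - w m x)" by (intro tendsto_intros w_lim)
  show "\<forall>\<^sub>F n in sequentially. norm (w n x - w m x) \<le> 1 / 2 ^ m"
    using eventually_ge_at_top[of m] by eventually_elim (rule w_close)
qed simp

lemma W_eq_off: "x \<notin> R m \<Longrightarrow> W x = w m x"
proof -
  assume x: "x \<notin> R m"
  have "eventually (\<lambda>n. w m x = w n x) sequentially"
    using eventually_ge_at_top[of m] by eventually_elim (use w_eq_off x in auto)
  from Lim_transform_eventually[OF tendsto_const this] have "(\<lambda>n. w n x) \<longlonglongrightarrow> w m x" .
  then show ?thesis using w_lim LIMSEQ_unique by blast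
qed

lemma W_holder: "norm ((W x - w 0 x) - (W y - w 0 y)) \<le> norm (x - y) powr \<alpha>"
proof (rule tendsto_upperbound)
  show "(\<lambda>n. norm ((w n x - w 0 x) - (w n y - w 0 y))) \<longlonglongrightarrow> norm ((W x - w 0 x) - (W y - w 0 y))"
    by (intro tendsto_intros w_lim)
  have "norm ((w n x - w 0 x) - (w n y - w 0 y)) \<le> norm (x - y) powr \<alpha>" for n
  proof -
    have "norm ((w n x - w 0 x) - (w n y - w 0 y)) \<le> (1 / 2 ^ 0 - 1 / 2 ^ n) * norm (x - y) powr \<alpha>"
      using modification_between[of 0 n] unfolding modification_def by blast
    also have "\<dots> \<le> 1 * norm (x - y) powr \<alpha>" by (intro mult_right_mono) auto
    finally show ?thesis by simp
  qed
  then show "\<forall>\<^sub>F n in sequentially. norm ((w n x - w 0 x) - (w n y - w 0 y)) \<le> norm (x - y) powr \<alpha>" by simp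
qed simp

text \<open>
  A region with a gradient other than the soaring one is disjoint from \<open>R (k + 1)\<close>, hence left alone by
  all later modifications.
\<close>

lemma region_persists:
  assumes x: "x \<in> R k" "x \<in> grad_region (w (Suc k)) Y" and Y: "Y \<noteq> X (Suc k)"
  shows "Suc k \<le> n \<Longrightarrow> x \<in> grad_region (w n) Y" "x \<in> grad_region W Y"
proof -
  let ?N = "R k \<inter> grad_region (w (Suc k)) Y"
  have N: "open ?N" "x \<in> ?N" using x by (auto intro!: open_Int oR open_grad_region)
  have off: "y \<notin> R (Suc k)" if "y \<in> ?N" for y
    using that grad_region_unique[of y "w (Suc k)" Y "X (Suc k)"] Y unfolding RSuc by blast
  show "x \<in> grad_region W Y"
    by (rule affine_near_cong[OF N W_eq_off[OF off, symmetric] x(2)])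
  assume n: "Suc k \<le> n"
  show "x \<in> grad_region (w n) Y"
    by (rule affine_near_cong[OF N w_eq_off[OF n off, symmetric] x(2)])
qed

text \<open>
  The final region of the atom \<open>Y\<close> of block \<open>n\<close>, for \<open>i = (n, Y)\<close>.
\<close>

definition P :: "nat \<times> (real^'m^'d) \<Rightarrow> (real^'m) set" where
  "P i = R (fst i) \<inter> grad_region (w (Suc (fst i))) (snd i)"

text \<open>
  The error set of block \<open>n\<close>; almost all its gradients are in \<open>U\<close>, and some may be in \<open>K\<close> as well.
\<close>

definition err :: "nat \<Rightarrow> (real^'m) set" where
  "err n = R n - (\<Union>Y\<in>S n. grad_region (w (Suc n)) Y)"

definition I :: "(nat \<times> (real^'m^'d)) set" where "I = (SIGMA n:UNIV. T n)"

lemma countable_I: "countable I"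
  unfolding I_def using finT by (intro countable_SIGMA) (auto intro: countable_finite)

lemma open_P: "open (P i)" unfolding P_def by (intro open_Int oR open_grad_region)

lemma P_sets: "P i \<in> sets lebesgue" by (intro open_imp_sets_lebesgue open_P)

lemma P_subset: "P i \<subseteq> \<Omega>" using R_subset by (auto simp: P_def)

lemma P_lmeasurable: "P i \<in> lmeasurable"
  using fmeasurableI2[OF \<Omega>_facts(4) P_subset P_sets] .

lemma err_sets: "err n \<in> sets lebesgue"
  unfolding err_def using oR by (intro sets.Diff open_imp_sets_lebesgue open_UN open_grad_region) (auto intro: open_grad_region)

lemma err_lmeasurable: "err n \<in> lmeasurable"
  using fmeasurableI2[OF R_lmeasurable[of n] _ err_sets] by (auto simp: err_def)

lemma P_grad:
  assumes "i \<in> I" "x \<in> P i"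
  shows "x \<in> grad_region W (snd i)" "Suc (fst i) \<le> n \<Longrightarrow> x \<in> grad_region (w n) (snd i)"
proof -
  have "x \<in> R (fst i)" "x \<in> grad_region (w (Suc (fst i))) (snd i)" "snd i \<noteq> X (Suc (fst i))"
    using assms by (auto simp: I_def P_def T_def)
  from region_persists(2)[OF this] region_persists(1)[OF this, of n]
  show "x \<in> grad_region W (snd i)" "Suc (fst i) \<le> n \<Longrightarrow> x \<in> grad_region (w n) (snd i)" by blast+
qed

lemma disjoint_P: "disjoint_family_on P I"
proof -
  have *: "P i \<inter> P j = {}" if "i \<in> I" "j \<in> I" "fst i \<le> fst j" "i \<noteq> j" for i j
  proof (cases "fst i = fst j")
    case True
    then have "snd i \<noteq> snd j" using that(4) by (auto simp: prod_eq_iff)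
    then show ?thesis using grad_region_unique[of _ "w (Suc (fst i))" "snd i" "snd j"] True by (auto simp: P_def)
  next
    case False
    then have "R (fst j) \<subseteq> R (Suc (fst i))" using that(3) by (intro R_decreasing) auto
    moreover have "P i \<inter> R (Suc (fst i)) = {}"
      using grad_region_unique[of _ "w (Suc (fst i))" "snd i" "X (Suc (fst i))"] that(1)
      by (auto simp: P_def RSuc I_def T_def)
    ultimately show ?thesis by (auto simp: P_def)
  qed
  show ?thesis unfolding disjoint_family_on_def
  proof (intro ballI impI)
    fix i j assume "i \<in> I" "j \<in> I" "i \<noteq> j"
    then show "P i \<inter> P j = {}" using *[of i j] *[of j i] by (cases "fst i \<le> fst j") auto
  qed
qed

lemma cover_finite: "\<Omega> - R n \<subseteq> (\<Union>i\<in>{i\<in>I. fst i < n}. P i) \<union> (\<Union>k<n. err k)"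
proof (induction n)
  case 0
  then show ?case by (simp add: R0)
next
  case (Suc n)
  show ?case
  proof
    fix x assume x: "x \<in> \<Omega> - R (Suc n)"
    show "x \<in> (\<Union>i\<in>{i\<in>I. fst i < Suc n}. P i) \<union> (\<Union>k<Suc n. err k)"
    proof (cases "x \<in> R n")
      case False
      then have "x \<in> (\<Union>i\<in>{i\<in>I. fst i < n}. P i) \<union> (\<Union>k<n. err k)" using Suc x by blast
      then show ?thesis by (auto simp: less_Suc_eq)
    next
      case True
      show ?thesis
      proof (cases "x \<in> err n")
        case False
        then obtain Y where Y: "Y \<in> S n" "x \<in> grad_region (w (Suc n)) Y" using True by (auto simp: err_def)
        then have "Y \<in> T n" using x True by (auto simp: T_def RSuc)
        then have "(n, Y) \<in> {i\<in>I. fst i < Suc n}" "x \<in> P (n, Y)" using True Y by (auto simp: I_def P_def)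
        then show ?thesis by blast
      qed auto
    qed
  qed
qed

lemma cover: "\<Omega> \<subseteq> (\<Union>i\<in>I. P i) \<union> (\<Union>n. err n) \<union> (\<Inter>n. R n)"
proof
  fix x assume x: "x \<in> \<Omega>"
  show "x \<in> (\<Union>i\<in>I. P i) \<union> (\<Union>n. err n) \<union> (\<Inter>n. R n)"
  proof (cases "\<forall>n. x \<in> R n")
    case False
    then obtain n where "x \<notin> R n" by blast
    then have "x \<in> (\<Union>i\<in>{i\<in>I. fst i < n}. P i) \<union> (\<Union>k<n. err k)" using cover_finite[of n] x by blast
    then show ?thesis by blast
  qed blast
qed

lemma negligible_err_region:
  "negligible (err n - (\<Union>Y\<in>{Y\<in>U. norm Y \<le> \<rho> n} - {X (Suc n)}. grad_region (w (Suc n)) Y))"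
  by (rule negligible_subset[OF neg[of n]]) (use XS[of n] in \<open>auto simp: err_def S_def\<close>)

lemma negligible_err_W: "negligible (err n - (\<Union>Y\<in>{Y\<in>U. norm Y \<le> \<rho> n}. grad_region W Y))"
proof (rule negligible_subset[OF negligible_err_region[of n]], rule subsetI)
  fix x assume x: "x \<in> err n - (\<Union>Y\<in>{Y\<in>U. norm Y \<le> \<rho> n}. grad_region W Y)"
  then have "x \<in> R n" by (auto simp: err_def)
  then show "x \<in> err n - (\<Union>Y\<in>{Y\<in>U. norm Y \<le> \<rho> n} - {X (Suc n)}. grad_region (w (Suc n)) Y)"
    using x region_persists(2)[of x n] by blast
qed

lemma negligible_err_w:
  assumes "Suc k \<le> n"
  shows "negligible (err k - (\<Union>Y. grad_region (w n) Y \<inter> grad_region W Y))"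
proof (rule negligible_subset[OF negligible_err_region[of k]], rule subsetI)
  fix x assume x: "x \<in> err k - (\<Union>Y. grad_region (w n) Y \<inter> grad_region W Y)"
  then have "x \<in> R k" by (auto simp: err_def)
  then show "x \<in> err k - (\<Union>Y\<in>{Y\<in>U. norm Y \<le> \<rho> k} - {X (Suc k)}. grad_region (w (Suc k)) Y)"
    using x region_persists[of x k] assms by blast
qed

text \<open>
  Off \<open>R n\<close> the map \<open>w n\<close> already has the gradient of the limit.
\<close>

lemma negligible_cover_off: "negligible (\<Omega> - R n - (\<Union>Y. grad_region (w n) Y \<inter> grad_region W Y))"
proof (rule negligible_subset)
  show "negligible (\<Union>k\<in>{..<n}. err k - (\<Union>Y. grad_region (w n) Y \<inter> grad_region W Y))"
    by (rule negligible_countable_Union) (auto intro!: negligible_err_w)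
  show "\<Omega> - R n - (\<Union>Y. grad_region (w n) Y \<inter> grad_region W Y)
      \<subseteq> (\<Union>k\<in>{..<n}. err k - (\<Union>Y. grad_region (w n) Y \<inter> grad_region W Y))"
  proof
    fix x assume x: "x \<in> \<Omega> - R n - (\<Union>Y. grad_region (w n) Y \<inter> grad_region W Y)"
    have "x \<notin> P i" if "i \<in> I" "fst i < n" for i
      using P_grad(1)[OF that(1), of x] P_grad(2)[OF that(1), of x n] that x by auto
    then have "x \<notin> (\<Union>i\<in>{i\<in>I. fst i < n}. P i)" by blast
    moreover have "x \<in> (\<Union>i\<in>{i\<in>I. fst i < n}. P i) \<union> (\<Union>k<n. err k)"
      by (rule subsetD[OF cover_finite]) (use x in simp)
    ultimately obtain k where "k < n" "x \<in> err k" by blast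
    then show "x \<in> (\<Union>k\<in>{..<n}. err k - (\<Union>Y. grad_region (w n) Y \<inter> grad_region W Y))"
      using x by (intro UN_I[of k]) simp_all
  qed
qed

abbreviation V :: real where "V \<equiv> vol \<Omega>"

lemma V_pos: "0 < V"
proof -
  have "\<not> negligible \<Omega>" using open_not_negligible[OF \<Omega>_facts(1,3)] .
  then have "V \<noteq> 0" using \<Omega>_facts(4) by (simp add: negligible_iff_measure)
  then show ?thesis using measure_nonneg[of lebesgue \<Omega>] by linarith
qed

lemma card_S_ge_1: "1 \<le> card (S n)"
  using finS[of n] XS[of n] card_gt_0_iff[of "S n"] by fastforce

lemma e_le_card: "e n \<le> card (S n) * e n"
  using card_S_ge_1[of n] e_pos[of n] by (simp add: mult_le_cancel_right1)

lemma fractions: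
  shows "vol (err n) \<le> card (S n) * e n * vol (R n)"
    and "Y \<in> S n \<Longrightarrow> vol (P (n, Y)) \<le> (1 + 1 / 2 ^ (n + 2)) * c n Y * vol (R n)"
    and "Y \<in> S n \<Longrightarrow> (1 - 1 / 2 ^ (n + 2)) * c n Y * vol (R n) \<le> vol (P (n, Y))"
proof -
  note * = upper_of_lower_fractions[OF finS R_lmeasurable[of n], of n "grad_region (w (Suc n))" "c n" "e n"]
  have A: "grad_region (w (Suc n)) Y \<in> sets lebesgue" for Y by (intro open_imp_sets_lebesgue open_grad_region)
  have D: "grad_region (w (Suc n)) Y \<inter> grad_region (w (Suc n)) Z = {}" if "Y \<noteq> Z" for Y Z
    using grad_region_unique[of _ "w (Suc n)" Y Z] that by blast
  show "vol (err n) \<le> card (S n) * e n * vol (R n)"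
    unfolding err_def by (rule *(1)) (use A D sum_c e_pos[of n] low in auto)
  assume Y: "Y \<in> S n"
  have ce: "card (S n) * e n \<le> c n Y / 2 ^ (n + 2)" using e2 Y by (simp add: S_def)
  have "vol (P (n, Y)) \<le> (c n Y + card (S n) * e n) * vol (R n)"
    unfolding P_def fst_conv snd_conv by (rule *(2)) (use A D sum_c e_pos[of n] low Y in auto)
  also have "\<dots> \<le> ((1 + 1 / 2 ^ (n + 2)) * c n Y) * vol (R n)"
    using ce by (intro mult_right_mono) (auto simp: distrib_right)
  finally show "vol (P (n, Y)) \<le> (1 + 1 / 2 ^ (n + 2)) * c n Y * vol (R n)" .
  have "((1 - 1 / 2 ^ (n + 2)) * c n Y) * vol (R n) \<le> (c n Y - e n) * vol (R n)"
    using ce e_le_card[of n] by (intro mult_right_mono) (auto simp: left_diff_distrib)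
  also have "\<dots> \<le> vol (P (n, Y))" using low by (simp add: P_def)
  finally show "(1 - 1 / 2 ^ (n + 2)) * c n Y * vol (R n) \<le> vol (P (n, Y))" .
qed

text \<open>
  The relative error \<open>2\<^bsup>-n-2\<^esup>\<close> of block \<open>n\<close> is small enough for the factors \<open>1/2 + 2\<^bsup>-n-1\<^esup>\<close> and \<open>2 - 2\<^bsup>-n\<^esup>\<close> to
  pass from \<open>n\<close> to \<open>n + 1\<close>; this replaces infinite products.
\<close>

lemma measure_R_bounds:
  "(1 / 2 + 1 / 2 ^ (n + 1)) * \<beta> n * V \<le> vol (R n) \<and> vol (R n) \<le> (2 - 1 / 2 ^ n) * \<beta> n * V"
proof (induction n)
  case 0
  then show ?case by (simp add: R0 \<beta>0)
next
  case (Suc n)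
  define x :: real where "x = 1 / 2 ^ n"
  have x: "0 < x" "x \<le> 1" "1 / 2 ^ (n + 1) = x / 2" "1 / 2 ^ (n + 2) = x / 4" "1 / 2 ^ (Suc n + 1) = x / 4" "1 / 2 ^ Suc n = x / 2"
    by (auto simp: x_def)
  have RP: "R (Suc n) = P (n, X (Suc n))" by (simp add: P_def RSuc)
  define k where "k = c n (X (Suc n))"
  have k: "0 < k" using c_pos[OF XS] by (simp add: k_def)
  have bV: "0 \<le> \<beta> n * V" using \<beta>_pos[of n] V_pos by simp
  have xx: "x * x \<le> x" using x by (simp add: mult_left_le_one_le)
  have "vol (R (Suc n)) \<le> (1 + x / 4) * k * vol (R n)"
    unfolding RP k_def using fractions(2)[OF XS[of n]] unfolding x(4) .
  also have "\<dots> \<le> (1 + x / 4) * k * ((2 - x) * \<beta> n * V)"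
    using Suc k x unfolding x_def[symmetric] by (intro mult_left_mono) auto
  also have "\<dots> = ((1 + x / 4) * (2 - x)) * (k * (\<beta> n * V))" by simp
  also have "\<dots> \<le> (2 - x / 2) * (k * (\<beta> n * V))"
  proof (rule mult_right_mono)
    have "0 \<le> x * x" by simp
    then show "(1 + x / 4) * (2 - x) \<le> 2 - x / 2" by (simp add: algebra_simps)
    show "0 \<le> k * (\<beta> n * V)" using k bV by simp
  qed
  finally have up: "vol (R (Suc n)) \<le> (2 - x / 2) * \<beta> (Suc n) * V" by (simp add: \<beta>Suc k_def mult_ac)
  have "(1 / 2 + x / 4) * (k * (\<beta> n * V)) \<le> ((1 - x / 4) * (1 / 2 + x / 2)) * (k * (\<beta> n * V))"
  proof (rule mult_right_mono)
    have eq: "(1 - x / 4) * (1 / 2 + x / 2) = 1 / 2 + x / 4 + (x - x * x) / 8" by (simp add: field_simps)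
    show "1 / 2 + x / 4 \<le> (1 - x / 4) * (1 / 2 + x / 2)" unfolding eq using xx by simp
    show "0 \<le> k * (\<beta> n * V)" using k bV by simp
  qed
  also have "\<dots> = (1 - x / 4) * k * ((1 / 2 + x / 2) * \<beta> n * V)" by simp
  also have "\<dots> \<le> (1 - x / 4) * k * vol (R n)"
    using Suc k x unfolding x(3) by (intro mult_left_mono) auto
  also have "\<dots> \<le> vol (R (Suc n))"
    unfolding RP k_def using fractions(3)[OF XS[of n]] unfolding x(4) .
  finally have lo: "(1 / 2 + x / 4) * \<beta> (Suc n) * V \<le> vol (R (Suc n))" by (simp add: \<beta>Suc k_def mult_ac)
  show ?case unfolding x(5,6) using up lo by blast
qed

lemma measure_P:
  assumes "i \<in> I"
  shows "vol (P i) \<le> 2 * V * mass i" "1 / 2 * V * mass i \<le> vol (P i)"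
proof -
  obtain n Y where i: "i = (n, Y)" "Y \<in> T n" using assms by (auto simp: I_def)
  then have Y: "Y \<in> S n" by (simp add: T_def)
  have m: "mass i = \<beta> n * c n Y" using i by (simp add: mass_def)
  define x :: real where "x = 1 / 2 ^ n"
  have x: "0 < x" "x \<le> 1" "1 / 2 ^ (n + 1) = x / 2" "1 / 2 ^ (n + 2) = x / 4" by (auto simp: x_def)
  have cV: "0 \<le> c n Y * (\<beta> n * V)" "0 < c n Y" using \<beta>_pos[of n] V_pos c_pos[OF Y] by auto
  have xx: "x * x \<le> x" using x by (simp add: mult_left_le_one_le)
  have "vol (P i) \<le> (1 + x / 4) * c n Y * vol (R n)"
    using fractions(2)[OF Y] unfolding i x(4) .
  also have "\<dots> \<le> (1 + x / 4) * c n Y * ((2 - x) * \<beta> n * V)"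
    using measure_R_bounds[of n] cV x unfolding x_def[symmetric] by (intro mult_left_mono) auto
  also have "\<dots> = ((1 + x / 4) * (2 - x)) * (c n Y * (\<beta> n * V))" by simp
  also have "\<dots> \<le> 2 * (c n Y * (\<beta> n * V))"
  proof (rule mult_right_mono[OF _ cV(1)])
    have "0 \<le> x * x" by simp
    then show "(1 + x / 4) * (2 - x) \<le> 2" using x by (simp add: algebra_simps)
  qed
  finally show "vol (P i) \<le> 2 * V * mass i" by (simp add: m mult_ac)
  have "1 / 2 * (c n Y * (\<beta> n * V)) \<le> ((1 - x / 4) * (1 / 2 + x / 2)) * (c n Y * (\<beta> n * V))"
  proof (rule mult_right_mono[OF _ cV(1)])
    have eq: "(1 - x / 4) * (1 / 2 + x / 2) = 1 / 2 + x / 4 + (x - x * x) / 8" by (simp add: field_simps)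
    show "1 / 2 \<le> (1 - x / 4) * (1 / 2 + x / 2)" unfolding eq using xx x by simp
  qed
  also have "\<dots> = (1 - x / 4) * c n Y * ((1 / 2 + x / 2) * \<beta> n * V)" by simp
  also have "\<dots> \<le> (1 - x / 4) * c n Y * vol (R n)"
    using measure_R_bounds[of n] cV x unfolding x(3) by (intro mult_left_mono) auto
  also have "\<dots> \<le> vol (P i)"
    using fractions(3)[OF Y] unfolding i x(4) .
  finally show "1 / 2 * V * mass i \<le> vol (P i)" by (simp add: m mult_ac)
qed

lemma measure_R_le: "vol (R n) \<le> 2 * \<beta> n * V" "vol (R n) \<le> V"
proof -
  have "(2 - 1 / 2 ^ n) * (\<beta> n * V) \<le> 2 * (\<beta> n * V)"
    using \<beta>_pos[of n] V_pos by (intro mult_right_mono) auto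
  then show "vol (R n) \<le> 2 * \<beta> n * V" using measure_R_bounds[of n] by (simp add: mult.assoc)
  show "vol (R n) \<le> V"
    by (rule measure_mono_fmeasurable[OF R_subset _ \<Omega>_facts(4)]) (use R_lmeasurable in blast)
qed

lemma negligible_Inter_R: "negligible (\<Inter>n. R n)"
proof -
  have m: "(\<Inter>n. R n) \<in> lmeasurable"
    by (rule fmeasurableI2[OF R_lmeasurable[of 0]]) (use oR in \<open>auto intro!: open_imp_sets_lebesgue\<close>)
  have "vol (\<Inter>n. R n) \<le> 2 * \<beta> n * V" for n
    using measure_mono_fmeasurable[of "\<Inter>n. R n" "R n" lebesgue] m R_lmeasurable measure_R_le(1)[of n] by fastforce
  moreover have "(\<lambda>n. 2 * \<beta> n * V) \<longlonglongrightarrow> 2 * 0 * V" by (intro tendsto_intros \<beta>lim)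
  ultimately have "vol (\<Inter>n. R n) \<le> 2 * 0 * V" by (intro LIMSEQ_le_const) auto
  then have "vol (\<Inter>n. R n) = 0" by (intro antisym measure_nonneg) simp
  then show ?thesis using m unfolding negligible_iff_measure by blast
qed

text \<open>
  Summed over \<open>n\<close>, the right-hand side gives \<open>\<delta> V\<close>.
\<close>

lemma measure_err: "vol (err n) * (1 + \<rho> n) powr r \<le> \<delta> * V * (1 / 2) ^ Suc n"
proof -
  have "card (S n) * e n * vol (R n) \<le> card (S n) * e n * V"
    using measure_R_le(2)[of n] e_pos[of n] by (intro mult_left_mono) auto
  then have "vol (err n) * (1 + \<rho> n) powr r \<le> (card (S n) * e n * V) * (1 + \<rho> n) powr r"
    using fractions(1)[of n] by (intro mult_right_mono) auto
  also have "\<dots> = (card (S n) * e n * (1 + \<rho> n) powr r) * V" by simp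
  also have "\<dots> \<le> (\<delta> * (1 / 2) ^ Suc n) * V" using e3[of n] V_pos by (intro mult_right_mono) (auto simp: S_def)
  finally show ?thesis by (simp add: mult_ac)
qed

lemma negligible_W: "negligible (\<Omega> - (\<Union>Y. grad_region W Y))"
proof (rule negligible_subset)
  show "negligible ((\<Union>n. err n - (\<Union>Y\<in>{Y\<in>U. norm Y \<le> \<rho> n}. grad_region W Y)) \<union> (\<Inter>n. R n))"
    by (intro negligible_Un negligible_Inter_R negligible_countable_Union) (auto intro: negligible_err_W)
  show "\<Omega> - (\<Union>Y. grad_region W Y) \<subseteq> (\<Union>n. err n - (\<Union>Y\<in>{Y\<in>U. norm Y \<le> \<rho> n}. grad_region W Y)) \<union> (\<Inter>n. R n)"
  proof
    fix x assume x: "x \<in> \<Omega> - (\<Union>Y. grad_region W Y)"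
    then have "x \<notin> (\<Union>i\<in>I. P i)" using P_grad(1)[of _ x] by auto
    moreover have "x \<in> (\<Union>i\<in>I. P i) \<union> (\<Union>n. err n) \<union> (\<Inter>n. R n)"
      by (rule subsetD[OF cover]) (use x in simp)
    ultimately consider n where "x \<in> err n" | "x \<in> (\<Inter>n. R n)" by blast
    then show "x \<in> (\<Union>n. err n - (\<Union>Y\<in>{Y\<in>U. norm Y \<le> \<rho> n}. grad_region W Y)) \<union> (\<Inter>n. R n)"
    proof cases
      case (1 n)
      then have "x \<in> err n - (\<Union>Y\<in>{Y\<in>U. norm Y \<le> \<rho> n}. grad_region W Y)" using x by auto
      then show ?thesis by blast
    qed simp
  qed
qed

lemma negligible_w: "negligible (\<Omega> - (\<Union>Y. grad_region (w n) Y))"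
  by (rule negligible_subset[OF negligible_cover_off[of n]]) (use Rgrad in blast)

end

section \<open>The distribution of the gradient\<close>

lemma suminf_half_powers:
  assumes "0 \<le> (a::real)"
  shows "(\<Sum>n. ennreal (a * (1 / 2) ^ Suc n)) = ennreal a"
proof -
  have "(\<lambda>n. a * (1 / 2) ^ Suc n) sums (a * 1)" by (intro sums_mult power_half_series)
  then show ?thesis using assms by (subst suminf_ennreal2) (auto simp: sums_iff)
qed

lemma borel_measurable_nn_integral_count_space:
  fixes f :: "'i \<Rightarrow> 'a \<Rightarrow> ennreal"
  assumes "countable J" and f: "\<And>i. i \<in> J \<Longrightarrow> f i \<in> borel_measurable M"
  shows "(\<lambda>x. \<integral>\<^sup>+i. f i x \<partial>count_space J) \<in> borel_measurable M"
proof (cases "finite J")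
  case True
  then show ?thesis using f by (simp add: nn_integral_count_space_finite borel_measurable_sum)
next
  case False
  then have J: "bij_betw (from_nat_into J) UNIV J" using assms(1) by (intro bij_betw_from_nat_into)
  then have J': "from_nat_into J n \<in> J" for n by (auto simp: bij_betw_def)
  have "(\<integral>\<^sup>+i. f i x \<partial>count_space J) = (\<Sum>n. f (from_nat_into J n) x)" for x
    by (simp add: nn_integral_bij_count_space[OF J, symmetric] nn_integral_count_space_nat)
  then show ?thesis using f[OF J'] by (simp add: borel_measurable_suminf_order)
qed

context staircase_realization
begin

abbreviation G :: "real^'m \<Rightarrow> real^'m^'d" where "G \<equiv> gradient_map W"

text \<open>
  The null set of points without a gradient to account for: those where an error has no gradient in
  the bounded part of \<open>U\<close>, and those that stay in all \<open>R n\<close>.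
\<close>

definition Z :: "(real^'m) set" where
  "Z = (\<Union>n. err n - (\<Union>Y\<in>{Y\<in>U. norm Y \<le> \<rho> n}. grad_region W Y)) \<union> (\<Inter>n. R n)"

lemma negligible_Z: "negligible Z"
  unfolding Z_def by (intro negligible_Un negligible_Inter_R negligible_countable_Union) (auto intro: negligible_err_W)

lemma AE_not_Z: "AE x in lebesgue. x \<notin> Z"
  by (rule AE_not_in) (use negligible_Z in \<open>simp add: negligible_iff_null_sets\<close>)

lemma G_P: "i \<in> I \<Longrightarrow> x \<in> P i \<Longrightarrow> G x = snd i"
  using P_grad(1) gradient_map_eq by blast

lemma I_K: "i \<in> I \<Longrightarrow> snd i \<in> K"
  using TK[of "fst i"] by (auto simp: I_def)

lemma gradient_cases:
  assumes "x \<in> \<Omega>" "x \<notin> Z"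
  obtains i where "i \<in> I" "x \<in> P i" "G x = snd i" | n where "x \<in> err n" "G x \<in> U" "norm (G x) \<le> \<rho> n"
proof -
  have "x \<in> (\<Union>i\<in>I. P i) \<union> (\<Union>n. err n) \<union> (\<Inter>n. R n)" by (rule subsetD[OF cover assms(1)])
  then consider i where "i \<in> I" "x \<in> P i" | n where "x \<in> err n" using assms(2) unfolding Z_def by blast
  then show thesis
  proof cases
    case (1 i)
    then show thesis using that(1) G_P by blast
  next
    case (2 n)
    then obtain Y where "Y \<in> U" "norm Y \<le> \<rho> n" "x \<in> grad_region W Y" using assms(2) unfolding Z_def by blast
    then show thesis using that(2)[of n] 2 gradient_map_eq by blast
  qed
qed

lemma G_measurable: "(\<lambda>x. indicator \<Omega> x *\<^sub>R G x) \<in> borel_measurable lebesgue"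
  and G_sets: "{x\<in>\<Omega>. G x \<in> E} \<in> sets lebesgue"
  by (rule lebesgue_measurable_piecewise[where W = "grad_region W" and I = UNIV and c = "\<lambda>Y. Y"];
      use \<Omega>_facts negligible_W open_grad_region gradient_map_eq open_imp_sets_lebesgue in blast)+

lemma P_union_emeasure: "emeasure lebesgue (\<Union>i\<in>{i\<in>I. snd i \<in> E}. P i) = (\<integral>\<^sup>+i. emeasure lebesgue (P i) * indicator {i\<in>I. snd i \<in> E} i \<partial>count_space UNIV)"
proof -
  have "emeasure lebesgue (\<Union>i\<in>{i\<in>I. snd i \<in> E}. P i) = (\<integral>\<^sup>+i. emeasure lebesgue (P i) \<partial>count_space {i\<in>I. snd i \<in> E})"
    using countable_I disjoint_P P_sets
    by (intro emeasure_UN_countable) (auto simp: disjoint_family_on_def intro: countable_subset)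
  then show ?thesis by (simp add: nn_integral_count_space_indicator)
qed

lemma \<nu>_emeasure: "E \<in> sets borel \<Longrightarrow> emeasure \<nu> E = (\<integral>\<^sup>+i. ennreal (mass i) * indicator {i\<in>I. snd i \<in> E} i \<partial>count_space UNIV)"
proof -
  assume E: "E \<in> sets borel"
  have "sets \<nu> = sets borel" using \<nu>(1) by (simp add: borel_prob_def)
  then have "emeasure \<nu> E = (\<integral>\<^sup>+Y. indicator E Y \<partial>\<nu>)" using E by simp
  also have "\<dots> = (\<integral>\<^sup>+i. ennreal (mass i) * indicator E (snd i) \<partial>count_space UNIV)"
    by (rule nn_integral_\<nu>) (use E in simp)
  also have "\<dots> = (\<integral>\<^sup>+i. ennreal (mass i) * indicator {i\<in>I. snd i \<in> E} i \<partial>count_space UNIV)"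
    by (intro nn_integral_cong) (auto simp: mass_def I_def indicator_def)
  finally show ?thesis .
qed

lemma emeasure_P:
  assumes "i \<in> I"
  shows "emeasure lebesgue (P i) \<le> ennreal (2 * V) * ennreal (mass i)" "ennreal (1 / 2 * V) * ennreal (mass i) \<le> emeasure lebesgue (P i)"
  using measure_P[OF assms] V_pos mass_nonneg[of i]
  by (auto simp: emeasure_eq_measure2[OF P_lmeasurable] ennreal_mult'[symmetric] ennreal_mult[symmetric] intro!: ennreal_leI)

text \<open>
  The regions \<open>P i\<close> are disjoint, and the volume of \<open>P i\<close> is at most \<open>2V\<close> times the mass of \<open>i\<close>.
\<close>

lemma good_upper:
  assumes "E \<in> sets borel"
  shows "emeasure lebesgue (\<Union>i\<in>{i\<in>I. snd i \<in> E}. P i) \<le> ennreal (2 * V) * emeasure \<nu> E"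
proof -
  have "emeasure lebesgue (\<Union>i\<in>{i\<in>I. snd i \<in> E}. P i)
      \<le> (\<integral>\<^sup>+i. ennreal (2 * V) * (ennreal (mass i) * indicator {i\<in>I. snd i \<in> E} i) \<partial>count_space UNIV)"
    unfolding P_union_emeasure by (intro nn_integral_mono) (auto simp: indicator_def emeasure_P)
  also have "\<dots> = ennreal (2 * V) * emeasure \<nu> E" unfolding \<nu>_emeasure[OF assms] by (rule nn_integral_cmult) simp
  finally show ?thesis .
qed

lemma good_lower:
  assumes "E \<in> sets borel"
  shows "ennreal (1 / 2 * V) * emeasure \<nu> E \<le> emeasure lebesgue (\<Union>i\<in>{i\<in>I. snd i \<in> E}. P i)"
proof -
  have "ennreal (1 / 2 * V) * emeasure \<nu> E
      = (\<integral>\<^sup>+i. ennreal (1 / 2 * V) * (ennreal (mass i) * indicator {i\<in>I. snd i \<in> E} i) \<partial>count_space UNIV)"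
    unfolding \<nu>_emeasure[OF assms] by (rule nn_integral_cmult[symmetric]) simp
  also have "\<dots> \<le> emeasure lebesgue (\<Union>i\<in>{i\<in>I. snd i \<in> E}. P i)"
    unfolding P_union_emeasure by (intro nn_integral_mono) (use emeasure_P(2) in \<open>auto simp: indicator_def\<close>)
  finally show ?thesis .
qed

lemma err_weighted: "ennreal ((1 + \<rho> n) powr r) * emeasure lebesgue (err n) \<le> ennreal (\<delta> * V * (1 / 2) ^ Suc n)"
  using measure_err[of n]
  by (simp add: emeasure_eq_measure2[OF err_lmeasurable] ennreal_mult'[symmetric] ennreal_leI mult.commute)

lemma err_indicator_measurable: "(\<lambda>x. ennreal ((1 + \<rho> n) powr r) * indicator (err n) x) \<in> borel_measurable lebesgue"
  by (intro borel_measurable_times_ennreal borel_measurable_const borel_measurable_indicator err_sets)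

lemma err_integral: "(\<integral>\<^sup>+x. (\<Sum>n. ennreal ((1 + \<rho> n) powr r) * indicator (err n) x) \<partial>lebesgue) \<le> ennreal (\<delta> * V)"
proof -
  have "(\<integral>\<^sup>+x. (\<Sum>n. ennreal ((1 + \<rho> n) powr r) * indicator (err n) x) \<partial>lebesgue)
      = (\<Sum>n. \<integral>\<^sup>+x. ennreal ((1 + \<rho> n) powr r) * indicator (err n) x \<partial>lebesgue)"
    by (rule nn_integral_suminf[OF err_indicator_measurable])
  also have "\<dots> = (\<Sum>n. ennreal ((1 + \<rho> n) powr r) * emeasure lebesgue (err n))"
    using err_sets by (simp add: nn_integral_cmult_indicator)
  also have "\<dots> \<le> (\<Sum>n. ennreal (\<delta> * V * (1 / 2) ^ Suc n))" by (intro suminf_le err_weighted) auto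
  also have "\<dots> = ennreal (\<delta> * V)" using \<delta> V_pos by (intro suminf_half_powers) auto
  finally show ?thesis .
qed

lemma err_term: "x \<in> err n \<Longrightarrow> ennreal ((1 + \<rho> n) powr r) \<le> (\<Sum>n. ennreal ((1 + \<rho> n) powr r) * indicator (err n) x)"
  using sum_le_suminf[of "\<lambda>n. ennreal ((1 + \<rho> n) powr r) * indicator (err n) x" "{n}"] by simp

text \<open>
  Points with gradient outside \<open>K\<close> lie in the error sets, where the gradient is bounded by \<open>\<rho> n\<close>.
\<close>

lemma error_integral:
  assumes "0 \<le> q" "q \<le> r"
  shows "(\<integral>\<^sup>+ x\<in>error_set K \<Omega> G. ennreal ((1 + norm (G x)) powr q) \<partial>lebesgue) \<le> ennreal (\<delta> * V)"
proof -
  have "(\<integral>\<^sup>+ x\<in>error_set K \<Omega> G. ennreal ((1 + norm (G x)) powr q) \<partial>lebesgue)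
     \<le> (\<integral>\<^sup>+x. (\<Sum>n. ennreal ((1 + \<rho> n) powr r) * indicator (err n) x) \<partial>lebesgue)"
  proof (rule nn_integral_mono_AE)
    show "AE x in lebesgue. ennreal ((1 + norm (G x)) powr q) * indicator (error_set K \<Omega> G) x
        \<le> (\<Sum>n. ennreal ((1 + \<rho> n) powr r) * indicator (err n) x)"
      using AE_not_Z
    proof eventually_elim
      case (elim x)
      show ?case
      proof (cases "x \<in> error_set K \<Omega> G")
        case True
        then have x: "x \<in> \<Omega>" "G x \<notin> K" by (auto simp: error_set_def)
        show ?thesis
        proof (rule gradient_cases[OF x(1) elim])
          fix i assume "i \<in> I" "x \<in> P i" "G x = snd i"
          then have "G x \<in> K" using I_K by simp
          then show ?thesis using x by simp
        next
          fix n assume n: "x \<in> err n" "G x \<in> U" "norm (G x) \<le> \<rho> n"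
          have "(1 + norm (G x)) powr q \<le> (1 + \<rho> n) powr q" using n assms by (intro powr_mono2) auto
          also have "\<dots> \<le> (1 + \<rho> n) powr r" using assms \<rho>[of n] by (intro powr_mono) auto
          finally have "ennreal ((1 + norm (G x)) powr q) \<le> ennreal ((1 + \<rho> n) powr r)" by (rule ennreal_leI)
          also have "\<dots> \<le> (\<Sum>n. ennreal ((1 + \<rho> n) powr r) * indicator (err n) x)" by (rule err_term[OF n(1)])
          finally show ?thesis using True by simp
        qed
      qed simp
    qed
  qed
  also note err_integral
  finally show ?thesis .
qed

lemma error_gradient: "AE x in lebesgue. x \<in> error_set K \<Omega> G \<longrightarrow> G x \<in> U"
  using AE_not_Z
proof eventually_elim
  case (elim x)
  show ?case
  proof
    assume "x \<in> error_set K \<Omega> G"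
    then have x: "x \<in> \<Omega>" "G x \<notin> K" by (auto simp: error_set_def)
    show "G x \<in> U"
    proof (rule gradient_cases[OF x(1) elim])
      fix i assume "i \<in> I" "x \<in> P i" "G x = snd i"
      then have "G x \<in> K" using I_K by simp
      then show ?thesis using x by simp
    qed
  qed
qed

lemma tail_set: "{X :: real^'m^'d. t < norm X} \<in> sets borel"
  by (intro borel_open open_Collect_less continuous_intros)

lemma \<nu>_measure: "emeasure \<nu> E = ennreal (measure \<nu> E)"
proof -
  interpret prob_space \<nu> using \<nu>(1) by (simp add: borel_prob_def)
  show ?thesis by (rule emeasure_eq_measure)
qed

lemma tail_sets: "{x\<in>\<Omega>. t < norm (G x)} \<in> sets lebesgue" "{x\<in>\<Omega>. t < norm (G x)} \<in> lmeasurable"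
proof -
  show "{x\<in>\<Omega>. t < norm (G x)} \<in> sets lebesgue" using G_sets[of "{X. t < norm X}"] by simp
  then show "{x\<in>\<Omega>. t < norm (G x)} \<in> lmeasurable" by (intro fmeasurableI2[OF \<Omega>_facts(4)]) auto
qed

text \<open>
  The regions of the atoms contribute at most \<open>2V\<close> times the tail of \<open>\<nu>\<close>; the error sets are treated with
  the Chebyshev inequality.
\<close>

lemma tail_upper:
  assumes t: "0 < t" and p: "0 \<le> p" "p \<le> r"
  shows "vol {x\<in>\<Omega>. norm (G x) > t} \<le> 2 * V * measure \<nu> {X. norm X > t} + \<delta> * V * t powr (- p)"
proof -
  let ?A = "\<Union>i\<in>{i\<in>I. snd i \<in> {X. t < norm X}}. P i"
  let ?N = "\<lambda>n. if t < \<rho> n then err n else {}"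
  have A: "?A \<in> sets lebesgue" by (intro open_imp_sets_lebesgue open_UN ballI open_P)
  have N: "?N n \<in> sets lebesgue" for n using err_sets by simp
  have UN: "(\<Union>n. ?N n) \<in> sets lebesgue" by (rule sets.countable_nat_UN) (use N in blast)
  have Zs: "Z \<in> null_sets lebesgue" using negligible_Z by (simp add: negligible_iff_null_sets)
  have sub: "{x\<in>\<Omega>. t < norm (G x)} \<subseteq> (?A \<union> (\<Union>n. ?N n)) \<union> Z"
  proof
    fix x assume x: "x \<in> {x\<in>\<Omega>. t < norm (G x)}"
    show "x \<in> (?A \<union> (\<Union>n. ?N n)) \<union> Z"
    proof (cases "x \<in> Z")
      case False
      have "x \<in> \<Omega>" using x by simp
      show ?thesis
      proof (rule gradient_cases[OF \<open>x \<in> \<Omega>\<close> False])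
        fix i assume i: "i \<in> I" "x \<in> P i" "G x = snd i"
        then have "i \<in> {i\<in>I. snd i \<in> {X. t < norm X}}" using x by simp
        then show ?thesis using i(2) by blast
      next
        fix n assume "x \<in> err n" "G x \<in> U" "norm (G x) \<le> \<rho> n"
        then have "x \<in> ?N n" using x by auto
        then show ?thesis by blast
      qed
    qed simp
  qed
  have Nb: "emeasure lebesgue (?N n) \<le> ennreal (\<delta> * V * t powr (- p) * (1 / 2) ^ Suc n)" for n
  proof (cases "t < \<rho> n")
    case True
    have "t powr p \<le> (1 + \<rho> n) powr p" using True t p by (intro powr_mono2) auto
    also have "\<dots> \<le> (1 + \<rho> n) powr r" using p \<rho>[of n] by (intro powr_mono) auto
    finally have "1 \<le> (1 + \<rho> n) powr r * t powr (- p)" using t by (simp add: powr_minus field_simps)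
    then have "vol (err n) * 1 \<le> vol (err n) * ((1 + \<rho> n) powr r * t powr (- p))"
      by (intro mult_left_mono) auto
    also have "\<dots> = (vol (err n) * (1 + \<rho> n) powr r) * t powr (- p)" by simp
    also have "\<dots> \<le> (\<delta> * V * (1 / 2) ^ Suc n) * t powr (- p)" by (intro mult_right_mono measure_err) auto
    finally have "vol (err n) \<le> \<delta> * V * t powr (- p) * (1 / 2) ^ Suc n" by (simp add: mult_ac)
    then show ?thesis using True by (simp add: emeasure_eq_measure2[OF err_lmeasurable] ennreal_leI)
  qed simp
  have "emeasure lebesgue {x\<in>\<Omega>. t < norm (G x)} \<le> emeasure lebesgue ((?A \<union> (\<Union>n. ?N n)) \<union> Z)"
    by (rule emeasure_mono[OF sub]) (intro sets.Un A UN null_setsD2[OF Zs])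
  also have "\<dots> = emeasure lebesgue (?A \<union> (\<Union>n. ?N n))"
    by (rule emeasure_Un_null_set[OF _ Zs]) (intro sets.Un A UN)
  also have "\<dots> \<le> emeasure lebesgue ?A + emeasure lebesgue (\<Union>n. ?N n)"
    by (rule emeasure_subadditive[OF A UN])
  also have "\<dots> \<le> ennreal (2 * V) * emeasure \<nu> {X. t < norm X} + (\<Sum>n. ennreal (\<delta> * V * t powr (- p) * (1 / 2) ^ Suc n))"
  proof (rule add_mono)
    show "emeasure lebesgue ?A \<le> ennreal (2 * V) * emeasure \<nu> {X. t < norm X}" by (rule good_upper[OF tail_set])
    have "emeasure lebesgue (\<Union>n. ?N n) \<le> (\<Sum>n. emeasure lebesgue (?N n))"
      by (rule emeasure_subadditive_countably) (use N in blast)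
    also have "\<dots> \<le> (\<Sum>n. ennreal (\<delta> * V * t powr (- p) * (1 / 2) ^ Suc n))" by (intro suminf_le Nb) auto
    finally show "emeasure lebesgue (\<Union>n. ?N n) \<le> (\<Sum>n. ennreal (\<delta> * V * t powr (- p) * (1 / 2) ^ Suc n))" .
  qed
  also have "(\<Sum>n. ennreal (\<delta> * V * t powr (- p) * (1 / 2) ^ Suc n)) = ennreal (\<delta> * V * t powr (- p))"
    using \<delta> V_pos by (intro suminf_half_powers) auto
  also have "ennreal (2 * V) * emeasure \<nu> {X. t < norm X} + ennreal (\<delta> * V * t powr (- p))
      = ennreal (2 * V * measure \<nu> {X. t < norm X} + \<delta> * V * t powr (- p))"
    using \<delta> V_pos by (simp add: \<nu>_measure ennreal_mult'[symmetric])
  finally have "ennreal (vol {x\<in>\<Omega>. t < norm (G x)}) \<le> ennreal (2 * V * measure \<nu> {X. t < norm X} + \<delta> * V * t powr (- p))"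
    by (simp add: emeasure_eq_measure2[OF tail_sets(2)])
  then show ?thesis using \<delta> V_pos by (subst (asm) ennreal_le_iff) auto
qed

lemma tail_lower: "1 / 2 * V * measure \<nu> {X. norm X > t} \<le> vol {x\<in>\<Omega>. norm (G x) > t}"
proof -
  let ?A = "\<Union>i\<in>{i\<in>I. snd i \<in> {X. t < norm X}}. P i"
  have "?A \<subseteq> {x\<in>\<Omega>. t < norm (G x)}"
  proof
    fix x assume "x \<in> ?A"
    then obtain i where "i \<in> I" "x \<in> P i" "t < norm (snd i)" by blast
    then show "x \<in> {x\<in>\<Omega>. t < norm (G x)}" using G_P[of i x] P_subset[of i] by auto
  qed
  then have "emeasure lebesgue ?A \<le> emeasure lebesgue {x\<in>\<Omega>. t < norm (G x)}"
    by (rule emeasure_mono[OF _ tail_sets(1)])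
  with good_lower[OF tail_set[of t]]
  have "ennreal (1 / 2 * V) * emeasure \<nu> {X. t < norm X} \<le> emeasure lebesgue {x\<in>\<Omega>. t < norm (G x)}" by (rule order_trans)
  then have "ennreal (1 / 2 * V * measure \<nu> {X. t < norm X}) \<le> ennreal (vol {x\<in>\<Omega>. t < norm (G x)})"
    using V_pos by (simp add: \<nu>_measure emeasure_eq_measure2[OF tail_sets(2)] ennreal_mult'[symmetric])
  then show ?thesis by (subst (asm) ennreal_le_iff) auto
qed

text \<open>
  On the regions of the atoms this is the integrability of the identity with respect to \<open>\<nu>\<close>.
\<close>

lemma G_integrable: "set_integrable lebesgue \<Omega> G"
  unfolding set_integrable_def
proof (rule integrableI_bounded[OF G_measurable])
  let ?g = "\<lambda>x. (\<integral>\<^sup>+i. ennreal (norm (snd i)) * indicator (P i) x \<partial>count_space I)"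
  let ?h = "\<lambda>x. \<Sum>n. ennreal ((1 + \<rho> n) powr r) * indicator (err n) x"
  have gm: "?g \<in> borel_measurable lebesgue"
    using countable_I P_sets by (intro borel_measurable_nn_integral_count_space) auto
  have hm: "?h \<in> borel_measurable lebesgue" by (rule borel_measurable_suminf_order[OF err_indicator_measurable])
  have "(\<integral>\<^sup>+x. ennreal (norm (indicator \<Omega> x *\<^sub>R G x)) \<partial>lebesgue) \<le> (\<integral>\<^sup>+x. ?g x + ?h x \<partial>lebesgue)"
  proof (rule nn_integral_mono_AE)
    show "AE x in lebesgue. ennreal (norm (indicator \<Omega> x *\<^sub>R G x)) \<le> ?g x + ?h x"
      using AE_not_Z
    proof eventually_elim
      case (elim x)
      show ?case
      proof (cases "x \<in> \<Omega>")
        case True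
        show ?thesis
        proof (rule gradient_cases[OF True elim])
          fix i assume i: "i \<in> I" "x \<in> P i" "G x = snd i"
          have "ennreal (norm (snd i)) * indicator (P i) x \<le> ?g x" by (rule nn_integral_ge_point[OF i(1)])
          then show ?thesis using i True by (simp add: add_increasing2)
        next
          fix n assume n: "x \<in> err n" "G x \<in> U" "norm (G x) \<le> \<rho> n"
          have "norm (G x) \<le> (1 + \<rho> n) powr 1" using n(3) \<rho>[of n] by simp
          also have "\<dots> \<le> (1 + \<rho> n) powr r" using \<rho>[of n] r by (intro powr_mono) auto
          finally have "ennreal (norm (G x)) \<le> ennreal ((1 + \<rho> n) powr r)" by (rule ennreal_leI)
          also have "\<dots> \<le> ?h x" by (rule err_term[OF n(1)])
          finally show ?thesis using True by (simp add: add_increasing)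
        qed
      qed simp
    qed
  qed
  also have "\<dots> = (\<integral>\<^sup>+x. ?g x \<partial>lebesgue) + (\<integral>\<^sup>+x. ?h x \<partial>lebesgue)" by (rule nn_integral_add[OF gm hm])
  also have "(\<integral>\<^sup>+x. ?g x \<partial>lebesgue) = (\<integral>\<^sup>+i. \<integral>\<^sup>+x. ennreal (norm (snd i)) * indicator (P i) x \<partial>lebesgue \<partial>count_space I)"
    using P_sets by (intro nn_integral_count_space_nn_integral countable_I) auto
  also have "\<dots> = (\<integral>\<^sup>+i. ennreal (norm (snd i)) * emeasure lebesgue (P i) \<partial>count_space I)"
    using P_sets by (simp add: nn_integral_cmult_indicator)
  also have "\<dots> = (\<integral>\<^sup>+i. ennreal (norm (snd i)) * emeasure lebesgue (P i) * indicator I i \<partial>count_space UNIV)"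
    by (simp add: nn_integral_count_space_indicator)
  also have "\<dots> \<le> (\<integral>\<^sup>+i. ennreal (2 * V) * (ennreal (mass i) * ennreal (norm (snd i))) \<partial>count_space UNIV)"
  proof (rule nn_integral_mono)
    fix i :: "nat \<times> (real^'m^'d)"
    show "ennreal (norm (snd i)) * emeasure lebesgue (P i) * indicator I i \<le> ennreal (2 * V) * (ennreal (mass i) * ennreal (norm (snd i)))"
    proof (cases "i \<in> I")
      case True
      then have "ennreal (norm (snd i)) * emeasure lebesgue (P i) \<le> ennreal (norm (snd i)) * (ennreal (2 * V) * ennreal (mass i))"
        by (intro mult_left_mono emeasure_P) auto
      then show ?thesis using True by (simp add: mult_ac)
    qed simp
  qed
  also have "\<dots> = ennreal (2 * V) * (\<integral>\<^sup>+i. ennreal (mass i) * ennreal (norm (snd i)) \<partial>count_space UNIV)"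
    by (rule nn_integral_cmult) simp
  also have "(\<integral>\<^sup>+i. ennreal (mass i) * ennreal (norm (snd i)) \<partial>count_space UNIV) = (\<integral>\<^sup>+Y. ennreal (norm Y) \<partial>\<nu>)"
    by (rule nn_integral_\<nu>[symmetric]) simp
  also have "ennreal (2 * V) * (\<integral>\<^sup>+Y. ennreal (norm Y) \<partial>\<nu>) + (\<integral>\<^sup>+x. ?h x \<partial>lebesgue) < \<infinity>"
  proof -
    have "(\<integral>\<^sup>+Y. ennreal (norm Y) \<partial>\<nu>) < \<infinity>"
      using \<nu>(2) by (auto simp: has_barycenter_def integrable_iff_bounded)
    moreover have "(\<integral>\<^sup>+x. ?h x \<partial>lebesgue) < \<infinity>" using err_integral by (rule order.strict_trans1) simp
    ultimately show ?thesis by (simp add: ennreal_mult_less_top)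
  qed
  finally show "(\<integral>\<^sup>+x. ennreal (norm (indicator \<Omega> x *\<^sub>R G x)) \<partial>lebesgue) < \<infinity>" by (simp add: add_right_mono)
qed

end

section \<open>The limit map\<close>

context staircase_realization
begin

lemma W11_w: "W11_gradient \<Omega> (w n) (gradient_map (w n))"
  by (rule W11_gradient_lipschitz[OF \<Omega>_facts(1,2) lip negligible_w gradient_map_eq gradient_map_eq_0])

lemma w_integrable: "set_integrable lebesgue \<Omega> (w n)" "set_integrable lebesgue \<Omega> (gradient_map (w n))"
  using W11_w[of n] by (auto simp: W11_gradient_def)

lemma W_integrable: "set_integrable lebesgue \<Omega> W"
proof -
  have m: "(\<lambda>x. indicator \<Omega> x *\<^sub>R (W x - w 0 x)) \<in> borel_measurable lebesgue"
  proof (rule borel_measurable_LIMSEQ_metric)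
    show "(\<lambda>x. indicator \<Omega> x *\<^sub>R (w n x - w 0 x)) \<in> borel_measurable lebesgue" for n
      using set_integral_diff(1)[OF w_integrable(1)[of n] w_integrable(1)[of 0]]
      unfolding set_integrable_def by (rule borel_measurable_integrable)
    show "(\<lambda>n. indicator \<Omega> x *\<^sub>R (w n x - w 0 x)) \<longlonglongrightarrow> indicator \<Omega> x *\<^sub>R (W x - w 0 x)" for x
      by (intro tendsto_intros w_lim)
  qed
  have "set_integrable lebesgue \<Omega> (\<lambda>x. W x - w 0 x)"
    by (rule set_integrable_bounded[OF \<Omega>_facts(4) m W_close])
  then have "set_integrable lebesgue \<Omega> (\<lambda>x. (W x - w 0 x) + w 0 x)"
    by (intro set_integral_add w_integrable)
  then show ?thesis by simp
qed

lemma w_L1_limit: "(\<lambda>n. LINT x:\<Omega>|lebesgue. norm (w n x - W x)) \<longlonglongrightarrow> 0"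
proof (rule Lim_null_comparison[OF always_eventually], rule allI)
  fix n
  have "0 \<le> (LINT x:\<Omega>|lebesgue. norm (w n x - W x))"
    unfolding set_lebesgue_integral_def by (intro Bochner_Integration.integral_nonneg) auto
  moreover have "(LINT x:\<Omega>|lebesgue. norm (w n x - W x)) \<le> (LINT x:\<Omega>|lebesgue. (1 / 2 ^ n))"
  proof (rule set_integral_mono)
    show "set_integrable lebesgue \<Omega> (\<lambda>x. norm (w n x - W x))"
      by (intro set_integrable_norm set_integral_diff w_integrable W_integrable)
    show "set_integrable lebesgue \<Omega> (\<lambda>x. 1 / 2 ^ n :: real)"
      using \<Omega>_facts(4) by (auto simp: set_integrable_def fmeasurable_def)
    show "norm (w n x - W x) \<le> 1 / 2 ^ n" for x using W_close[of x n] by (simp add: norm_minus_commute)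
  qed
  moreover have "(LINT x:\<Omega>|lebesgue. (1 / 2 ^ n :: real)) = V * (1 / 2) ^ n"
    using \<Omega>_facts(4) by (simp add: set_lebesgue_integral_def power_one_over)
  ultimately show "norm (LINT x:\<Omega>|lebesgue. norm (w n x - W x)) \<le> V * (1 / 2) ^ n" by simp
next
  show "(\<lambda>n. V * (1 / 2) ^ n) \<longlonglongrightarrow> 0" by (intro tendsto_mult_right_zero LIMSEQ_power_zero) simp
qed

text \<open>
  The two gradients differ only in \<open>R n\<close>, where the first one is \<open>X n\<close>. There the integral of \<open>|X n|\<close>
  vanishes in the limit by \<open>soaring_vanishes\<close>, and the integral of \<open>|G|\<close> does because the sets \<open>R n\<close>
  shrink to a null set.
\<close>

lemma gradient_L1_limit: "(\<lambda>n. LINT x:\<Omega>|lebesgue. norm (gradient_map (w n) x - G x)) \<longlonglongrightarrow> 0"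
proof -
  let ?F = "\<lambda>x. indicator \<Omega> x *\<^sub>R G x"
  let ?g = "\<lambda>n x. norm (X n) * indicator (R n) x + indicator (R n) x *\<^sub>R norm (?F x)"
  have Fi: "integrable lebesgue (\<lambda>x. norm (?F x))" using G_integrable unfolding set_integrable_def by (rule integrable_norm)
  have Ri: "integrable lebesgue (indicator (R n) :: _ \<Rightarrow> real)" for n using R_lmeasurable[of n] by (auto simp: fmeasurable_def)
  have RF: "integrable lebesgue (\<lambda>x. indicator (R n) x *\<^sub>R norm (?F x))" for n
    by (rule integrable_mult_indicator[OF _ Fi]) (use R_lmeasurable in blast)
  have gi: "integrable lebesgue (?g n)" for n
    by (intro Bochner_Integration.integrable_add integrable_mult_right Ri RF)
  have gv: "integral\<^sup>L lebesgue (?g n) = norm (X n) * vol (R n) + (LINT x|lebesgue. indicator (R n) x *\<^sub>R norm (?F x))" for n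
    using Ri RF by (subst Bochner_Integration.integral_add) auto
  have le: "(LINT x:\<Omega>|lebesgue. norm (gradient_map (w n) x - G x)) \<le> integral\<^sup>L lebesgue (?g n)" for n
    unfolding set_lebesgue_integral_def
  proof (rule integral_mono_AE[OF _ gi])
    show "integrable lebesgue (\<lambda>x. indicator \<Omega> x *\<^sub>R norm (gradient_map (w n) x - G x))"
      using set_integrable_norm[OF set_integral_diff(1)[OF w_integrable(2)[of n] G_integrable]] by (simp add: set_integrable_def)
    have "AE x in lebesgue. x \<notin> \<Omega> - R n - (\<Union>Y. grad_region (w n) Y \<inter> grad_region W Y)"
      by (rule AE_not_in) (use negligible_cover_off in \<open>simp add: negligible_iff_null_sets\<close>)
    then show "AE x in lebesgue. indicator \<Omega> x *\<^sub>R norm (gradient_map (w n) x - G x) \<le> ?g n x"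
    proof eventually_elim
      case (elim x)
      consider "x \<notin> \<Omega>" | "x \<in> \<Omega>" "x \<in> R n" | Y where "x \<in> grad_region (w n) Y" "x \<in> grad_region W Y"
        using elim by blast
      then show ?case
      proof cases
        case 1
        then show ?thesis by simp
      next
        case 2
        then have "gradient_map (w n) x = X n" using Rgrad gradient_map_eq by blast
        then show ?thesis using 2 norm_triangle_ineq4[of "X n" "G x"] by simp
      next
        case 3
        then have "gradient_map (w n) x = G x" using gradient_map_eq by metis
        then show ?thesis by simp
      qed
    qed
  qed
  have lim1: "(\<lambda>n. norm (X n) * vol (R n)) \<longlonglongrightarrow> 0"
  proof (rule Lim_null_comparison[OF always_eventually], rule allI)
    fix n
    have "norm (X n) * vol (R n) \<le> norm (X n) * (2 * \<beta> n * V)"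
      by (intro mult_left_mono measure_R_le) auto
    also have "\<dots> = 2 * V * norm (\<beta> n *\<^sub>R X n)" using \<beta>_pos[of n] by simp
    finally show "norm (norm (X n) * vol (R n)) \<le> 2 * V * norm (\<beta> n *\<^sub>R X n)" by simp
  next
    show "(\<lambda>n. 2 * V * norm (\<beta> n *\<^sub>R X n)) \<longlonglongrightarrow> 0"
      by (intro tendsto_mult_right_zero tendsto_norm_zero soaring_vanishes)
  qed
  have "(\<lambda>n. LINT x|lebesgue. indicator (R n) x *\<^sub>R norm (?F x)) \<longlonglongrightarrow> integral\<^sup>L (lebesgue :: (real^'m) measure) (\<lambda>x. 0 :: real)"
  proof (rule integral_dominated_convergence[where w = "\<lambda>x. norm (?F x)"])
    show "(\<lambda>x. indicator (R n) x *\<^sub>R norm (?F x)) \<in> borel_measurable lebesgue" for n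
      by (rule borel_measurable_integrable[OF RF])
    show "integrable lebesgue (\<lambda>x. norm (?F x))" by (rule Fi)
    have "AE x in lebesgue. x \<notin> (\<Inter>n. R n)"
      by (rule AE_not_in) (use negligible_Inter_R in \<open>simp add: negligible_iff_null_sets\<close>)
    then show "AE x in lebesgue. (\<lambda>n. indicator (R n) x *\<^sub>R norm (?F x)) \<longlonglongrightarrow> 0"
    proof eventually_elim
      case (elim x)
      then obtain N where N: "x \<notin> R N" by blast
      have "eventually (\<lambda>n. 0 = indicator (R n) x *\<^sub>R norm (?F x)) sequentially"
        using eventually_ge_at_top[of N]
      proof eventually_elim
        case (elim n)
        then have "x \<notin> R n" using N R_decreasing by blast
        then show ?case by simp
      qed
      then show ?case by (rule Lim_transform_eventually[OF tendsto_const])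
    qed
    show "AE x in lebesgue. norm (indicator (R n) x *\<^sub>R norm (?F x)) \<le> norm (?F x)" for n
      by (intro AE_I2) (simp add: indicator_def)
  qed simp
  then have "(\<lambda>n. integral\<^sup>L lebesgue (?g n)) \<longlonglongrightarrow> 0 + 0" unfolding gv using lim1 by (intro tendsto_add) simp_all
  then have g0: "(\<lambda>n. integral\<^sup>L lebesgue (?g n)) \<longlonglongrightarrow> 0" by simp
  show ?thesis
  proof (rule Lim_null_comparison[OF always_eventually g0], rule allI)
    fix n
    have "0 \<le> (LINT x:\<Omega>|lebesgue. norm (gradient_map (w n) x - G x))"
      unfolding set_lebesgue_integral_def by (intro Bochner_Integration.integral_nonneg) auto
    then show "norm (LINT x:\<Omega>|lebesgue. norm (gradient_map (w n) x - G x)) \<le> integral\<^sup>L lebesgue (?g n)" using le[of n] by simp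
  qed
qed

lemma W11_W: "W11_gradient \<Omega> W G"
  by (rule W11_gradient_limit[OF W11_w W_integrable G_integrable w_L1_limit gradient_L1_limit])

lemma holder_W: "holder_on \<alpha> (closure \<Omega>) W"
proof -
  obtain L where L: "\<And>x y. norm (w 0 x - w 0 y) \<le> L * norm (x - y)" using lip[of 0] unfolding lipschitz_map_def by blast
  obtain D where D: "D > 0" "\<And>x. x \<in> closure \<Omega> \<Longrightarrow> norm x \<le> D"
    using \<Omega>_facts(2) bounded_closure[of \<Omega>] unfolding bounded_pos by blast
  have "norm (W x - W y) \<le> (\<bar>L\<bar> * (2 * D) powr (1 - \<alpha>) + 1) * norm (x - y) powr \<alpha>" if "x \<in> closure \<Omega>" "y \<in> closure \<Omega>" for x y
  proof -
    let ?d = "norm (x - y)"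
    have d: "?d \<le> 2 * D" using norm_triangle_ineq4[of x y] D(2)[OF that(1)] D(2)[OF that(2)] by linarith
    have "?d = ?d powr (1 - \<alpha>) * ?d powr \<alpha>" by (cases "x = y") (auto simp: powr_add[symmetric])
    also have "\<dots> \<le> (2 * D) powr (1 - \<alpha>) * ?d powr \<alpha>" using d \<alpha> by (intro mult_right_mono powr_mono2) auto
    finally have d2: "\<bar>L\<bar> * ?d \<le> \<bar>L\<bar> * ((2 * D) powr (1 - \<alpha>) * ?d powr \<alpha>)" by (intro mult_left_mono) auto
    have "W x - W y = (w 0 x - w 0 y) + ((W x - w 0 x) - (W y - w 0 y))" by simp
    also have "norm \<dots> \<le> L * ?d + ?d powr \<alpha>" by (intro norm_triangle_mono L W_holder)
    also have "\<dots> \<le> \<bar>L\<bar> * ?d + ?d powr \<alpha>" by (intro add_right_mono mult_right_mono) auto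
    also have "\<dots> \<le> (\<bar>L\<bar> * (2 * D) powr (1 - \<alpha>) + 1) * ?d powr \<alpha>" using d2 by (simp add: algebra_simps)
    finally show ?thesis .
  qed
  then show ?thesis unfolding holder_on_def by blast
qed

text \<open>
  The constant: regions of the atoms contribute \<open>2M\<^sup>p\<close> and errors at most \<open>1\<close>, and \<open>2M\<^sup>p + 1 \<le> (3M)\<^sup>p\<close>.
\<close>

lemma W_reducing_map:
  assumes p: "1 < p" "p \<le> r" and q: "1 < q" "q \<le> r" and M: "1 \<le> M" and \<epsilon>: "\<delta> < \<epsilon>" "\<delta> \<le> 1"
    and tail: "\<And>t. 0 < t \<Longrightarrow> measure \<nu> {X. norm X > t} \<le> M powr p * (1 + norm (X 0) powr p) * t powr (- p)"
  shows "reducing_map U K p (3 * M) (X 0) b \<epsilon> \<alpha> q \<Omega> W G"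
  unfolding reducing_map_def
proof (intro conjI allI impI ballI)
  have "W \<in> W11 \<Omega>" using W11_W by (auto simp: W11_def)
  then show "piecewise_affine \<Omega> W" by (rule piecewise_affine_of_grad_regions[OF \<Omega> _ negligible_W])
  show "W11_gradient \<Omega> W G" by (rule W11_W)
  show "holder_on \<alpha> (closure \<Omega>) W" by (rule holder_W)
  show "W x = X 0 *v x + b" if "x \<in> frontier \<Omega>" for x
  proof -
    have "x \<notin> R 0" using that frontier_disjoint_eq[of \<Omega>] \<Omega>_facts(1) by (auto simp: R0)
    then show ?thesis using W_eq_off[of x 0] by (simp add: w0)
  qed
  show "AE x in lebesgue. x \<in> error_set K \<Omega> G \<longrightarrow> G x \<in> U" by (rule error_gradient)
  have "(\<integral>\<^sup>+ x\<in>error_set K \<Omega> G. ennreal ((1 + norm (G x)) powr q) \<partial>lebesgue) \<le> ennreal (\<delta> * V)"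
    using q by (intro error_integral) auto
  also have "\<dots> < ennreal (\<epsilon> * V)" using \<epsilon>(1) \<delta> V_pos by (intro ennreal_lessI) auto
  finally show "(\<integral>\<^sup>+ x\<in>error_set K \<Omega> G. ennreal ((1 + norm (G x)) powr q) \<partial>lebesgue) < ennreal (\<epsilon> * V)" .
  fix t :: real assume t: "0 < t"
  define N where "N = 1 + norm (X 0) powr p"
  have N: "1 \<le> N" by (simp add: N_def)
  have Mp: "1 \<le> M powr p" using M p by (simp add: ge_one_powr_ge_zero)
  have "(3::real) powr 1 \<le> 3 powr p" using p by (intro powr_mono) auto
  then have 3: "3 * M powr p \<le> (3 * M) powr p" using M by (simp add: powr_mult)
  have tV: "0 \<le> V * t powr (- p)" using V_pos by simp
  have "vol {x\<in>\<Omega>. norm (G x) > t} \<le> 2 * V * measure \<nu> {X. norm X > t} + \<delta> * V * t powr (- p)"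
    using p by (intro tail_upper t) auto
  also have "\<dots> \<le> 2 * V * (M powr p * N * t powr (- p)) + 1 * V * t powr (- p)"
    using tail[OF t] V_pos \<epsilon>(2) unfolding N_def by (intro add_mono mult_left_mono mult_right_mono) auto
  also have "\<dots> = (2 * (M powr p * N) + 1) * (V * t powr (- p))" by (simp add: algebra_simps)
  also have "\<dots> \<le> ((3 * M) powr p * N) * (V * t powr (- p))"
  proof (rule mult_right_mono[OF _ tV])
    have "1 * 1 \<le> M powr p * N" by (intro mult_mono) (use Mp N in auto)
    then have "2 * (M powr p * N) + 1 \<le> 3 * (M powr p * N)" by linarith
    also have "\<dots> = (3 * M powr p) * N" by simp
    also have "\<dots> \<le> (3 * M) powr p * N" using 3 N by (intro mult_right_mono) auto
    finally show "2 * (M powr p * N) + 1 \<le> (3 * M) powr p * N" .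
  qed
  finally show "vol {x\<in>\<Omega>. norm (G x) > t} \<le> (3 * M) powr p * (1 + norm (X 0) powr p) * V * t powr (- p)"
    by (simp add: N_def mult_ac)
qed

end

lemma realizable_mono:
  fixes \<omega> :: "(real^'m^'d) measure"
  assumes "realizable \<alpha> U \<rho> X \<omega>" "\<rho> \<le> \<rho>'"
  shows "realizable \<alpha> U \<rho>' X \<omega>"
  unfolding realizable_def
proof (intro allI impI)
  fix \<eta> :: real and w :: "real^'m \<Rightarrow> real^'d" and S
  assume *: "\<eta> > 0" "lipschitz_map w" "open S" "bounded S" "S \<subseteq> grad_region w X"
  obtain w' where w': "realizes \<alpha> \<eta> U \<rho> \<omega> S w w'" using assms(1) * unfolding realizable_def by meson
  then have "negligible (S - (\<Union>Y\<in>{Y. 0 < measure \<omega> {Y}} \<union> {Y\<in>U. norm Y \<le> \<rho>}. grad_region w' Y))"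
    by (simp add: realizes_def)
  then have "negligible (S - (\<Union>Y\<in>{Y. 0 < measure \<omega> {Y}} \<union> {Y\<in>U. norm Y \<le> \<rho>'}. grad_region w' Y))"
    by (rule negligible_subset) (use assms(2) in \<open>auto intro: order_trans\<close>)
  then show "\<exists>w'. realizes \<alpha> \<eta> U \<rho>' \<omega> S w w'" using w' unfolding realizes_def by blast
qed

text \<open>
  All conditions hold for all sufficiently small \<open>e\<close>.
\<close>

lemma ex_small_tolerance:
  fixes c :: "'a \<Rightarrow> real"
  assumes "finite S" "\<And>Y. Y \<in> S \<Longrightarrow> 0 < c Y" "0 < a" "0 < d" "0 \<le> k" "0 \<le> s"
  shows "\<exists>e>0. e \<le> a \<and> (\<forall>Y\<in>S. k * e \<le> c Y) \<and> k * e * s \<le> d"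
proof -
  have l: "((\<lambda>e. e) \<longlongrightarrow> 0) (at_right (0::real))" by (rule tendsto_ident_at)
  have lim: "((\<lambda>e. k * e) \<longlongrightarrow> 0) (at_right 0)" "((\<lambda>e. k * e * s) \<longlongrightarrow> 0) (at_right 0)"
    using l by (auto intro!: tendsto_mult_left_zero tendsto_mult_right_zero)
  have "eventually (\<lambda>e. 0 < e) (at_right (0::real))" by (rule eventually_at_right_less)
  moreover have "eventually (\<lambda>e. e < a) (at_right 0)" using order_tendstoD(2)[OF l assms(3)] .
  moreover have "eventually (\<lambda>e. \<forall>Y\<in>S. k * e < c Y) (at_right 0)"
    using assms(1) order_tendstoD(2)[OF lim(1) assms(2)] by (simp add: eventually_ball_finite_distrib)
  moreover have "eventually (\<lambda>e. k * e * s < d) (at_right 0)" using order_tendstoD(2)[OF lim(2) assms(4)] .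
  ultimately have "eventually (\<lambda>e. 0 < e \<and> e \<le> a \<and> (\<forall>Y\<in>S. k * e \<le> c Y) \<and> k * e * s \<le> d) (at_right 0)"
    by eventually_elim (auto simp: less_imp_le)
  then show ?thesis using eventually_happens'[of "at_right (0::real)"] by (auto simp: trivial_limit_at_right_real)
qed

text \<open>
  The bounds \<open>\<rho> n\<close> are provided by the laminates, the tolerances \<open>e n\<close> are chosen depending on them, and
  the maps are then obtained by dependent choice.
\<close>

lemma ex_staircase_realization:
  fixes U K :: "(real^'m^'d) set"
  assumes U: "open U" and st: "staircase_laminate U K X0 \<nu>" and \<alpha>: "0 < \<alpha>" "\<alpha> < 1"
    and r: "1 \<le> r" and \<delta>: "0 < \<delta>" and \<Omega>: "regular_domain \<Omega>"
  obtains X c \<beta> \<rho> e w R where "X 0 = X0" "staircase_realization K \<nu> X c \<beta> U \<alpha> r \<delta> \<rho> e \<Omega> b w R"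
proof -
  obtain X \<omega> \<beta> where X: "X 0 = X0" "\<forall>n. finite_order_laminate U (X n) (\<omega> n)"
      and dat: "staircase_data K \<nu> X (\<lambda>n Y. measure (\<omega> n) {Y}) \<beta>"
    by (rule staircase_laminate_data[OF st])
  interpret staircase_data K \<nu> X "\<lambda>n Y. measure (\<omega> n) {Y}" \<beta> by (rule dat)
  have "\<exists>\<rho>. 0 \<le> \<rho> \<and> realizable \<alpha> U \<rho> (X n) (\<omega> n)" for n
  proof -
    obtain \<rho> where "realizable \<alpha> U \<rho> (X n) (\<omega> n)"
      using finite_order_laminate_realizable[OF U \<alpha>] X(2) by blast
    then have "realizable \<alpha> U (max 0 \<rho>) (X n) (\<omega> n)" by (rule realizable_mono) simp
    then show ?thesis by (intro exI[of _ "max 0 \<rho>"]) simp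
  qed
  then obtain \<rho> where \<rho>: "\<And>n. 0 \<le> \<rho> n" "\<And>n. realizable \<alpha> U (\<rho> n) (X n) (\<omega> n)" by metis
  let ?S = "\<lambda>n. {Y. 0 < measure (\<omega> n) {Y}}"
  have "\<exists>e>0. e \<le> 1 / 2 ^ Suc n \<and> (\<forall>Y\<in>?S n. real (card (?S n)) * e \<le> measure (\<omega> n) {Y} / 2 ^ (n + 2)) \<and>
      real (card (?S n)) * e * (1 + \<rho> n) powr r \<le> \<delta> * (1 / 2) ^ Suc n" for n
    by (rule ex_small_tolerance[OF finS']) (use \<delta> in auto)
  then obtain e where e: "\<And>n. 0 < e n" "\<And>n. e n \<le> 1 / 2 ^ Suc n"
      "\<And>n. \<forall>Y\<in>?S n. real (card (?S n)) * e n \<le> measure (\<omega> n) {Y} / 2 ^ (n + 2)"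
      "\<And>n. real (card (?S n)) * e n * (1 + \<rho> n) powr r \<le> \<delta> * (1 / 2) ^ Suc n"
    by metis
  define w0 where "w0 = (\<lambda>x. X 0 *v x + b)"
  have lw0: "lipschitz_map w0"
  proof -
    obtain B where "\<And>x. norm (X 0 *v x) \<le> norm x * B"
      using bounded_linear.bounded[OF matrix_vector_mul_bounded_linear[of "X 0"]] by blast
    then have "norm (w0 x - w0 y) \<le> B * norm (x - y)" for x y
      by (simp add: w0_def matrix_vector_mult_diff_distrib[symmetric] mult.commute)
    then show ?thesis unfolding lipschitz_map_def by blast
  qed
  have sub: "\<Omega> \<subseteq> grad_region w0 (X 0)" unfolding w0_def grad_region_affine by simp
  have ob: "open \<Omega>" "bounded \<Omega>" using \<Omega> by (auto simp: regular_domain_def)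
  obtain w R where wR: "w 0 = w0" "R 0 = \<Omega>" "\<forall>n. lipschitz_map (w n)" "\<forall>n. open (R n)"
      "\<forall>n. R n \<subseteq> grad_region (w n) (X n)" "\<forall>n. R (Suc n) = R n \<inter> grad_region (w (Suc n)) (X (Suc n))"
      "\<forall>n. realizes \<alpha> (e n) U (\<rho> n) (\<omega> n) (R n) (w n) (w (Suc n))"
    by (rule ex_realization_sequence[of \<alpha> U \<rho> X \<omega> e \<Omega> w0, OF \<rho>(2) e(1) ob lw0 sub])
  have "staircase_realization K \<nu> X (\<lambda>n Y. measure (\<omega> n) {Y}) \<beta> U \<alpha> r \<delta> \<rho> e \<Omega> b w R"
  proof (unfold_locales; (rule \<alpha> r \<delta> \<rho>(1) \<Omega> e(1,2,4))?)
    show "w 0 = (\<lambda>x. X 0 *v x + b)" "R 0 = \<Omega>" using wR(1,2) by (simp_all add: w0_def)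
    show "\<And>n. lipschitz_map (w n)" "\<And>n. open (R n)" "\<And>n. R n \<subseteq> grad_region (w n) (X n)"
      "\<And>n. R (Suc n) = R n \<inter> grad_region (w (Suc n)) (X (Suc n))"
      using wR(3-6) by blast+
    show "\<And>n. modification \<alpha> (e n) (R n) (w n) (w (Suc n))"
      "\<And>n. negligible (R n - (\<Union>Y\<in>?S n \<union> {Y\<in>U. norm Y \<le> \<rho> n}. grad_region (w (Suc n)) Y))"
      "\<And>n Y. (measure (\<omega> n) {Y} - e n) * vol (R n) \<le> vol (R n \<inter> grad_region (w (Suc n)) Y)"
      using wR(7) unfolding realizes_def by blast+
    show "\<And>n Y. 0 < measure (\<omega> n) {Y} \<Longrightarrow> real (card (?S n)) * e n \<le> measure (\<omega> n) {Y} / 2 ^ (n + 2)"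
      using e(3) by blast
  qed
  then show ?thesis using that X(1) by blast
qed

theorem theorem1p3:
  fixes U K :: "(real^'m^'d) set"
    and p M mstar :: real
    and \<nu> :: "real^'m^'d \<Rightarrow> (real^'m^'d) measure"
  assumes "open U"
    and "1 < p"
    and "M \<ge> 1"
    and "mstar > 0"
    and "\<forall>X\<^sub>0\<in>U. staircase_laminate U K X\<^sub>0 (\<nu> X\<^sub>0)"
    and "\<forall>X\<^sub>0\<in>U. \<forall>t>0. measure (\<nu> X\<^sub>0) {X. norm X > t}
           \<le> M powr p * (1 + norm X\<^sub>0 powr p) * t powr (- p)"
  shows "weak_Lp_reducible U K p \<and>
    ((\<forall>X\<^sub>0\<in>U. \<forall>t>1. measure (\<nu> X\<^sub>0) {X. norm X > t} \<ge> mstar powr p * t powr (- p))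
       \<longrightarrow> weak_Lp_exactly_reducible U K p)"
proof -
  (* The same map serves both claims; the exponent r = max p q covers the tail of order p and
     the integral of order q over the errors. *)
  have main: "\<exists>w G. reducing_map U K p (3 * M) X\<^sub>0 b \<epsilon> \<alpha> q \<Omega> w G \<and>
      (\<forall>t. 1 / 2 * vol \<Omega> * measure (\<nu> X\<^sub>0) {X. norm X > t} \<le> vol {x\<in>\<Omega>. norm (G x) > t})"
    if X0: "X\<^sub>0 \<in> U" and \<epsilon>: "\<epsilon> \<in> {0<..<1}" and \<alpha>: "\<alpha> \<in> {0<..<1}" and q: "1 < q" and \<Omega>: "regular_domain \<Omega>"
    for X\<^sub>0 b \<epsilon> \<alpha> q \<Omega>
  proof -
    obtain X c \<beta> \<rho> e w R where X: "X 0 = X\<^sub>0"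
        and sr: "staircase_realization K (\<nu> X\<^sub>0) X c \<beta> U \<alpha> (max p q) (\<epsilon> / 2) \<rho> e \<Omega> b w R"
    proof (rule ex_staircase_realization[of U K X\<^sub>0 "\<nu> X\<^sub>0" \<alpha> "max p q" "\<epsilon> / 2" \<Omega> b])
      show "staircase_laminate U K X\<^sub>0 (\<nu> X\<^sub>0)" using assms(5) X0 by blast
    qed (use \<epsilon> \<alpha> q \<Omega> assms(1,2) in auto)
    interpret staircase_realization K "\<nu> X\<^sub>0" X c \<beta> U \<alpha> "max p q" "\<epsilon> / 2" \<rho> e \<Omega> b w R by (rule sr)
    have "reducing_map U K p (3 * M) (X 0) b \<epsilon> \<alpha> q \<Omega> W (gradient_map W)"
      by (rule W_reducing_map) (use assms X0 X \<epsilon> q in auto)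
    then show ?thesis using tail_lower X by blast
  qed
  have "weak_Lp_reducible U K p"
    unfolding weak_Lp_reducible_def
  proof (rule exI[of _ "3 * M"], intro conjI ballI allI impI)
    show "1 \<le> 3 * M" using assms(3) by simp
    fix X\<^sub>0 :: "real^'m^'d" and b :: "real^'d" and \<epsilon> \<alpha> q :: real and \<Omega> :: "(real^'m) set"
    assume "X\<^sub>0 \<in> U" "\<epsilon> \<in> {0<..<1}" "\<alpha> \<in> {0<..<1}" "1 < q" "regular_domain \<Omega>"
    from main[OF this] show "\<exists>w G. reducing_map U K p (3 * M) X\<^sub>0 b \<epsilon> \<alpha> q \<Omega> w G" by blast
  qed
  moreover have "weak_Lp_exactly_reducible U K p"
    if lower: "\<forall>X\<^sub>0\<in>U. \<forall>t>1. measure (\<nu> X\<^sub>0) {X. norm X > t} \<ge> mstar powr p * t powr (- p)"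
    unfolding weak_Lp_exactly_reducible_def
  proof (rule exI[of _ "3 * M"], intro conjI exI[of _ "mstar / 2"] ballI allI impI)
    show "1 \<le> 3 * M" "0 < mstar / 2" using assms(3,4) by auto
    fix X\<^sub>0 :: "real^'m^'d" and b :: "real^'d" and \<epsilon> \<alpha> q :: real and \<Omega> :: "(real^'m) set"
    assume *: "X\<^sub>0 \<in> U" "\<epsilon> \<in> {0<..<1}" "\<alpha> \<in> {0<..<1}" "1 < q" "regular_domain \<Omega>"
    obtain w G where wG: "reducing_map U K p (3 * M) X\<^sub>0 b \<epsilon> \<alpha> q \<Omega> w G"
        "\<And>t. 1 / 2 * vol \<Omega> * measure (\<nu> X\<^sub>0) {X. norm X > t} \<le> vol {x\<in>\<Omega>. norm (G x) > t}"
      using main[OF *] by blast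
    have "(mstar / 2) powr p * vol \<Omega> * t powr (- p) \<le> vol {x\<in>\<Omega>. norm (G x) > t}" if t: "1 < t" for t
    proof -
      have "(2::real) powr 1 \<le> 2 powr p" using assms(2) by (intro powr_mono) auto
      then have "mstar powr p / 2 powr p \<le> mstar powr p / 2" by (intro divide_left_mono) auto
      then have "(mstar / 2) powr p \<le> 1 / 2 * mstar powr p" using assms(4) by (simp add: powr_divide)
      then have "(mstar / 2) powr p * (vol \<Omega> * t powr (- p)) \<le> (1 / 2 * mstar powr p) * (vol \<Omega> * t powr (- p))"
        by (intro mult_right_mono) auto
      also have "\<dots> = 1 / 2 * vol \<Omega> * (mstar powr p * t powr (- p))" by simp
      also have "\<dots> \<le> 1 / 2 * vol \<Omega> * measure (\<nu> X\<^sub>0) {X. norm X > t}"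
        using lower *(1) t by (intro mult_left_mono) auto
      also note wG(2)
      finally show ?thesis by (simp add: mult.assoc)
    qed
    then show "\<exists>w G. reducing_map U K p (3 * M) X\<^sub>0 b \<epsilon> \<alpha> q \<Omega> w G \<and>
        (\<forall>t>1. (mstar / 2) powr p * vol \<Omega> * t powr (- p) \<le> vol {x\<in>\<Omega>. norm (G x) > t})"
      using wG(1) by blast
  qed
  ultimately show ?thesis by blast
qed

end
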